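(* Let $\lambda\in P^+$. (1) The set $\mathbb B^{\frac\infty2}(\lambda)\sqcup\{\mathbf 0\}$ is stable under the action of the root operators $e_i$ and $f_i$, $i\in I_{\mathrm{af}}$. (2) For $\eta\in\mathbb B^{\frac\infty2}(\lambda)$ and $i\in I_{\mathrm{af}}$ set $\varepsilon_i(\eta):=\max\{n\ge0\mid e_i^n\eta\ne\mathbf 0\}$ and $\varphi_i(\eta):=\max\{n\ge0\mid f_i^n\eta\ne\mathbf 0\}$. Then the set $\mathbb B^{\frac\infty2}(\lambda)$, equipped with the maps $\mathrm{wt}$, $e_i$, $f_i$, $\varepsilon_i$, $\varphi_i$ ($i\in I_{\mathrm{af}}$), is a crystal with weights in $P_{\mathrm{af}}$.
   Context: **Affine data.** $\mathfrak g_{\mathrm{af}}$ is an untwisted affine Lie algebra over $\mathbb C$ with simple roots $\{\alpha_i\}_{i\in I_{\mathrm{af}}}$, simple coroots $\{\alpha_i^\vee\}$, pairing $\langle\cdot,\cdot\rangle$, null root $\delta=\sum a_i\alpha_i$, canonical central element $c=\sum a_i^\vee\alpha_i^\vee$. Fix $0\in I_{\mathrm{af}}$ with $a_0=a_0^\vee=1$; $I=I_{\mathrm{af}}\setminus\{0\}$. $P_{\mathrm{af}}\subset\mathfrak h_{\mathrm{af}}^*$ is an integral weight lattice containing all $\alpha_i$, on which all $\alpha_i^\vee$ are integer valued, and containing $\Lambda_i$ ($i\in I_{\mathrm{af}}$) with $\langle\alpha_j^\vee,\Lambda_i\rangle=\delta_{ij}$. $\varpi_i=\Lambda_i-\langle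 c,\Lambda_i\rangle\Lambda_0$ for $i\in I$; $P^+=\sum_{i\in I}\mathbb Z_{\ge0}\varpi_i$; $Q^\vee=\bigoplus_{i\in I}\mathbb Z\alpha_i^\vee$. $W_{\mathrm{af}}=\langle r_i\mid i\in I_{\mathrm{af}}\rangle=W\ltimes\{t_\xi\mid\xi\in Q^\vee\}$, $W=\langle r_i\mid i\in I\rangle$, $t_\xi$ the translation by $\xi$; $wt_\xi\mu=w\mu-\langle\xi,\mu\rangle\delta$ if $\langle c,\mu\rangle=0$. $\Delta$ is the finite root system for $I$, $\Delta^+$ its positive roots; real roots $\Delta_{\mathrm{af}}=\{\alpha+n\delta\mid\alpha\in\Delta,n\in\mathbb Z\}$, $\Delta_{\mathrm{af}}^+=\Delta^+\sqcup\{\alpha+n\delta\mid\alpha\in\Delta,n>0\}$; $r_\beta$, $\beta^\vee$ are the reflection and coroot of $\beta$. **SiLS paths.** For $J\subset I$: $\Delta_J=\Delta\cap\bigoplus_{j\in J}\mathbb Z\alpha_j$, $(\Delta_J)_{\mathrm{af}}^+=\{\alpha+n\delta\mid \alpha\in\Delta_J,n\in\mathbb Z\}\cap\Delta_{\mathrm{af}}^+$, $(W^J)_{\mathrm{af}}=\{x\in W_{\mathrm{af}}\mid x\beta\in\Delta_{\mathrm{af}}^+\ \forall\beta\in(\Delta_J)_{\mathrm{af}}^+\}$. For $x=vt_\zeta$ ($v\in W,\zeta\in Q^\vee$), $\ell^{\frac\infty2}(x)=\ell(v)+2\langle\zeta,\rho\rangle$, $\rho=\frac12\sum_{\alpha\in\Delta^+}\alpha$.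 The graph $\mathrm{SiB}^J$ has vertex set $(W^J)_{\mathrm{af}}$ and edges $x\xrightarrow{\beta}r_\beta x$ for $x\in(W^J)_{\mathrm{af}},\beta\in\Delta_{\mathrm{af}}^+$ with $r_\beta x\in(W^J)_{\mathrm{af}}$ and $\ell^{\frac\infty2}(r_\beta x)=\ell^{\frac\infty2}(x)+1$; $x\le_{\frac\infty2}y$ means there is a directed path from $x$ to $y$ in $\mathrm{SiB}^J$. For $\lambda\in P^+$, $J=\{i\in I\mid\langle\alpha_i^\vee,\lambda\rangle=0\}$ and rational $0<a\le1$, $\mathrm{SiB}(\lambda;a)$ is the subgraph of $\mathrm{SiB}^J$ with the same vertices and only the edges $x\xrightarrow{\beta}y$ with $a\langle\beta^\vee,x\lambda\rangle\in\mathbb Z$. $\mathbb B^{\frac\infty2}(\lambda)$ is the set of SiLS paths of shape $\lambda$: pairs $\eta=(x_1,\dots,x_s;a_0,\dots,a_s)$ with $x_1>_{\frac\infty2}\cdots>_{\frac\infty2}x_s$ in $(W^J)_{\mathrm{af}}$ and rationals $0=a_0<\cdots<a_s=1$ such that for each $1\le u\le s-1$ there is a directed path from $x_{u+1}$ to $x_u$ in $\mathrm{SiB}(\lambda;a_u)$. **Root operators.** Let $\overline\eta:[0,1]\to\mathbb R\otimes_{\mathbb Z} P_{\mathrm{af}}$ be the piecewise-linear path with $\overline\eta(0)=0$ and direction $x_u\lambda$ on $[a_{u-1},a_u]$ (this is an LS path of shape $\lambda$ in Littelmann's sense); $\mathrm{wt}(\eta)=\overline\eta(1)\in P_{\mathrm{af}}$.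 For $i\in I_{\mathrm{af}}$ put $H(t)=\langle\alpha_i^\vee,\overline\eta(t)\rangle$, $m=\min_{[0,1]}H$ (all local minima of $H$ are integers). $e_i\eta:=\mathbf 0$ if $m=0$; if $m\le-1$, let $t_1=\min\{t\mid H(t)=m\}$, $t_0=\max\{t\in[0,t_1]\mid H(t)=m+1\}$, $t_1=a_q$, $a_{p-1}\le t_0<a_p$, and $e_i\eta:=(x_1,\dots,x_p,r_ix_p,\dots,r_ix_q,x_{q+1},\dots,x_s;a_0,\dots,a_{p-1},t_0,a_p,\dots,a_q=t_1,\dots,a_s)$, dropping $x_p,a_{p-1}$ if $t_0=a_{p-1}$, and dropping $x_{q+1},a_q$ if $r_ix_q=x_{q+1}$. $f_i\eta:=\mathbf 0$ if $H(1)=m$; otherwise let $t_0=\max\{t\mid H(t)=m\}$, $t_1=\min\{t\in[t_0,1]\mid H(t)=m+1\}$, $t_0=a_p$, $a_q<t_1\le a_{q+1}$, and $f_i\eta:=(x_1,\dots,x_p,r_ix_{p+1},\dots,r_ix_{q+1},x_{q+1},\dots,x_s;a_0,\dots,a_p=t_0,\dots,a_q,t_1,a_{q+1},\dots,a_s)$, dropping $x_{q+1},a_{q+1}$ if $t_1=a_{q+1}$, and dropping $x_p,a_p$ if $x_p=r_ix_{p+1}$. Also $e_i\mathbf 0=f_i\mathbf 0=\mathbf 0$; $\mathbf 0$ is an extra element. "Crystal" is in the sense of Kashiwara. *)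

theory Defs
  imports "HOL-Analysis.Analysis"
begin

section \<open>Untwisted affine root data\<close>

text \<open>
  The type \<open>'i\<close> is the index set \<open>I_af\<close>, and \<open>'v\<close> is the real form of the dual Cartan subalgebra,
  that is, \<open>R \<otimes> P_af\<close>.  A coroot is given as the functional on \<open>'v\<close> that it induces.
\<close>

record ('i, 'v) affine_datum =
  simple_root :: "'i \<Rightarrow> 'v"
  simple_coroot :: "'i \<Rightarrow> 'v \<Rightarrow> real"
  mark :: "'i \<Rightarrow> nat"
  comark :: "'i \<Rightarrow> nat"
  node0 :: 'i
  weight_lattice :: "'v set"
  fund_weight :: "'i \<Rightarrow> 'v"

definition cartan :: "('i, 'v, 'z) affine_datum_scheme \<Rightarrow> 'i \<Rightarrow> 'i \<Rightarrow> real" where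
  "cartan D i j = simple_coroot D i (simple_root D j)"

definition generalized_cartan_matrix :: "('i \<Rightarrow> 'i \<Rightarrow> real) \<Rightarrow> bool" where
  "generalized_cartan_matrix A \<longleftrightarrow>
     (\<forall>i j. A i j \<in> \<int>) \<and> (\<forall>i. A i i = 2) \<and> (\<forall>i j. i \<noteq> j \<longrightarrow> A i j \<le> 0) \<and>
     (\<forall>i j. A i j = 0 \<longleftrightarrow> A j i = 0)"

definition indecomposable_matrix :: "('i \<Rightarrow> 'i \<Rightarrow> real) \<Rightarrow> bool" where
  "indecomposable_matrix A \<longleftrightarrow>
     (\<forall>S. S \<noteq> {} \<and> S \<noteq> UNIV \<longrightarrow> (\<exists>i\<in>S. \<exists>j\<in>- S. A i j \<noteq> 0))"

text \<open>
  Case (Aff) of the trichotomy of indecomposable generalized Cartan matrices in Kac's book: the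
  corank is 1, the kernel contains a positive vector \<open>u\<close>, and \<open>A v \<ge> 0\<close> implies \<open>A v = 0\<close>.
\<close>

definition affine_type :: "('i::finite \<Rightarrow> 'i \<Rightarrow> real) \<Rightarrow> bool" where
  "affine_type A \<longleftrightarrow>
     generalized_cartan_matrix A \<and> indecomposable_matrix A \<and>
     (\<exists>u. (\<forall>i. 0 < u i) \<and>
          (\<forall>v. (\<forall>i. (\<Sum>j\<in>UNIV. A i j * v j) = 0) \<longleftrightarrow> (\<exists>k. \<forall>i. v i = k * u i))) \<and>
     (\<forall>v. (\<forall>i. 0 \<le> (\<Sum>j\<in>UNIV. A i j * v j)) \<longrightarrow> (\<forall>i. (\<Sum>j\<in>UNIV. A i j * v j) = 0))"

definition fin_nodes :: "('i, 'v, 'z) affine_datum_scheme \<Rightarrow> 'i set" where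
  "fin_nodes D = UNIV - {node0 D}"

definition null_root :: "('i::finite, 'v::real_vector, 'z) affine_datum_scheme \<Rightarrow> 'v" where
  "null_root D = (\<Sum>i\<in>UNIV. real (mark D i) *\<^sub>R simple_root D i)"

definition central :: "('i::finite, 'v, 'z) affine_datum_scheme \<Rightarrow> 'v \<Rightarrow> real" where
  "central D \<mu> = (\<Sum>i\<in>UNIV. real (comark D i) * simple_coroot D i \<mu>)"


subsection \<open>Weyl groups, as groups of linear maps\<close>

definition simple_refl ::
  "('i, 'v::real_vector, 'z) affine_datum_scheme \<Rightarrow> 'i \<Rightarrow> 'v \<Rightarrow> 'v" where
  "simple_refl D i \<mu> = \<mu> - simple_coroot D i \<mu> *\<^sub>R simple_root D i"

definition weyl_word ::
  "('i, 'v::real_vector, 'z) affine_datum_scheme \<Rightarrow> 'i list \<Rightarrow> 'v \<Rightarrow> 'v" where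
  "weyl_word D w = foldr (\<lambda>i g. simple_refl D i \<circ> g) w id"

definition weyl_af :: "('i, 'v::real_vector, 'z) affine_datum_scheme \<Rightarrow> ('v \<Rightarrow> 'v) set" where
  "weyl_af D = range (weyl_word D)"

definition weyl_fin :: "('i, 'v::real_vector, 'z) affine_datum_scheme \<Rightarrow> ('v \<Rightarrow> 'v) set" where
  "weyl_fin D = weyl_word D ` lists (fin_nodes D)"

definition weyl_length ::
  "('i, 'v::real_vector, 'z) affine_datum_scheme \<Rightarrow> ('v \<Rightarrow> 'v) \<Rightarrow> nat" where
  "weyl_length D v = (LEAST k. \<exists>w\<in>lists (fin_nodes D). length w = k \<and> weyl_word D w = v)"


subsection \<open>Roots\<close>

definition root_lattice ::
  "('i::finite, 'v::real_vector, 'z) affine_datum_scheme \<Rightarrow> 'i set \<Rightarrow> 'v set" where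
  "root_lattice D J = range (\<lambda>n :: 'i \<Rightarrow> int. \<Sum>j\<in>J. real_of_int (n j) *\<^sub>R simple_root D j)"

definition pos_root_cone :: "('i::finite, 'v::real_vector, 'z) affine_datum_scheme \<Rightarrow> 'v set" where
  "pos_root_cone D =
     range (\<lambda>n :: 'i \<Rightarrow> nat. \<Sum>j\<in>fin_nodes D. real (n j) *\<^sub>R simple_root D j)"

definition fin_roots :: "('i, 'v::real_vector, 'z) affine_datum_scheme \<Rightarrow> 'v set" where
  "fin_roots D = {w (simple_root D i) | w i. w \<in> weyl_fin D \<and> i \<in> fin_nodes D}"

definition fin_pos_roots :: "('i::finite, 'v::real_vector, 'z) affine_datum_scheme \<Rightarrow> 'v set" where
  "fin_pos_roots D = fin_roots D \<inter> pos_root_cone D"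

definition af_pos_roots :: "('i::finite, 'v::real_vector, 'z) affine_datum_scheme \<Rightarrow> 'v set" where
  "af_pos_roots D =
     fin_pos_roots D \<union>
     {\<alpha> + real_of_int n *\<^sub>R null_root D | \<alpha> n. \<alpha> \<in> fin_roots D \<and> 0 < n}"

text \<open>
  The coroot of the real root \<open>w \<alpha>\<^sub>i\<close> is \<open>w \<alpha>\<^sub>i\<^sup>\<or>\<close>, which depends only on the root.
\<close>

definition coroot_of ::
  "('i, 'v::real_vector, 'z) affine_datum_scheme \<Rightarrow> 'v \<Rightarrow> 'v \<Rightarrow> real" where
  "coroot_of D \<beta> =
     (THE h. \<exists>w\<in>weyl_af D. \<exists>i. \<beta> = w (simple_root D i) \<and> h = simple_coroot D i \<circ> inv w)"

definition root_refl :: "('i, 'v::real_vector, 'z) affine_datum_scheme \<Rightarrow> 'v \<Rightarrow> 'v \<Rightarrow> 'v" where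
  "root_refl D \<beta> \<mu> = \<mu> - coroot_of D \<beta> \<mu> *\<^sub>R \<beta>"


subsection \<open>The standing assumptions\<close>

text \<open>
  A lattice is the integer span of a real basis.  A realization of an affine Cartan matrix of size
  \<open>n\<close> has dimension \<open>n + 1\<close>.  The last two assumptions say that the affine Cartan matrix is the
  extended Cartan matrix of the finite root system of \<open>I\<close>, i.e. that \<open>\<alpha>\<^sub>0 = \<delta> - \<theta>\<close> with \<open>\<theta>\<close> the
  highest root; among the affine types with \<open>a\<^sub>0 = a\<^sub>0\<^sup>\<or> = 1\<close> these are the untwisted ones.
\<close>

locale untwisted_affine =
  fixes D :: "('i::finite, 'v::real_vector) affine_datum"
  assumes affine: "affine_type (cartan D)"
    and linear_coroot: "linear (simple_coroot D i)"
    and inj_simple_root: "inj (simple_root D)"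
    and independent_simple_roots: "independent (range (simple_root D))"
    and lattice: "\<exists>B. finite B \<and> card B = CARD('i) + 1 \<and> independent B \<and> span B = UNIV \<and>
          weight_lattice D = range (\<lambda>n :: 'v \<Rightarrow> int. \<Sum>b\<in>B. real_of_int (n b) *\<^sub>R b)"
    and simple_root_in_lattice: "simple_root D i \<in> weight_lattice D"
    and coroot_integral: "\<mu> \<in> weight_lattice D \<Longrightarrow> simple_coroot D i \<mu> \<in> \<int>"
    and fund_weight_in_lattice: "fund_weight D i \<in> weight_lattice D"
    and coroot_fund_weight: "simple_coroot D j (fund_weight D i) = (if i = j then 1 else 0)"
    and mark_pos: "0 < mark D i"
    and mark_coprime: "Gcd (range (mark D)) = 1"
    and mark_kernel: "(\<Sum>j\<in>UNIV. cartan D i j * real (mark D j)) = 0"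
    and comark_pos: "0 < comark D i"
    and comark_coprime: "Gcd (range (comark D)) = 1"
    and comark_kernel: "(\<Sum>j\<in>UNIV. real (comark D j) * cartan D j i) = 0"
    and mark_node0: "mark D (node0 D) = 1"
    and comark_node0: "comark D (node0 D) = 1"
    and theta_root: "null_root D - simple_root D (node0 D) \<in> fin_roots D"
    and theta_highest: "\<beta> \<in> fin_roots D \<Longrightarrow>
          null_root D - simple_root D (node0 D) - \<beta> \<in> pos_root_cone D"


subsection \<open>Level-zero dominant weights and translations\<close>

definition level_zero_fund_weight ::
  "('i::finite, 'v::real_vector, 'z) affine_datum_scheme \<Rightarrow> 'i \<Rightarrow> 'v" where
  "level_zero_fund_weight D i =
     fund_weight D i - central D (fund_weight D i) *\<^sub>R fund_weight D (node0 D)"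

definition dominant_weights ::
  "('i::finite, 'v::real_vector, 'z) affine_datum_scheme \<Rightarrow> 'v set" where
  "dominant_weights D =
     range (\<lambda>n :: 'i \<Rightarrow> nat. \<Sum>i\<in>fin_nodes D. real (n i) *\<^sub>R level_zero_fund_weight D i)"

text \<open>
  An element of \<open>Q\<^sup>\<or>\<close> is represented by its integer coordinates \<open>\<xi>\<close> with respect to the simple
  coroots with index in \<open>I\<close>; the coordinate at the node 0 is ignored.  The map \<open>nu_coroot\<close> is the
  isomorphism given by the normalized invariant form, with \<open>a\<^sub>i\<^sup>\<or> \<nu>(\<alpha>\<^sub>i\<^sup>\<or>) = a\<^sub>i \<alpha>\<^sub>i\<close>, and the translation is
  \<open>t\<^sub>\<xi> \<mu> = \<mu> + \<langle>c,\<mu>\<rangle> \<nu>(\<xi>) - (\<langle>\<xi>,\<mu>\<rangle> + (1/2) \<bar>\<nu>(\<xi>)\<bar>\<^sup>2 \<langle>c,\<mu>\<rangle>) \<delta>\<close>, where \<open>\<bar>\<nu>(\<xi>)\<bar>\<^sup>2 = \<langle>\<xi>,\<nu>(\<xi>)\<rangle>\<close>.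
\<close>

definition coroot_pairing ::
  "('i::finite, 'v, 'z) affine_datum_scheme \<Rightarrow> ('i \<Rightarrow> int) \<Rightarrow> 'v \<Rightarrow> real" where
  "coroot_pairing D \<xi> \<mu> = (\<Sum>i\<in>fin_nodes D. real_of_int (\<xi> i) * simple_coroot D i \<mu>)"

definition nu_coroot ::
  "('i::finite, 'v::real_vector, 'z) affine_datum_scheme \<Rightarrow> ('i \<Rightarrow> int) \<Rightarrow> 'v" where
  "nu_coroot D \<xi> =
     (\<Sum>i\<in>fin_nodes D.
        (real_of_int (\<xi> i) * real (mark D i) / real (comark D i)) *\<^sub>R simple_root D i)"

definition translation ::
  "('i::finite, 'v::real_vector, 'z) affine_datum_scheme \<Rightarrow> ('i \<Rightarrow> int) \<Rightarrow> 'v \<Rightarrow> 'v" where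
  "translation D \<xi> \<mu> =
     \<mu> + central D \<mu> *\<^sub>R nu_coroot D \<xi>
       - (coroot_pairing D \<xi> \<mu> + coroot_pairing D \<xi> (nu_coroot D \<xi>) / 2 * central D \<mu>)
           *\<^sub>R null_root D"


section \<open>Semi-infinite Lakshmibai-Seshadri paths\<close>

definition half_sum_pos :: "('i::finite, 'v::real_vector, 'z) affine_datum_scheme \<Rightarrow> 'v" where
  "half_sum_pos D = (1 / 2) *\<^sub>R (\<Sum>\<alpha>\<in>fin_pos_roots D. \<alpha>)"

definition semi_inf_length ::
  "('i::finite, 'v::real_vector, 'z) affine_datum_scheme \<Rightarrow> ('v \<Rightarrow> 'v) \<Rightarrow> real" where
  "semi_inf_length D x =
     (THE l. \<exists>v\<in>weyl_fin D. \<exists>\<zeta>. x = v \<circ> translation D \<zeta> \<and>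
        l = real (weyl_length D v) + 2 * coroot_pairing D \<zeta> (half_sum_pos D))"

definition af_pos_roots_J ::
  "('i::finite, 'v::real_vector, 'z) affine_datum_scheme \<Rightarrow> 'i set \<Rightarrow> 'v set" where
  "af_pos_roots_J D J =
     {\<alpha> + real_of_int n *\<^sub>R null_root D | \<alpha> n. \<alpha> \<in> fin_roots D \<inter> root_lattice D J}
       \<inter> af_pos_roots D"

definition weyl_J_af ::
  "('i::finite, 'v::real_vector, 'z) affine_datum_scheme \<Rightarrow> 'i set \<Rightarrow> ('v \<Rightarrow> 'v) set" where
  "weyl_J_af D J = {x \<in> weyl_af D. \<forall>\<beta>\<in>af_pos_roots_J D J. x \<beta> \<in> af_pos_roots D}"

definition SiB_edge ::
  "('i::finite, 'v::real_vector, 'z) affine_datum_scheme \<Rightarrow> 'i set \<Rightarrow>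
     ('v \<Rightarrow> 'v) \<Rightarrow> 'v \<Rightarrow> ('v \<Rightarrow> 'v) \<Rightarrow> bool" where
  "SiB_edge D J x \<beta> y \<longleftrightarrow>
     x \<in> weyl_J_af D J \<and> \<beta> \<in> af_pos_roots D \<and> y = root_refl D \<beta> \<circ> x \<and>
     y \<in> weyl_J_af D J \<and> semi_inf_length D y = semi_inf_length D x + 1"

definition si_le ::
  "('i::finite, 'v::real_vector, 'z) affine_datum_scheme \<Rightarrow> 'i set \<Rightarrow>
     ('v \<Rightarrow> 'v) \<Rightarrow> ('v \<Rightarrow> 'v) \<Rightarrow> bool" where
  "si_le D J = (\<lambda>x y. \<exists>\<beta>. SiB_edge D J x \<beta> y)\<^sup>*\<^sup>*"

definition si_less ::
  "('i::finite, 'v::real_vector, 'z) affine_datum_scheme \<Rightarrow> 'i set \<Rightarrow>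
     ('v \<Rightarrow> 'v) \<Rightarrow> ('v \<Rightarrow> 'v) \<Rightarrow> bool" where
  "si_less D J x y \<longleftrightarrow> si_le D J x y \<and> x \<noteq> y"

definition stab_nodes :: "('i, 'v, 'z) affine_datum_scheme \<Rightarrow> 'v \<Rightarrow> 'i set" where
  "stab_nodes D lam = {i \<in> fin_nodes D. simple_coroot D i lam = 0}"

definition SiB_path ::
  "('i::finite, 'v::real_vector, 'z) affine_datum_scheme \<Rightarrow> 'v \<Rightarrow> real \<Rightarrow>
     ('v \<Rightarrow> 'v) \<Rightarrow> ('v \<Rightarrow> 'v) \<Rightarrow> bool" where
  "SiB_path D lam a =
     (\<lambda>x y. \<exists>\<beta>. SiB_edge D (stab_nodes D lam) x \<beta> y \<and> a * coroot_of D \<beta> (x lam) \<in> \<int>)\<^sup>*\<^sup>*"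

text \<open>
  The tuple \<open>(x\<^sub>1, \<dots>, x\<^sub>s; a\<^sub>0, \<dots>, a\<^sub>s)\<close> is the pair \<open>(xs, as)\<close> of lists, so that \<open>x\<^sub>u = xs ! (u - 1)\<close>
  and \<open>a\<^sub>u = as ! u\<close>.
\<close>

type_synonym 'v sils = "('v \<Rightarrow> 'v) list \<times> real list"

definition SiLS ::
  "('i::finite, 'v::real_vector, 'z) affine_datum_scheme \<Rightarrow> 'v \<Rightarrow> 'v sils set" where
  "SiLS D lam = {(xs, as).
     set xs \<subseteq> weyl_J_af D (stab_nodes D lam) \<and>
     (\<forall>u\<in>{1..<length xs}. si_less D (stab_nodes D lam) (xs ! u) (xs ! (u - 1))) \<and>
     length as = length xs + 1 \<and> set as \<subseteq> \<rat> \<and>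
     as ! 0 = 0 \<and> as ! length xs = 1 \<and> (\<forall>u<length xs. as ! u < as ! (u + 1)) \<and>
     (\<forall>u\<in>{1..<length xs}. SiB_path D lam (as ! u) (xs ! u) (xs ! (u - 1)))}"

text \<open>
  On \<open>[0, 1]\<close>, the time that the path has spent by time \<open>t\<close> in the direction \<open>x\<^sub>u \<lambda>\<close> of
  \<open>[a\<^sub>u\<^sub>-\<^sub>1, a\<^sub>u]\<close> is \<open>min t a\<^sub>u - min t a\<^sub>u\<^sub>-\<^sub>1\<close>.
\<close>

fun sils_path :: "'v::real_vector \<Rightarrow> 'v sils \<Rightarrow> real \<Rightarrow> 'v" where
  "sils_path lam (xs, as) t =
     (\<Sum>u<length xs. (min t (as ! (u + 1)) - min t (as ! u)) *\<^sub>R (xs ! u) lam)"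

definition wt :: "'v::real_vector \<Rightarrow> 'v sils \<Rightarrow> 'v" where
  "wt lam \<eta> = sils_path lam \<eta> 1"


section \<open>Root operators\<close>

definition H_fun ::
  "('i, 'v::real_vector, 'z) affine_datum_scheme \<Rightarrow> 'v \<Rightarrow> 'i \<Rightarrow> 'v sils \<Rightarrow> real \<Rightarrow> real" where
  "H_fun D lam i \<eta> t = simple_coroot D i (sils_path lam \<eta> t)"

definition H_min ::
  "('i, 'v::real_vector, 'z) affine_datum_scheme \<Rightarrow> 'v \<Rightarrow> 'i \<Rightarrow> 'v sils \<Rightarrow> real" where
  "H_min D lam i \<eta> = (LEAST y. y \<in> H_fun D lam i \<eta> ` {0..1})"

text \<open>
  The element \<open>\<zero>\<close> is \<^term>\<open>None\<close>.  In \<open>root_e\<close>, \<open>dl\<close> and \<open>dr\<close> say whether the entries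
  \<open>x\<^sub>p, a\<^sub>p\<^sub>-\<^sub>1\<close> and \<open>x\<^sub>q\<^sub>+\<^sub>1, a\<^sub>q\<close>, respectively, are dropped; in \<open>root_f\<close>, they refer to \<open>x\<^sub>p, a\<^sub>p\<close> and
  \<open>x\<^sub>q\<^sub>+\<^sub>1, a\<^sub>q\<^sub>+\<^sub>1\<close>.  Nothing is dropped when \<open>x\<^sub>q\<^sub>+\<^sub>1\<close> (for \<open>q = s\<close>) or \<open>x\<^sub>p\<close> (for \<open>p = 0\<close>) does not exist.
\<close>

fun root_e ::
  "('i, 'v::real_vector, 'z) affine_datum_scheme \<Rightarrow> 'v \<Rightarrow> 'i \<Rightarrow> 'v sils \<Rightarrow> 'v sils option" where
  "root_e D lam i (xs, as) =
     (let H = H_fun D lam i (xs, as); m = H_min D lam i (xs, as) in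
      if m = 0 then None
      else
       (let s = length xs;
            t1 = (LEAST t. t \<in> {0..1} \<and> H t = m);
            t0 = (GREATEST t. t \<in> {0..t1} \<and> H t = m + 1);
            q = (THE q. q \<le> s \<and> as ! q = t1);
            p = (THE p. 1 \<le> p \<and> p \<le> s \<and> as ! (p - 1) \<le> t0 \<and> t0 < as ! p);
            dl = (t0 = as ! (p - 1));
            dr = (q < s \<and> simple_refl D i \<circ> xs ! (q - 1) = xs ! q)
        in Some
         (take (if dl then p - 1 else p) xs
            @ map ((\<circ>) (simple_refl D i)) (drop (p - 1) (take q xs))
            @ drop (if dr then q + 1 else q) xs,
          take (if dl then p - 1 else p) as
            @ [t0] @ drop p (take q as)
            @ drop (if dr then q + 1 else q) as)))"

fun root_f ::
  "('i, 'v::real_vector, 'z) affine_datum_scheme \<Rightarrow> 'v \<Rightarrow> 'i \<Rightarrow> 'v sils \<Rightarrow> 'v sils option" where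
  "root_f D lam i (xs, as) =
     (let H = H_fun D lam i (xs, as); m = H_min D lam i (xs, as) in
      if H 1 = m then None
      else
       (let s = length xs;
            t0 = (GREATEST t. t \<in> {0..1} \<and> H t = m);
            t1 = (LEAST t. t \<in> {t0..1} \<and> H t = m + 1);
            p = (THE p. p \<le> s \<and> as ! p = t0);
            q = (THE q. q < s \<and> as ! q < t1 \<and> t1 \<le> as ! (q + 1));
            dl = (1 \<le> p \<and> xs ! (p - 1) = simple_refl D i \<circ> xs ! p);
            dr = (t1 = as ! (q + 1))
        in Some
         (take (if dl then p - 1 else p) xs
            @ map ((\<circ>) (simple_refl D i)) (drop p (take (q + 1) xs))
            @ drop (if dr then q + 1 else q) xs,
          take (if dl then p else p + 1) as
            @ drop (p + 1) (take (q + 1) as) @ [t1]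
            @ drop (if dr then q + 2 else q + 1) as)))"

definition op_power :: "('b \<Rightarrow> 'b option) \<Rightarrow> nat \<Rightarrow> 'b \<Rightarrow> 'b option" where
  "op_power g n b = ((\<lambda>z. Option.bind z g) ^^ n) (Some b)"

definition op_depth :: "('b \<Rightarrow> 'b option) \<Rightarrow> 'b \<Rightarrow> nat" where
  "op_depth g b = Max {n. op_power g n b \<noteq> None}"


section \<open>Crystals in the sense of Kashiwara\<close>

locale crystal =
  fixes D :: "('i::finite, 'v::real_vector) affine_datum"
    and B :: "'b set"
    and weight :: "'b \<Rightarrow> 'v"
    and e f :: "'i \<Rightarrow> 'b \<Rightarrow> 'b option"
    and eps phi :: "'i \<Rightarrow> 'b \<Rightarrow> ereal"
  assumes weight_in: "b \<in> B \<Longrightarrow> weight b \<in> weight_lattice D"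
    and e_in: "b \<in> B \<Longrightarrow> e i b \<in> insert None (Some ` B)"
    and f_in: "b \<in> B \<Longrightarrow> f i b \<in> insert None (Some ` B)"
    and eps_in: "b \<in> B \<Longrightarrow> eps i b \<in> insert (- \<infinity>) (range (\<lambda>n :: int. ereal (of_int n)))"
    and phi_in: "b \<in> B \<Longrightarrow> phi i b \<in> insert (- \<infinity>) (range (\<lambda>n :: int. ereal (of_int n)))"
    and phi_eps: "b \<in> B \<Longrightarrow> phi i b = eps i b + ereal (simple_coroot D i (weight b))"
    and weight_e: "b \<in> B \<Longrightarrow> e i b = Some b' \<Longrightarrow> weight b' = weight b + simple_root D i"
    and eps_e: "b \<in> B \<Longrightarrow> e i b = Some b' \<Longrightarrow> eps i b' = eps i b - 1"
    and phi_e: "b \<in> B \<Longrightarrow> e i b = Some b' \<Longrightarrow> phi i b' = phi i b + 1"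
    and weight_f: "b \<in> B \<Longrightarrow> f i b = Some b' \<Longrightarrow> weight b' = weight b - simple_root D i"
    and eps_f: "b \<in> B \<Longrightarrow> f i b = Some b' \<Longrightarrow> eps i b' = eps i b + 1"
    and phi_f: "b \<in> B \<Longrightarrow> f i b = Some b' \<Longrightarrow> phi i b' = phi i b - 1"
    and e_iff_f: "b \<in> B \<Longrightarrow> b' \<in> B \<Longrightarrow> e i b = Some b' \<longleftrightarrow> f i b' = Some b"
    and phi_minus_infinity: "b \<in> B \<Longrightarrow> phi i b = - \<infinity> \<Longrightarrow> e i b = None \<and> f i b = None"

end

theory Submission
  imports Defs
begin

text \<open>
  The semi-infinite length of \<open>x\<close> is a signed count of inversions: it is the sum over the positive
  finite roots \<open>\<beta>\<close> of the least \<open>n\<close> with \<open>x (\<beta> + n \<delta>) > 0\<close>.  Hence a simple reflection \<open>r\<^sub>i\<close> changes the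
  length of \<open>x\<close> relative to the stabilizer of \<open>\<lambda>\<close> by the sign of \<open>\<langle>\<alpha>\<^sub>i\<^sup>\<or>, x \<lambda>\<rangle>\<close>, and by induction on the height a
  reflection in a positive root \<open>\<beta>\<close> with \<open>\<langle>\<beta>\<^sup>\<or>, x \<lambda>\<rangle> > 0\<close> increases it.  So along an edge with label
  different from \<open>\<alpha>\<^sub>i\<close> the sign of \<open>\<langle>\<alpha>\<^sub>i\<^sup>\<or>, x \<lambda>\<rangle>\<close> cannot decrease, and an edge between vertices of equal
  nonzero sign may be reflected by \<open>r\<^sub>i\<close>.  This gives the lifting properties of paths in \<open>SiB(\<lambda>; a)\<close>
  and forces the values of \<open>H\<close> at its turning points to be integers.  Both root operators reflect the
  path on an interval on which \<open>H\<close> is monotone and changes by 1, so they are mutually inverse and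
  shift the minimum of \<open>H\<close> by 1; thus \<open>\<epsilon>\<^sub>i = - min H\<close> and \<open>\<phi>\<^sub>i = H 1 - min H\<close>.
\<close>

text \<open>Only the Cartan matrix and its two kernel vectors are given, so root theory has to be
  built from an invariant form, and the form needs symmetrizability. This is derived from the kernel
  vectors themselves, with no classification of diagrams. Real affine roots are finite roots shifted
  by multiples of \<open>\<delta>\<close>; that they are conjugate to simple roots is a result, not
  a definition.

  Two obstacles shape the study of paths. The set \<open>WJ\<close> is not stable under a simple
  reflection that fixes \<open>x lam\<close>; hence lengths are compared through
  \<open>rel_length\<close>, which is defined on the whole affine Weyl group and changes by the sign
  of the slope even when that sign is zero. And a path between two vertices with slopes of the same
  sign may change sign in between, where it cannot be reflected edge by edge; an edge that lowers
  the sign joins mirror images and serves as a shortcut.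

  All integrality stems from one lattice fact: along \<open>SiB(\<lambda>; a)\<close> the vector
  \<open>a\<close> times \<open>x lam\<close> is constant modulo the weight lattice, so a path at
  time \<open>t\<close> is congruent to \<open>t\<close> times its current direction.\<close>

section \<open>Symmetrizability and quadratic forms of affine matrices\<close>

text \<open>Scaling rows by \<open>b\<close> and columns by \<open>a\<close> gives a matrix
  \<open>M\<close> with vanishing row and column sums. So \<open>M\<close> minus its transpose is a
  circulation, and a nonzero circulation contains a directed cycle. Along this cycle the inequality
  of arithmetic and geometric means makes \<open>u\<close> strictly concave, which is impossible on
  a cycle.\<close>

lemma affine_symmetrizable:
  fixes A :: "'i::finite \<Rightarrow> 'i \<Rightarrow> real" and a b :: "'i \<Rightarrow> real"
  assumes gcm: "generalized_cartan_matrix A"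
    and a: "\<And>i. 0 < a i" "\<And>i. (\<Sum>j\<in>UNIV. A i j * a j) = 0"
    and b: "\<And>i. 0 < b i" "\<And>i. (\<Sum>j\<in>UNIV. b j * A j i) = 0"
  shows "b i * A i j * a j = b j * A j i * a i"
proof -
  define M where "M i j = b i * A i j * a j" for i j
  define u where "u i = sqrt (a i * b i)" for i
  have u0: "0 < u i" for i by (simp add: u_def a b)
  have usq: "u i ^ 2 = a i * b i" for i
    using a(1)[of i] b(1)[of i] by (simp add: u_def less_imp_le)
  have Aint: "A i j \<in> \<int>" and Adiag: "A i i = 2" and Aneg: "i \<noteq> j \<Longrightarrow> A i j \<le> 0"
    and Azero: "A i j = 0 \<longleftrightarrow> A j i = 0" for i j
    using gcm unfolding generalized_cartan_matrix_def by (simp_all)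
  have row: "(\<Sum>j\<in>UNIV. M i j) = 0" for i
    using a(2)[of i] by (simp add: M_def mult.assoc sum_distrib_left[symmetric])
  have col: "(\<Sum>j\<in>UNIV. M j i) = 0" for i
    using b(2)[of i] by (simp add: M_def sum_distrib_right[symmetric])
  have Mneg: "M i j \<le> 0" if "i \<noteq> j" for i j
    using Aneg[OF that] a(1)[of j] b(1)[of i]
    by (simp add: M_def mult_nonneg_nonpos mult_nonpos_nonneg)
  \<comment> \<open>Both entries of \<open>A\<close> are nonzero integers, so their product is at
    least 1 and the geometric mean of \<open>- M i j\<close> and \<open>- M j i\<close> is at least
    \<open>u i * u j\<close>. The two numbers differ, so their arithmetic mean is strictly
    larger.\<close>
  have strict: "u i * u j < - (M i j + M j i) / 2" if "M i j \<noteq> M j i" for i j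
  proof -
    have ij: "i \<noteq> j" using that by auto
    have nz: "A i j \<noteq> 0"
    proof
      assume "A i j = 0"
      with Azero have "A j i = 0" by blast
      with \<open>A i j = 0\<close> that show False by (simp add: M_def)
    qed
    hence nz': "A j i \<noteq> 0" using Azero by blast
    have le1: "A k l \<le> -1" if kl: "k \<noteq> l" "A k l \<noteq> 0" for k l
    proof -
      obtain z where z: "A k l = of_int z" using Aint Ints_cases by blast
      with Aneg[OF kl(1)] kl(2) have "z < 0" by simp
      thus ?thesis using z by simp
    qed
    have "1 \<le> (- A i j) * (- A j i)"
      using le1[OF ij nz] le1[OF _ nz'] ij mult_mono[of 1 "- A i j" 1 "- A j i"] by simp
    hence "(a i * b i) * (a j * b j) * 1 \<le> (a i * b i) * (a j * b j) * (A i j * A j i)"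
      using a(1)[of i] b(1)[of i] a(1)[of j] b(1)[of j] by (intro mult_left_mono) auto
    hence "(u i * u j)^2 \<le> M i j * M j i"
      by (simp add: power_mult_distrib usq M_def ac_simps)
    also have "\<dots> < ((M i j + M j i) / 2)^2"
    proof -
      have "((M i j + M j i) / 2)^2 - M i j * M j i = ((M i j - M j i) / 2)^2"
        by (simp add: power2_eq_square field_simps)
      moreover have "((M i j - M j i) / 2)^2 > 0" using that by simp
      ultimately show ?thesis by linarith
    qed
    also have "\<dots> = (- (M i j + M j i) / 2)^2" by (simp add: power2_eq_square field_simps)
    finally show ?thesis
      using Mneg[of i j] Mneg[of j i] ij by (elim power2_less_imp_less) simp
  qed
  define K where "K i j = M i j - M j i" for i j
  have Ksum: "(\<Sum>j\<in>UNIV. K i j) = 0" for i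
    by (simp add: K_def sum_subtractf row col)
  have "M i j = M j i"
  proof (rule ccontr)
    assume "M i j \<noteq> M j i"
    define S where "S = {i. \<exists>j. K i j > 0}"
    have S0: "S \<noteq> {}"
    proof -
      have "0 < K i j \<or> 0 < K j i" using \<open>M i j \<noteq> M j i\<close> by (auto simp: K_def)
      thus ?thesis by (auto simp: S_def)
    qed
    define s where "s i = (SOME j. K i j > 0)" for i
    have s: "K i (s i) > 0" if "i \<in> S" for i
      using that unfolding S_def s_def by (auto intro: someI_ex)
    \<comment> \<open>\<open>K\<close> is antisymmetric with vanishing row sums: what flows into
      \<open>s i\<close> must flow out again.\<close>
    have sS: "s i \<in> S" if "i \<in> S" for i
    proof (rule ccontr)
      assume "s i \<notin> S"
      hence le: "K (s i) j \<le> 0" for j by (auto simp: S_def not_less)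
      have "K (s i) i < 0" using s[OF that] by (simp add: K_def)
      hence "(\<Sum>j\<in>UNIV. K (s i) j) < (\<Sum>j\<in>(UNIV::'i set). 0)"
        by (intro sum_strict_mono_ex1) (auto intro: le)
      with Ksum show False by simp
    qed
    \<comment> \<open>On a closed set of least cardinality \<open>s\<close> is onto, hence a
      permutation; this is the directed cycle.\<close>
    have "\<exists>C. (C \<noteq> {} \<and> C \<subseteq> S \<and> s ` C \<subseteq> C) \<and>
        (\<forall>C'. C' \<noteq> {} \<and> C' \<subseteq> S \<and> s ` C' \<subseteq> C' \<longrightarrow> card C \<le> card C')"
    proof (rule ex_has_least_nat)
      show "S \<noteq> {} \<and> S \<subseteq> S \<and> s ` S \<subseteq> S" using S0 sS by blast
    qed
    then obtain C where C0: "C \<noteq> {} \<and> C \<subseteq> S \<and> s ` C \<subseteq> C"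
      and Cmin: "\<forall>C'. C' \<noteq> {} \<and> C' \<subseteq> S \<and> s ` C' \<subseteq> C' \<longrightarrow> card C \<le> card C'"
      by (elim exE conjE[of "_ \<and> _"]) (rule that)
    from C0 have C: "C \<noteq> {}" "C \<subseteq> S" "s ` C \<subseteq> C" by auto
    have "card C \<le> card (s ` C)" using C by (intro Cmin[rule_format]) auto
    with C(3) have sC: "s ` C = C" by (intro card_seteq) auto
    have inj: "inj_on s C" by (rule eq_card_imp_inj_on) (simp_all add: sC)
    have re: "(\<Sum>i\<in>C. f (s i)) = (\<Sum>i\<in>C. f i)" for f :: "'i \<Rightarrow> real"
      using sum.reindex[OF inj, of f] sC by simp
    have key: "u i + u (s (s i)) < 2 * u (s i)" if i: "i \<in> C" for i
    proof -
      let ?v = "s i" let ?w = "s (s i)"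
      have k1: "K i ?v > 0" using s i C by blast
      have k2: "K ?v ?w > 0" using s[of ?v] i C by blast
      have d: "i \<noteq> ?v" "?v \<noteq> ?w" using k1 k2 by (auto simp: K_def)
      have d': "i \<noteq> ?w"
      proof
        assume "i = ?w"
        hence "K ?v i > 0" using k2 by simp
        thus False using k1 by (simp add: K_def)
      qed
      \<comment> \<open>The diagonal entry balances all the off-diagonal ones. Only the two
        neighbours on the cycle are kept; they are distinct because \<open>K\<close> cannot be
        positive in both directions.\<close>
      have "0 = (\<Sum>j\<in>UNIV. (M ?v j + M j ?v) / 2)"
        using row[of ?v] col[of ?v] by (simp add: sum_divide_distrib[symmetric] sum.distrib)
      also have "\<dots> = M ?v ?v + (\<Sum>j\<in>UNIV - {?v}. (M ?v j + M j ?v) / 2)"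
        by (subst sum.remove[of UNIV ?v]) simp_all
      finally have "M ?v ?v = - (\<Sum>j\<in>UNIV - {?v}. (M ?v j + M j ?v) / 2)" by simp
      also have "\<dots> = (\<Sum>j\<in>UNIV - {?v}. - (M ?v j + M j ?v) / 2)"
        by (subst sum_negf[symmetric]) (simp only: minus_divide_left)
      also have "\<dots> \<ge> (\<Sum>j\<in>{i, ?w}. - (M ?v j + M j ?v) / 2)"
      proof (intro sum_mono2)
        fix j assume "j \<in> UNIV - {?v} - {i, ?w}"
        hence "M ?v j \<le> 0" "M j ?v \<le> 0" by (auto intro: Mneg)
        thus "0 \<le> - (M ?v j + M j ?v) / 2" by (intro divide_nonneg_pos) auto
      qed (use d in auto)
      finally have "(\<Sum>j\<in>{i, ?w}. - (M ?v j + M j ?v) / 2) \<le> M ?v ?v" .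
      hence "- (M ?v i + M i ?v) / 2 + - (M ?v ?w + M ?w ?v) / 2 \<le> M ?v ?v"
        using d' by simp
      moreover have "u ?v * u i < - (M ?v i + M i ?v) / 2"
        by (rule strict) (use k1 in \<open>auto simp: K_def\<close>)
      moreover have "u ?v * u ?w < - (M ?v ?w + M ?w ?v) / 2"
        by (rule strict) (use k2 in \<open>auto simp: K_def\<close>)
      moreover have "M ?v ?v = 2 * u ?v ^ 2" by (simp add: usq M_def Adiag)
      ultimately have "u ?v * u i + u ?v * u ?w < 2 * u ?v ^ 2" by argo
      hence "u ?v * (u i + u ?w) < u ?v * (2 * u ?v)"
        by (simp add: power2_eq_square distrib_left)
      thus ?thesis using u0[of ?v] by simp
    qed
    have "(\<Sum>i\<in>C. u i + u (s (s i))) < (\<Sum>i\<in>C. 2 * u (s i))"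
      using C by (intro sum_strict_mono key) auto
    thus False
      using re[of u] re[of "\<lambda>i. u (s i)"] by (simp add: sum.distrib sum_distrib_left[symmetric])
  qed
  thus ?thesis by (simp add: M_def)
qed

text \<open>On expanding the square, the pure terms die with the row and column sums. For
  nonpositive off-diagonal entries this displays the form as a sum of squares.\<close>

lemma laplacian_form:
  fixes M :: "'i::finite \<Rightarrow> 'i \<Rightarrow> real"
  assumes row: "\<And>i. (\<Sum>j\<in>UNIV. M i j) = 0" and col: "\<And>j. (\<Sum>i\<in>UNIV. M i j) = 0"
  shows "(\<Sum>i\<in>UNIV. \<Sum>j\<in>UNIV. M i j * y i * y j) =
         (\<Sum>i\<in>UNIV. \<Sum>j\<in>UNIV. - M i j * (y i - y j)^2) / 2"
proof -
  have e: "- M i j * (y i - y j)^2 = 2 * (M i j * y i * y j) - M i j * (y i)^2 - M i j * (y j)^2" for i j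
    by (simp add: power2_eq_square algebra_simps)
  have 1: "(\<Sum>i\<in>UNIV. \<Sum>j\<in>UNIV. M i j * (y i)^2) = 0"
    by (simp add: sum_distrib_right[symmetric] row)
  have 2: "(\<Sum>i\<in>UNIV. \<Sum>j\<in>UNIV. M i j * (y j)^2) = 0"
    by (subst sum.swap) (simp add: sum_distrib_right[symmetric] col)
  show ?thesis
    by (simp only: e sum_subtractf 1 2) (simp add: sum_distrib_left[symmetric])
qed

text \<open>Off-diagonal terms come in equal pairs, so only the diagonal could spoil evenness. Below
  this shows that certain squared lengths are integral multiples of that of a root.\<close>

lemma even_double_sum:
  fixes f :: "'k \<Rightarrow> 'k \<Rightarrow> real"
  assumes "finite S" and "\<And>k l. f k l = f l k" "\<And>k l. f k l \<in> \<int>" "\<And>k. f k k / 2 \<in> \<int>"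
  shows "(\<Sum>k\<in>S. \<Sum>l\<in>S. f k l) / 2 \<in> \<int>"
  using assms(1)
proof induction
  case (insert x S)
  have "(\<Sum>k\<in>insert x S. \<Sum>l\<in>insert x S. f k l) =
        f x x + (\<Sum>l\<in>S. f x l) + ((\<Sum>k\<in>S. f k x) + (\<Sum>k\<in>S. \<Sum>l\<in>S. f k l))"
    using insert by (simp add: sum.distrib)
  also have "(\<Sum>k\<in>S. f k x) = (\<Sum>l\<in>S. f x l)" by (rule sum.cong) (auto intro: assms)
  finally have "(\<Sum>k\<in>insert x S. \<Sum>l\<in>insert x S. f k l) / 2 =
        f x x / 2 + (\<Sum>l\<in>S. f x l) + (\<Sum>k\<in>S. \<Sum>l\<in>S. f k l) / 2"
    by (simp add: field_simps)
  also have "\<dots> \<in> \<int>" by (intro Ints_add Ints_sum insert.IH assms)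
  finally show ?case .
qed simp

section \<open>Simple roots, coordinates and level\<close>

context untwisted_affine
begin

abbreviation \<alpha> where "\<alpha> \<equiv> simple_root D"
abbreviation \<kappa> where "\<kappa> \<equiv> simple_coroot D"
abbreviation \<sigma> where "\<sigma> \<equiv> simple_refl D"
abbreviation \<delta> where "\<delta> \<equiv> null_root D"

lemma cartan_gcm: "generalized_cartan_matrix (cartan D)"
  using affine by (simp add: affine_type_def)

lemma cartan_int: "\<kappa> i (\<alpha> j) \<in> \<int>"
  using cartan_gcm by (simp add: generalized_cartan_matrix_def cartan_def)

lemma cartan_diag [simp]: "\<kappa> i (\<alpha> i) = 2"
  using cartan_gcm by (simp add: generalized_cartan_matrix_def cartan_def)

lemma cartan_nonpos: "i \<noteq> j \<Longrightarrow> \<kappa> i (\<alpha> j) \<le> 0"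
  using cartan_gcm by (simp add: generalized_cartan_matrix_def cartan_def)

lemmas coroot_simps [simp] =
  linear_add[OF linear_coroot] linear_diff[OF linear_coroot] linear_scale[OF linear_coroot]
  linear_neg[OF linear_coroot] linear_0[OF linear_coroot] linear_sum[OF linear_coroot]

text \<open>Half the squared length of the simple root in the normalized invariant form, see
  \<open>bform_real_root\<close>.\<close>

definition symmetrizer :: "'i \<Rightarrow> real" where
  "symmetrizer k = real (comark D k) / real (mark D k)"

lemma symmetrizer_pos: "0 < symmetrizer k"
  using mark_pos[of k] comark_pos[of k] by (simp add: symmetrizer_def)

lemma symmetrizer_mark: "symmetrizer k * real (mark D k) = real (comark D k)"
  using mark_pos[of k] by (simp add: symmetrizer_def)

lemma scaled_cartan_sym:
  "real (comark D i) * \<kappa> i (\<alpha> j) * real (mark D j) = real (comark D j) * \<kappa> j (\<alpha> i) * real (mark D i)"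
  using affine_symmetrizable[OF cartan_gcm, of "\<lambda>i. real (mark D i)" "\<lambda>i. real (comark D i)" i j]
    mark_pos comark_pos mark_kernel comark_kernel by (simp add: cartan_def)

lemma symmetrizer_cartan: "symmetrizer i * \<kappa> i (\<alpha> j) = symmetrizer j * \<kappa> j (\<alpha> i)"
  using scaled_cartan_sym[of i j] mark_pos[of i] mark_pos[of j]
  by (simp add: symmetrizer_def field_simps)

text \<open>The simple roots span a subspace of codimension one, so the coordinate functionals are
  chosen extensions; only their values on \<open>root_span\<close> are determined.\<close>

definition coord :: "'i \<Rightarrow> 'v \<Rightarrow> real" where
  "coord = (SOME g. \<forall>k. linear (g k) \<and> (\<forall>j. g k (\<alpha> j) = (if j = k then 1 else 0)))"

lemma coord_spec: "linear (coord k) \<and> (\<forall>j. coord k (\<alpha> j) = (if j = k then 1 else 0))"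
proof -
  have "\<exists>g. \<forall>k. linear (g k) \<and> (\<forall>j. g k (\<alpha> j) = (if j = k then 1 else (0::real)))"
  proof (rule choice, rule allI)
    fix k
    obtain g where g: "linear g" "\<forall>x\<in>range \<alpha>. g x = (if x = \<alpha> k then 1 else (0::real))"
      using linear_independent_extend[OF independent_simple_roots, of "\<lambda>x. if x = \<alpha> k then 1 else (0::real)"]
      by (elim exE conjE) (rule that)
    have "g (\<alpha> j) = (if j = k then 1 else 0)" for j
      using g(2)[rule_format, of "\<alpha> j"] inj_simple_root by (simp add: inj_eq)
    with g(1) show "\<exists>g. linear g \<and> (\<forall>j. g (\<alpha> j) = (if j = k then 1 else (0::real)))"
      by blast
  qed
  from someI_ex[OF this] show ?thesis unfolding coord_def by blast
qed

lemma linear_coord: "linear (coord k)" using coord_spec by blast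

lemmas coord_simps [simp] =
  linear_add[OF linear_coord] linear_diff[OF linear_coord] linear_scale[OF linear_coord]
  linear_neg[OF linear_coord] linear_0[OF linear_coord] linear_sum[OF linear_coord]

lemma coord_simple [simp]: "coord k (\<alpha> j) = (if j = k then 1 else 0)"
  using coord_spec by blast

abbreviation "root_span \<equiv> span (range \<alpha>)"

lemma simple_root_span [simp]: "\<alpha> i \<in> root_span" by (simp add: span_base)

lemma root_span_eq: "\<beta> \<in> root_span \<Longrightarrow> \<beta> = (\<Sum>k\<in>UNIV. coord k \<beta> *\<^sub>R \<alpha> k)"
proof (induction rule: span_induct_alt)
  case (step c x y)
  then obtain i where x: "x = \<alpha> i" by blast
  have "(\<Sum>k\<in>UNIV. coord k (c *\<^sub>R x + y) *\<^sub>R \<alpha> k) =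
      (\<Sum>k\<in>UNIV. (c * (if i = k then 1 else 0)) *\<^sub>R \<alpha> k) + (\<Sum>k\<in>UNIV. coord k y *\<^sub>R \<alpha> k)"
    by (simp add: x scaleR_left_distrib sum.distrib)
  also have "(\<Sum>k\<in>UNIV. (c * (if i = k then 1 else 0)) *\<^sub>R \<alpha> k) = c *\<^sub>R \<alpha> i"
    by (subst sum.remove[of _ i]) (auto intro!: sum.neutral)
  finally show ?case using step x by simp
qed simp

lemma root_span_eqI: "\<beta> \<in> root_span \<Longrightarrow> \<gamma> \<in> root_span \<Longrightarrow> (\<And>k. coord k \<beta> = coord k \<gamma>) \<Longrightarrow> \<beta> = \<gamma>"
  using root_span_eq[of \<beta>] root_span_eq[of \<gamma>] by simp

lemma null_root_span [simp]: "\<delta> \<in> root_span"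
  by (simp add: null_root_def span_sum span_scale)

lemma coord_null_root: "coord k \<delta> = real (mark D k)"
proof -
  have "coord k \<delta> = (\<Sum>i\<in>UNIV. if i = k then real (mark D i) else 0)"
    unfolding null_root_def coord_simps coord_simple by (intro sum.cong) auto
  thus ?thesis by simp
qed

lemma coroot_null_root [simp]: "\<kappa> i \<delta> = 0"
  using mark_kernel[of i] by (simp add: null_root_def cartan_def mult.commute)

lemma linear_central: "linear (central D)"
  unfolding central_def
  by (rule linearI) (simp_all add: sum.distrib algebra_simps sum_distrib_left)

lemmas central_simps [simp] =
  linear_add[OF linear_central] linear_diff[OF linear_central] linear_scale[OF linear_central]
  linear_neg[OF linear_central] linear_0[OF linear_central] linear_sum[OF linear_central]

lemma central_simple [simp]: "central D (\<alpha> i) = 0"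
  using comark_kernel[of i] by (simp add: central_def cartan_def)

lemma central_root_span [simp]: "\<beta> \<in> root_span \<Longrightarrow> central D \<beta> = 0"
  by (subst root_span_eq) simp_all

subsection \<open>The invariant form\<close>

text \<open>The normalized invariant form with first argument in the root span. The asymmetric shape
  admits arbitrary weights as second argument, at the price that symmetry is available on
  \<open>root_span\<close> only.\<close>

definition bform :: "'v \<Rightarrow> 'v \<Rightarrow> real" where
  "bform \<beta> \<mu> = (\<Sum>k\<in>UNIV. coord k \<beta> * symmetrizer k * \<kappa> k \<mu>)"

lemma linear_bform_right: "linear (bform \<beta>)"
  unfolding bform_def
  by (rule linearI) (simp_all add: sum.distrib algebra_simps sum_distrib_left)

lemma linear_bform_left: "linear (\<lambda>\<beta>. bform \<beta> \<mu>)"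
  unfolding bform_def
  by (rule linearI) (simp_all add: sum.distrib algebra_simps sum_distrib_left)

lemmas bform_simps [simp] =
  linear_add[OF linear_bform_right] linear_diff[OF linear_bform_right]
  linear_scale[OF linear_bform_right] linear_neg[OF linear_bform_right]
  linear_0[OF linear_bform_right] linear_sum[OF linear_bform_right]
  linear_add[OF linear_bform_left] linear_diff[OF linear_bform_left]
  linear_scale[OF linear_bform_left] linear_neg[OF linear_bform_left]
  linear_0[OF linear_bform_left] linear_sum[OF linear_bform_left]

lemma bform_simple_left [simp]: "bform (\<alpha> i) \<mu> = symmetrizer i * \<kappa> i \<mu>"
proof -
  have "bform (\<alpha> i) \<mu> = (\<Sum>k\<in>UNIV. if i = k then symmetrizer k * \<kappa> k \<mu> else 0)"
    unfolding bform_def by (intro sum.cong) auto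
  thus ?thesis by simp
qed

lemma bform_sym: "\<beta> \<in> root_span \<Longrightarrow> \<gamma> \<in> root_span \<Longrightarrow> bform \<beta> \<gamma> = bform \<gamma> \<beta>"
proof (induction \<beta> rule: span_induct_alt)
  case (step c x y)
  then obtain i where x: "x = \<alpha> i" by blast
  have "bform \<gamma> (\<alpha> i) = symmetrizer i * \<kappa> i \<gamma>"
  proof -
    have "bform \<gamma> (\<alpha> i) = (\<Sum>k\<in>UNIV. symmetrizer i * (coord k \<gamma> * \<kappa> i (\<alpha> k)))"
      unfolding bform_def
    proof (rule sum.cong)
      fix k show "coord k \<gamma> * symmetrizer k * \<kappa> k (\<alpha> i) = symmetrizer i * (coord k \<gamma> * \<kappa> i (\<alpha> k))"
        using symmetrizer_cartan[of i k] by (simp add: algebra_simps)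
    qed simp
    also have "\<dots> = symmetrizer i * \<kappa> i (\<Sum>k\<in>UNIV. coord k \<gamma> *\<^sub>R \<alpha> k)"
      by (simp add: sum_distrib_left)
    also have "(\<Sum>k\<in>UNIV. coord k \<gamma> *\<^sub>R \<alpha> k) = \<gamma>" using root_span_eq[OF \<open>\<gamma> \<in> root_span\<close>] by simp
    finally show ?thesis .
  qed
  thus ?case using step x by simp
qed simp

text \<open>Under the form the null root corresponds to the canonical central element.\<close>

lemma bform_null_left [simp]: "bform \<delta> \<mu> = central D \<mu>"
  unfolding bform_def central_def coord_null_root
  by (intro sum.cong) (use symmetrizer_mark in \<open>auto simp: mult.commute mult.left_commute\<close>)

lemma bform_null_right [simp]: "bform \<beta> \<delta> = 0"
  by (simp add: bform_def)

lemma bform_refl: "\<beta> \<in> root_span \<Longrightarrow> bform (\<sigma> i \<beta>) (\<sigma> i \<mu>) = bform \<beta> \<mu>"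
  using bform_sym[of \<beta> "\<alpha> i"] by (simp add: simple_refl_def algebra_simps)

lemma bform_coords:
  assumes "\<gamma> \<in> root_span"
  shows "bform \<beta> \<gamma> = (\<Sum>k\<in>UNIV. \<Sum>l\<in>UNIV. coord k \<beta> * (symmetrizer k * \<kappa> k (\<alpha> l)) * coord l \<gamma>)"
proof -
  have "\<kappa> k \<gamma> = (\<Sum>l\<in>UNIV. \<kappa> k (\<alpha> l) * coord l \<gamma>)" for k
    by (subst root_span_eq[OF assms]) (simp add: mult.commute)
  thus ?thesis by (simp add: bform_def sum_distrib_left mult.assoc)
qed

text \<open>In the coordinates \<open>y\<close>, rescaled by the marks, the Gram matrix is a
  weighted Laplacian of the Dynkin diagram. The form is then a sum of weighted squares of
  differences along edges, and on a connected diagram it vanishes only for constant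
  \<open>y\<close>, that is, for multiples of the null root.\<close>

lemma bform_nonneg:
  assumes "\<beta> \<in> root_span"
  shows "0 \<le> bform \<beta> \<beta>"
    and "bform \<beta> \<beta> = 0 \<Longrightarrow> \<exists>c. \<forall>k. coord k \<beta> = c * real (mark D k)"
proof -
  define M where "M i j = real (comark D i) * \<kappa> i (\<alpha> j) * real (mark D j)" for i j
  define y where "y k = coord k \<beta> / real (mark D k)" for k
  have row: "(\<Sum>j\<in>UNIV. M i j) = 0" for i
    using mark_kernel[of i] by (simp add: M_def cartan_def mult.assoc sum_distrib_left[symmetric])
  have sym: "M i j = M j i" for i j unfolding M_def by (rule scaled_cartan_sym)
  have neg: "M i j \<le> 0" if "i \<noteq> j" for i j
    using cartan_nonpos[OF that] by (simp add: M_def mult_nonneg_nonpos mult_nonpos_nonneg)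
  have t: "0 \<le> - M i j * (y i - y j)^2" for i j
    using neg[of i j] by (cases "i = j") (auto simp: mult_nonpos_nonneg)
  have "bform \<beta> \<beta> = (\<Sum>i\<in>UNIV. \<Sum>j\<in>UNIV. M i j * y i * y j)"
    unfolding bform_coords[OF assms]
  proof (intro sum.cong refl)
    fix i j
    show "coord i \<beta> * (symmetrizer i * \<kappa> i (\<alpha> j)) * coord j \<beta> = M i j * y i * y j"
      using mark_pos[of i] mark_pos[of j] by (simp add: M_def y_def symmetrizer_def)
  qed
  also have "\<dots> = (\<Sum>i\<in>UNIV. \<Sum>j\<in>UNIV. - M i j * (y i - y j)^2) / 2"
    by (rule laplacian_form[OF row]) (subst sym, rule row)
  finally have eq: "bform \<beta> \<beta> = (\<Sum>i\<in>UNIV. \<Sum>j\<in>UNIV. - M i j * (y i - y j)^2) / 2" .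
  show "0 \<le> bform \<beta> \<beta>" unfolding eq by (intro divide_nonneg_pos sum_nonneg t) simp
  assume "bform \<beta> \<beta> = 0"
  hence s0: "(\<Sum>i\<in>UNIV. \<Sum>j\<in>UNIV. - M i j * (y i - y j)^2) = 0" using eq by simp
  have nn: "0 \<le> (\<Sum>j\<in>UNIV. - M i j * (y i - y j)^2)" for i by (rule sum_nonneg, rule t)
  have s1: "\<forall>i. (\<Sum>j\<in>UNIV. - M i j * (y i - y j)^2) = 0"
    using sum_nonneg_eq_0_iff[OF finite nn, THEN iffD1, OF s0] by blast
  hence z: "- M i j * (y i - y j)^2 = 0" for i j
    using sum_nonneg_eq_0_iff[OF finite t, THEN iffD1, OF s1[rule_format]] by blast
  fix i0 :: 'i
  define S where "S = {i. y i = y i0}"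
  have "S = UNIV"
  proof (rule ccontr)
    assume "S \<noteq> UNIV"
    moreover have "S \<noteq> {}" by (auto simp: S_def)
    moreover have "indecomposable_matrix (cartan D)" using affine by (simp add: affine_type_def)
    ultimately obtain i j where ij: "i \<in> S" "j \<in> - S" "cartan D i j \<noteq> 0"
      unfolding indecomposable_matrix_def by blast
    hence "M i j \<noteq> 0" using mark_pos[of j] comark_pos[of i] by (simp add: M_def cartan_def)
    with z[of i j] have "y i = y j" by simp
    with ij show False by (simp add: S_def)
  qed
  hence "y k = y i0" for k by (auto simp: S_def)
  moreover have "coord k \<beta> = y k * real (mark D k)" for k using mark_pos[of k] by (simp add: y_def)
  ultimately have "coord k \<beta> = y i0 * real (mark D k)" for k by metis
  thus "\<exists>c. \<forall>k. coord k \<beta> = c * real (mark D k)" by blast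
qed

subsection \<open>Weyl groups\<close>

lemma linear_refl: "linear (\<sigma> i)"
  unfolding simple_refl_def
  by (rule linearI) (simp_all add: algebra_simps scaleR_left_distrib scaleR_right_diff_distrib)

lemma refl_refl [simp]: "\<sigma> i (\<sigma> i \<mu>) = \<mu>"
  by (simp add: simple_refl_def)

lemma refl_comp_refl [simp]: "\<sigma> i \<circ> (\<sigma> i \<circ> x) = x"
  by (simp add: fun_eq_iff)

lemma refl_simple [simp]: "\<sigma> i (\<alpha> i) = - \<alpha> i"
  by (simp add: simple_refl_def algebra_simps scaleR_2)

lemma refl_null [simp]: "\<sigma> i \<delta> = \<delta>"
  by (simp add: simple_refl_def)

lemma central_refl [simp]: "central D (\<sigma> i \<mu>) = central D \<mu>"
  by (simp add: simple_refl_def)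

lemma weyl_word_Nil [simp]: "weyl_word D [] = id"
  by (simp add: weyl_word_def)

lemma weyl_word_Cons [simp]: "weyl_word D (i # w) = \<sigma> i \<circ> weyl_word D w"
  by (simp add: weyl_word_def)

lemma weyl_word_append: "weyl_word D (u @ w) = weyl_word D u \<circ> weyl_word D w"
  by (induction u) auto

lemma weyl_word_rev: "weyl_word D (rev w) \<circ> weyl_word D w = id"
  by (induction w) (simp_all add: weyl_word_append fun_eq_iff)

lemma weyl_af_induct [consumes 1, case_names id step]:
  assumes "x \<in> weyl_af D" "P id" "\<And>x i. x \<in> weyl_af D \<Longrightarrow> P x \<Longrightarrow> P (\<sigma> i \<circ> x)"
  shows "P x"
proof -
  have "P (weyl_word D w)" for w
  proof (induction w)
    case Nil show ?case using assms(2) by (simp only: weyl_word_Nil)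
  next
    case (Cons i w)
    thus ?case unfolding weyl_word_Cons by (intro assms(3)) (auto simp: weyl_af_def)
  qed
  thus ?thesis using assms(1) by (auto simp: weyl_af_def)
qed

lemma weyl_fin_induct [consumes 1, case_names id step]:
  assumes "x \<in> weyl_fin D" "P id"
    "\<And>x i. x \<in> weyl_fin D \<Longrightarrow> i \<in> fin_nodes D \<Longrightarrow> P x \<Longrightarrow> P (\<sigma> i \<circ> x)"
  shows "P x"
proof -
  have "P (weyl_word D w)" if "w \<in> lists (fin_nodes D)" for w
    using that
  proof (induction w)
    case Nil show ?case using assms(2) by (simp only: weyl_word_Nil)
  next
    case (Cons i w)
    thus ?case unfolding weyl_word_Cons by (intro assms(3)) (auto simp: weyl_fin_def)
  qed
  thus ?thesis using assms(1) by (auto simp: weyl_fin_def)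
qed

lemma weyl_id [simp]: "id \<in> weyl_af D" "id \<in> weyl_fin D"
  unfolding weyl_af_def weyl_fin_def
  by (rule range_eqI[of _ _ "[]"], simp, rule image_eqI[of _ _ "[]"], simp_all)

lemma weyl_refl: "\<sigma> i \<in> weyl_af D"
  using weyl_word_Cons[of i "[]"] unfolding weyl_af_def by (metis comp_id rangeI weyl_word_Nil)

lemma weyl_fin_refl: "i \<in> fin_nodes D \<Longrightarrow> \<sigma> i \<in> weyl_fin D"
  unfolding weyl_fin_def by (rule image_eqI[of _ _ "[i]"]) auto

lemma weyl_comp: "x \<in> weyl_af D \<Longrightarrow> y \<in> weyl_af D \<Longrightarrow> x \<circ> y \<in> weyl_af D"
  unfolding weyl_af_def by (auto simp: weyl_word_append[symmetric])

lemma weyl_fin_comp: "x \<in> weyl_fin D \<Longrightarrow> y \<in> weyl_fin D \<Longrightarrow> x \<circ> y \<in> weyl_fin D"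
  unfolding weyl_fin_def by (auto simp: weyl_word_append[symmetric] intro!: imageI)

lemma weyl_refl_comp: "x \<in> weyl_af D \<Longrightarrow> \<sigma> i \<circ> x \<in> weyl_af D"
  by (intro weyl_comp weyl_refl)

lemma weyl_fin_sub: "x \<in> weyl_fin D \<Longrightarrow> x \<in> weyl_af D"
  by (auto simp: weyl_fin_def weyl_af_def)

lemma weyl_inverse: "x \<in> weyl_af D \<Longrightarrow> \<exists>y\<in>weyl_af D. x \<circ> y = id \<and> y \<circ> x = id"
  unfolding weyl_af_def
  by clarify (metis weyl_word_rev rev_rev_ident rangeI)

lemma weyl_fin_inverse: "x \<in> weyl_fin D \<Longrightarrow> \<exists>y\<in>weyl_fin D. x \<circ> y = id \<and> y \<circ> x = id"
  unfolding weyl_fin_def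
  by clarify (metis weyl_word_rev rev_rev_ident imageI in_lists_conv_set set_rev)

lemma weyl_linear: "x \<in> weyl_af D \<Longrightarrow> linear x"
proof (induction rule: weyl_af_induct)
  case id show ?case unfolding id_def by (rule linear_ident)
next
  case (step x i)
  show ?case by (rule linear_compose[OF step(2) linear_refl])
qed

lemma weyl_bij: "x \<in> weyl_af D \<Longrightarrow> bij x"
  using weyl_inverse o_bij by blast

lemma weyl_inv: "x \<in> weyl_af D \<Longrightarrow> inv x \<in> weyl_af D"
  using weyl_inverse inv_unique_comp by metis

lemma weyl_fin_inv: "x \<in> weyl_fin D \<Longrightarrow> inv x \<in> weyl_fin D"
  using weyl_fin_inverse inv_unique_comp by metis

lemma weyl_inv_cancel [simp]: "x \<in> weyl_af D \<Longrightarrow> x (inv x \<mu>) = \<mu>" "x \<in> weyl_af D \<Longrightarrow> inv x (x \<mu>) = \<mu>"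
  using weyl_bij by (auto simp: bij_is_surj surj_f_inv_f bij_is_inj)

lemma weyl_null: "x \<in> weyl_af D \<Longrightarrow> x \<delta> = \<delta>"
  by (induction rule: weyl_af_induct) auto

lemma weyl_central: "x \<in> weyl_af D \<Longrightarrow> central D (x \<mu>) = central D \<mu>"
  by (induction rule: weyl_af_induct) auto

lemma refl_root_span: "\<beta> \<in> root_span \<Longrightarrow> \<sigma> i \<beta> \<in> root_span"
  by (simp add: simple_refl_def span_diff span_scale)

lemma weyl_root_span: "x \<in> weyl_af D \<Longrightarrow> \<beta> \<in> root_span \<Longrightarrow> x \<beta> \<in> root_span"
  by (induction rule: weyl_af_induct) (auto intro: refl_root_span)

lemma weyl_bform: "x \<in> weyl_af D \<Longrightarrow> \<beta> \<in> root_span \<Longrightarrow> bform (x \<beta>) (x \<mu>) = bform \<beta> \<mu>"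
  by (induction rule: weyl_af_induct) (auto simp: bform_refl weyl_root_span)

lemma weyl_simps:
  assumes "x \<in> weyl_af D"
  shows "x (\<beta> + \<gamma>) = x \<beta> + x \<gamma>" "x (\<beta> - \<gamma>) = x \<beta> - x \<gamma>" "x (c *\<^sub>R \<beta>) = c *\<^sub>R x \<beta>" "x (- \<beta>) = - x \<beta>"
    "x 0 = 0"
  using weyl_linear[OF assms] by (simp_all add: linear_add linear_diff linear_scale linear_neg linear_0)

subsection \<open>Real roots\<close>

text \<open>The second number is the coefficient of the \<open>k\<close>-th simple coroot in the
  coroot of \<open>x (\<alpha> i)\<close>. Each reflection changes it by an integral combination,
  just as it does for the root itself.\<close>

lemma real_root_integral:
  assumes "x \<in> weyl_af D"
  shows "coord k (x (\<alpha> i)) \<in> \<int>" "coord k (x (\<alpha> i)) * symmetrizer k / symmetrizer i \<in> \<int>"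
proof -
  have "\<forall>k. coord k (x (\<alpha> i)) \<in> \<int> \<and> coord k (x (\<alpha> i)) * symmetrizer k / symmetrizer i \<in> \<int>"
    using assms
  proof (induction rule: weyl_af_induct)
    case id
    show ?case using symmetrizer_pos by (auto simp: less_imp_neq[THEN not_sym])
  next
    case (step x j)
    let ?\<beta> = "x (\<alpha> i)"
    have span: "?\<beta> \<in> root_span" using step weyl_root_span by simp
    have 1: "\<kappa> j ?\<beta> = (\<Sum>k\<in>UNIV. coord k ?\<beta> * \<kappa> j (\<alpha> k))"
      by (subst root_span_eq[OF span]) simp
    hence "\<kappa> j ?\<beta> \<in> \<int>"
      using step by (auto intro!: Ints_sum Ints_mult cartan_int)
    moreover have "\<kappa> j ?\<beta> * symmetrizer j / symmetrizer i
        = (\<Sum>k\<in>UNIV. (coord k ?\<beta> * symmetrizer k / symmetrizer i) * \<kappa> k (\<alpha> j))"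
      unfolding 1 sum_distrib_right sum_divide_distrib
    proof (intro sum.cong refl)
      fix k
      show "coord k ?\<beta> * \<kappa> j (\<alpha> k) * symmetrizer j / symmetrizer i
        = (coord k ?\<beta> * symmetrizer k / symmetrizer i) * \<kappa> k (\<alpha> j)"
        using symmetrizer_cartan[of j k] by (simp add: mult.commute mult.left_commute)
    qed
    moreover have "(\<Sum>k\<in>UNIV. (coord k ?\<beta> * symmetrizer k / symmetrizer i) * \<kappa> k (\<alpha> j)) \<in> \<int>"
      using step(2) by (intro Ints_sum Ints_mult[OF _ cartan_int]) blast
    ultimately show ?case
      using step by (auto simp: simple_refl_def left_diff_distrib diff_divide_distrib intro!: Ints_diff)
  qed
  thus "coord k (x (\<alpha> i)) \<in> \<int>" "coord k (x (\<alpha> i)) * symmetrizer k / symmetrizer i \<in> \<int>" by auto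
qed

lemma bform_real_root: "x \<in> weyl_af D \<Longrightarrow> bform (x (\<alpha> i)) (x (\<alpha> i)) = 2 * symmetrizer i"
  by (simp add: weyl_bform)

text \<open>
  If \<open>\<beta>\<close> had coordinates of both signs, split it as \<open>p - n\<close> with disjoint supports.  By integrality
  of the coroot of \<open>\<beta>\<close>, both \<open>\<bar>p\<bar>\<^sup>2\<close> and \<open>\<bar>n\<bar>\<^sup>2\<close> are positive multiples of \<open>\<bar>\<beta>\<bar>\<^sup>2\<close>, whereas
  \<open>\<bar>p\<bar>\<^sup>2 + \<bar>n\<bar>\<^sup>2 \<le> \<bar>\<beta>\<bar>\<^sup>2\<close>.
\<close>

lemma real_root_sign:
  assumes x: "x \<in> weyl_af D"
  shows "(\<forall>k. 0 \<le> coord k (x (\<alpha> i))) \<or> (\<forall>k. coord k (x (\<alpha> i)) \<le> 0)"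
proof (rule ccontr)
  assume neg: "\<not> ?thesis"
  let ?\<beta> = "x (\<alpha> i)"
  have span: "?\<beta> \<in> root_span" using x weyl_root_span by simp
  define v where "v q = (\<Sum>k\<in>UNIV. q k *\<^sub>R \<alpha> k)" for q :: "'i \<Rightarrow> real"
  have vspan: "v q \<in> root_span" for q by (simp add: v_def span_sum span_scale)
  have cv: "coord k (v q) = q k" for k q
  proof -
    have "coord k (v q) = (\<Sum>l\<in>UNIV. if l = k then q l else 0)"
      unfolding v_def coord_simps coord_simple by (intro sum.cong) auto
    thus ?thesis by simp
  qed
  have ge: "2 * symmetrizer i \<le> bform (v q) (v q)"
    if q: "\<And>k. q k \<in> \<int>" "\<And>k. q k * symmetrizer k / symmetrizer i \<in> \<int>" and nz: "q k1 \<noteq> 0" and z: "q k2 = 0"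
    for q k1 k2
  proof -
    let ?f = "\<lambda>k l. (q k * symmetrizer k / symmetrizer i) * \<kappa> k (\<alpha> l) * q l"
    \<comment> \<open>The double sum is the squared length of \<open>v q\<close> divided by
      \<open>symmetrizer i\<close>; the diagonal entries 2 of the Cartan matrix make it
      even.\<close>
    have "(\<Sum>k\<in>UNIV. \<Sum>l\<in>UNIV. ?f k l) / 2 \<in> \<int>"
    proof (rule even_double_sum)
      show "?f k l = ?f l k" for k l
        using symmetrizer_cartan[of k l] by (simp add: mult.commute mult.left_commute)
      show "?f k l \<in> \<int>" for k l by (intro Ints_mult q cartan_int)
      show "?f k k / 2 \<in> \<int>" for k
        using Ints_mult[OF q(2)[of k] q(1)[of k]] by (simp add: mult.assoc)
    qed simp
    also have "(\<Sum>k\<in>UNIV. \<Sum>l\<in>UNIV. ?f k l) / 2 = bform (v q) (v q) / (2 * symmetrizer i)"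
      unfolding bform_coords[OF vspan] cv sum_divide_distrib
      by (intro sum.cong refl) (simp add: field_simps)
    finally have int: "bform (v q) (v q) / (2 * symmetrizer i) \<in> \<int>" .
    \<comment> \<open>A vector of length zero is a multiple of the null root, all of whose
      coordinates are nonzero or none; \<open>q\<close> vanishes at \<open>k2\<close> but not at
      \<open>k1\<close>.\<close>
    have "bform (v q) (v q) \<noteq> 0"
    proof
      assume "bform (v q) (v q) = 0"
      from bform_nonneg(2)[OF vspan this] obtain c where c: "\<And>k. q k = c * real (mark D k)"
        unfolding cv by blast
      from c[of k2] z mark_pos[of k2] have "c = 0" by simp
      with c[of k1] nz show False by simp
    qed
    hence "0 < bform (v q) (v q) / (2 * symmetrizer i)"
      using bform_nonneg(1)[OF vspan, of q] symmetrizer_pos[of i] by simp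
    with int have "1 \<le> bform (v q) (v q) / (2 * symmetrizer i)"
      by (auto elim!: Ints_cases)
    thus ?thesis using symmetrizer_pos[of i] by (simp add: field_simps)
  qed
  define p where "p k = max (coord k ?\<beta>) 0" for k
  define n where "n k = max (- coord k ?\<beta>) 0" for k
  from neg obtain k1 k2 where k: "coord k1 ?\<beta> < 0" "0 < coord k2 ?\<beta>" by (auto simp: not_le)
  note int = real_root_integral[OF x, of _ i]
  have "2 * symmetrizer i \<le> bform (v p) (v p)"
    by (rule ge[of _ k2 k1]) (use int k in \<open>auto simp: p_def max_def\<close>)
  moreover have "2 * symmetrizer i \<le> bform (v n) (v n)"
    by (rule ge[of _ k1 k2]) (use int k in \<open>auto simp: n_def max_def\<close>)
  moreover have "bform (v p) (v n) \<le> 0"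
    unfolding bform_coords[OF vspan] cv
  proof (intro sum_nonpos)
    fix k l
    show "p k * (symmetrizer k * \<kappa> k (\<alpha> l)) * n l \<le> 0"
    proof (cases "k = l")
      case True thus ?thesis by (auto simp: p_def n_def max_def)
    next
      case False
      have "symmetrizer k * \<kappa> k (\<alpha> l) \<le> 0"
        using cartan_nonpos[OF False] symmetrizer_pos[of k] by (simp add: mult_nonneg_nonpos)
      thus ?thesis
        by (intro mult_nonpos_nonneg[OF mult_nonneg_nonpos]) (auto simp: p_def n_def)
    qed
  qed
  moreover have "bform (v n) (v p) = bform (v p) (v n)" by (rule bform_sym[OF vspan vspan])
  moreover have "?\<beta> = v p - v n"
    by (rule root_span_eqI) (auto simp: span span_diff vspan cv p_def n_def max_def)
  hence "2 * symmetrizer i = bform (v p - v n) (v p - v n)"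
    using bform_real_root[OF x, of i] by simp
  ultimately show False using symmetrizer_pos[of i] by simp
qed

text \<open>Comparing squared lengths makes \<open>c * c\<close> a ratio of symmetrizers;
  integrality of the coroot then exhibits an integral inverse of \<open>c\<close>.\<close>

lemma real_root_multiple:
  assumes x: "x \<in> weyl_af D" and y: "y \<in> weyl_af D" and c: "c \<in> \<int>" and eq: "c *\<^sub>R x (\<alpha> j) = y (\<alpha> l)"
  shows "c = 1 \<or> c = - 1"
proof -
  have "inv x \<circ> y \<in> weyl_af D" using x y by (intro weyl_comp weyl_inv)
  note i = real_root_integral(2)[OF this, of j l]
  have "(inv x \<circ> y) (\<alpha> l) = c *\<^sub>R \<alpha> j"
    using x eq[symmetric] by (simp add: weyl_simps[OF weyl_inv])
  with i have i: "c * symmetrizer j / symmetrizer l \<in> \<int>" by simp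
  have "bform (y (\<alpha> l)) (y (\<alpha> l)) = c * c * (2 * symmetrizer j)"
    using bform_real_root[OF x, of j] by (simp flip: eq)
  hence "c * c * symmetrizer j = symmetrizer l"
    using bform_real_root[OF y, of l] by simp
  hence "c * (c * symmetrizer j / symmetrizer l) = symmetrizer l / symmetrizer l"
    by (simp add: mult.assoc)
  also have "\<dots> = 1" using symmetrizer_pos[of l] by simp
  finally have "c * (c * symmetrizer j / symmetrizer l) = 1" .
  moreover obtain a where a: "c = of_int a" using c by (auto elim: Ints_cases)
  moreover obtain b where "c * symmetrizer j / symmetrizer l = of_int b" using i by (auto elim: Ints_cases)
  ultimately have "a * b = 1" by (metis of_int_1 of_int_eq_iff of_int_mult)
  hence "a = 1 \<or> a = -1" by (rule zmult_eq_1_iff[THEN iffD1, THEN disjE]) auto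
  thus ?thesis using a by auto
qed

section \<open>The finite root system and its highest root\<close>

abbreviation "\<theta> \<equiv> null_root D - simple_root D (node0 D)"

lemma fin_rootE:
  assumes "\<beta> \<in> fin_roots D"
  obtains x i where "x \<in> weyl_fin D" "i \<in> fin_nodes D" "\<beta> = x (\<alpha> i)"
  using assms by (auto simp: fin_roots_def)

lemma weyl_fin_root: "x \<in> weyl_fin D \<Longrightarrow> \<beta> \<in> fin_roots D \<Longrightarrow> x \<beta> \<in> fin_roots D"
  unfolding fin_roots_def mem_Collect_eq by (metis comp_apply weyl_fin_comp)

lemma fin_root_simple: "i \<in> fin_nodes D \<Longrightarrow> \<alpha> i \<in> fin_roots D"
  unfolding fin_roots_def by (auto intro!: exI[of _ id] exI[of _ i])

lemma fin_root_neg: assumes "\<beta> \<in> fin_roots D" shows "- \<beta> \<in> fin_roots D"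
proof -
  obtain x i where x: "x \<in> weyl_fin D" "i \<in> fin_nodes D" "\<beta> = x (\<alpha> i)" by (rule fin_rootE[OF assms])
  hence "- \<beta> = (x \<circ> \<sigma> i) (\<alpha> i)" by (simp add: weyl_simps[OF weyl_fin_sub])
  thus ?thesis using x weyl_fin_comp weyl_fin_refl unfolding fin_roots_def by blast
qed

lemma fin_root_span: "\<beta> \<in> fin_roots D \<Longrightarrow> \<beta> \<in> root_span"
  by (metis fin_rootE weyl_root_span weyl_fin_sub simple_root_span)

lemma weyl_fin_coord0: "x \<in> weyl_fin D \<Longrightarrow> coord (node0 D) (x \<mu>) = coord (node0 D) \<mu>"
  by (induction rule: weyl_fin_induct) (auto simp: simple_refl_def fin_nodes_def)

lemma fin_root_coord0 [simp]: "\<beta> \<in> fin_roots D \<Longrightarrow> coord (node0 D) \<beta> = 0"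
  by (elim fin_rootE) (auto simp: weyl_fin_coord0 fin_nodes_def)

lemma fin_root_bform: "\<beta> \<in> fin_roots D \<Longrightarrow> 0 < bform \<beta> \<beta>"
  by (elim fin_rootE) (simp add: bform_real_root weyl_fin_sub symmetrizer_pos)

lemma fin_root_sign: "\<beta> \<in> fin_roots D \<Longrightarrow> (\<forall>k. 0 \<le> coord k \<beta>) \<or> (\<forall>k. coord k \<beta> \<le> 0)"
  using real_root_sign weyl_fin_sub by (metis fin_rootE)

lemma fin_root_int: "\<beta> \<in> fin_roots D \<Longrightarrow> coord k \<beta> \<in> \<int>"
  using real_root_integral weyl_fin_sub by (metis fin_rootE)

lemma pos_root_cone_iff:
  assumes "\<beta> \<in> root_span" "\<And>k. coord k \<beta> \<in> \<int>" "coord (node0 D) \<beta> = 0"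
  shows "\<beta> \<in> pos_root_cone D \<longleftrightarrow> (\<forall>k. 0 \<le> coord k \<beta>)"
proof
  assume "\<beta> \<in> pos_root_cone D"
  then obtain n :: "'i \<Rightarrow> nat" where n: "\<beta> = (\<Sum>j\<in>fin_nodes D. real (n j) *\<^sub>R \<alpha> j)"
    by (auto simp: pos_root_cone_def)
  show "\<forall>k. 0 \<le> coord k \<beta>" by (auto simp: n intro!: sum_nonneg)
next
  assume nn: "\<forall>k. 0 \<le> coord k \<beta>"
  define n where "n k = nat \<lfloor>coord k \<beta>\<rfloor>" for k
  have n: "real (n k) = coord k \<beta>" for k
    using assms(2)[of k] nn by (auto simp: n_def elim!: Ints_cases)
  have "\<beta> = (\<Sum>k\<in>UNIV. coord k \<beta> *\<^sub>R \<alpha> k)" by (rule root_span_eq[OF assms(1)])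
  also have "\<dots> = (\<Sum>k\<in>fin_nodes D. coord k \<beta> *\<^sub>R \<alpha> k)"
    using assms(3) by (intro sum.mono_neutral_right) (auto simp: fin_nodes_def)
  finally show "\<beta> \<in> pos_root_cone D" unfolding pos_root_cone_def n[symmetric] by (rule range_eqI[of _ _ n])
qed

lemma theta_span: "\<theta> \<in> root_span" by (simp add: span_diff)

lemma coord0_theta: "coord (node0 D) \<theta> = 0" by (simp add: coord_null_root mark_node0)

text \<open>Both \<open>\<beta>\<close> and its negative lie below the highest root.\<close>

lemma theta_coord_ge:
  assumes "\<beta> \<in> fin_roots D"
  shows "\<bar>coord k \<beta>\<bar> \<le> coord k \<theta>"
proof -
  have "0 \<le> coord k (\<theta> - \<gamma>)" if "\<gamma> \<in> fin_roots D" for \<gamma>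
  proof -
    have "coord k (\<theta> - \<gamma>) \<in> \<int>" for k
      using fin_root_int[OF theta_root] fin_root_int[OF that] by (simp add: Ints_diff)
    thus ?thesis
      using theta_highest[OF that] pos_root_cone_iff[of "\<theta> - \<gamma>"] that
      by (simp add: span_diff theta_span fin_root_span coord0_theta del: coord_simps)
        (metis coord0_theta diff_0_right coord_simps(2) fin_root_coord0)
  qed
  from this[OF assms] this[OF fin_root_neg[OF assms]] show ?thesis by simp
qed

lemma bform_theta [simp]: "bform \<theta> \<mu> = central D \<mu> - \<kappa> (node0 D) \<mu>"
  by (simp add: symmetrizer_def mark_node0 comark_node0)

text \<open>As \<open>\<theta>\<close> has squared length 2, its coroot is the central element minus
  the simple coroot at node 0. The reflection in \<open>\<theta>\<close> is thus the finite part of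
  the simple reflection at node 0.\<close>

lemma theta_reflection:
  obtains s where "s \<in> weyl_fin D" "\<And>\<mu>. s \<mu> = \<mu> - (central D \<mu> - \<kappa> (node0 D) \<mu>) *\<^sub>R \<theta>"
    "\<And>\<beta>. \<beta> \<in> fin_roots D \<Longrightarrow> \<kappa> (node0 D) \<beta> \<in> \<int>"
proof -
  obtain x i where x: "x \<in> weyl_fin D" "i \<in> fin_nodes D" "\<theta> = x (\<alpha> i)" by (rule fin_rootE[OF theta_root])
  have xa: "x \<in> weyl_af D" by (rule weyl_fin_sub[OF x(1)])
  have d: "symmetrizer i = 1"
    using bform_real_root[OF xa, of i] unfolding x(3)[symmetric] bform_theta by simp
  have k: "\<kappa> i (inv x \<mu>) = central D \<mu> - \<kappa> (node0 D) \<mu>" for \<mu>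
  proof -
    have "central D \<mu> - \<kappa> (node0 D) \<mu> = bform (x (\<alpha> i)) (x (inv x \<mu>))"
      unfolding x(3)[symmetric] bform_theta using xa by simp
    also have "\<dots> = \<kappa> i (inv x \<mu>)" by (simp only: weyl_bform[OF xa simple_root_span]) (simp add: d)
    finally show ?thesis by simp
  qed
  let ?s = "x \<circ> \<sigma> i \<circ> inv x"
  have "?s \<in> weyl_fin D" using x by (intro weyl_fin_comp weyl_fin_inv weyl_fin_refl)
  moreover have "?s \<mu> = \<mu> - (central D \<mu> - \<kappa> (node0 D) \<mu>) *\<^sub>R \<theta>" for \<mu>
    using xa by (simp add: simple_refl_def weyl_simps k x(3))
  moreover have "\<kappa> (node0 D) \<beta> \<in> \<int>" if b: "\<beta> \<in> fin_roots D" for \<beta>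
  proof -
    have "\<kappa> (node0 D) \<beta> = (\<Sum>k\<in>UNIV. coord k \<beta> * \<kappa> (node0 D) (\<alpha> k))"
      by (subst root_span_eq[OF fin_root_span[OF b]]) simp
    thus ?thesis using fin_root_int[OF b] by (auto intro!: Ints_sum Ints_mult cartan_int)
  qed
  ultimately show ?thesis by (rule that)
qed

section \<open>Real affine roots and their positivity\<close>

definition af_roots :: "'v set" where
  "af_roots = {\<alpha> + real_of_int n *\<^sub>R \<delta> | \<alpha> n. \<alpha> \<in> fin_roots D}"

lemma af_rootI [intro]: "\<beta> \<in> fin_roots D \<Longrightarrow> \<beta> + real_of_int n *\<^sub>R \<delta> \<in> af_roots"
  by (auto simp: af_roots_def)

lemma af_root_fin: "\<beta> \<in> fin_roots D \<Longrightarrow> \<beta> \<in> af_roots"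
  using af_rootI[of \<beta> 0] by simp

lemma af_rootE:
  assumes "\<beta> \<in> af_roots"
  obtains \<gamma> n where "\<gamma> \<in> fin_roots D" "\<beta> = \<gamma> + real_of_int n *\<^sub>R \<delta>"
  using assms by (auto simp: af_roots_def)

lemma af_root_shift: "\<beta> \<in> af_roots \<Longrightarrow> \<beta> + real_of_int n *\<^sub>R \<delta> \<in> af_roots"
  by (elim af_rootE) (metis add.assoc af_rootI of_int_add scaleR_left_distrib)

lemma af_root_simple: "\<alpha> i \<in> af_roots"
proof (cases "i = node0 D")
  case True
  have "- \<theta> + real_of_int 1 *\<^sub>R \<delta> \<in> af_roots" by (intro af_rootI fin_root_neg theta_root)
  thus ?thesis using True by simp
next
  case False
  thus ?thesis by (intro af_root_fin fin_root_simple) (simp add: fin_nodes_def)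
qed

text \<open>Only node 0 needs thought: its simple root is \<open>\<delta> - \<theta>\<close>, so the
  reflection in \<open>\<theta>\<close> acts on the finite part while the multiple of
  \<open>\<delta>\<close> shifts by an integer.\<close>

lemma af_root_refl:
  assumes "\<beta> \<in> af_roots"
  shows "\<sigma> i \<beta> \<in> af_roots"
proof -
  obtain \<gamma> n where b: "\<gamma> \<in> fin_roots D" "\<beta> = \<gamma> + real_of_int n *\<^sub>R \<delta>" by (rule af_rootE[OF assms])
  have e: "\<sigma> i \<beta> = \<sigma> i \<gamma> + real_of_int n *\<^sub>R \<delta>"
    by (simp add: b linear_add[OF linear_refl] linear_scale[OF linear_refl])
  show ?thesis
  proof (cases "i = node0 D")
    case False
    hence "\<sigma> i \<gamma> \<in> fin_roots D"
      using weyl_fin_root[OF weyl_fin_refl b(1)] by (simp add: fin_nodes_def)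
    thus ?thesis unfolding e by (rule af_rootI)
  next
    case True
    obtain s where s: "s \<in> weyl_fin D" "\<And>\<mu>. s \<mu> = \<mu> - (central D \<mu> - \<kappa> (node0 D) \<mu>) *\<^sub>R \<theta>"
      and int: "\<And>\<beta>. \<beta> \<in> fin_roots D \<Longrightarrow> \<kappa> (node0 D) \<beta> \<in> \<int>" using theta_reflection by blast
    obtain m where m: "\<kappa> (node0 D) \<gamma> = real_of_int m" using int[OF b(1)] by (auto elim: Ints_cases)
    have "s \<gamma> \<in> fin_roots D" by (rule weyl_fin_root[OF s(1) b(1)])
    moreover have "\<sigma> i \<gamma> = s \<gamma> + real_of_int (- m) *\<^sub>R \<delta>"
      by (simp add: True simple_refl_def s fin_root_span[OF b(1)] m algebra_simps)
    ultimately show ?thesis unfolding e using af_root_shift af_rootI by metis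
  qed
qed

lemma weyl_af_root: "x \<in> weyl_af D \<Longrightarrow> \<beta> \<in> af_roots \<Longrightarrow> x \<beta> \<in> af_roots"
  by (induction rule: weyl_af_induct) (simp_all add: af_root_refl)

lemma af_root_span: "\<beta> \<in> af_roots \<Longrightarrow> \<beta> \<in> root_span"
  by (elim af_rootE) (simp add: span_add span_scale fin_root_span)

lemma af_root_neg: "\<beta> \<in> af_roots \<Longrightarrow> - \<beta> \<in> af_roots"
proof (elim af_rootE)
  fix \<gamma> n assume "\<gamma> \<in> fin_roots D" "\<beta> = \<gamma> + real_of_int n *\<^sub>R \<delta>"
  thus "- \<beta> \<in> af_roots" using af_rootI[OF fin_root_neg, of \<gamma> "- n"] by simp
qed

lemma af_root_bform: "\<beta> \<in> af_roots \<Longrightarrow> 0 < bform \<beta> \<beta>"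
  by (elim af_rootE) (simp add: fin_root_bform fin_root_span)

lemma af_root_int: "\<beta> \<in> af_roots \<Longrightarrow> coord k \<beta> \<in> \<int>"
  by (elim af_rootE) (auto simp: coord_null_root intro!: Ints_add Ints_mult fin_root_int)

text \<open>A coordinate of a finite root is at least minus that of \<open>\<theta>\<close>, hence
  at least minus the mark, and a single \<open>\<delta>\<close> already compensates this.\<close>

lemma coord_pos_shift:
  assumes "\<beta> \<in> fin_roots D" "0 < n"
  shows "0 \<le> coord k (\<beta> + real_of_int n *\<^sub>R \<delta>)"
proof -
  have "coord k \<theta> \<le> real (mark D k)" by (simp add: coord_null_root)
  hence "- coord k \<beta> \<le> real (mark D k)" using theta_coord_ge[OF assms(1), of k] by simp
  also have "\<dots> \<le> real_of_int n * real (mark D k)" using assms(2) by (simp add: mult_le_cancel_right1)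
  finally show ?thesis by (simp add: coord_null_root)
qed

text \<open>Turns positivity into a sign condition on coordinates. The multiple of
  \<open>\<delta>\<close> is recovered as the coordinate at node 0, where the mark is 1.\<close>

lemma af_pos_root_iff: "\<beta> \<in> af_pos_roots D \<longleftrightarrow> \<beta> \<in> af_roots \<and> (\<forall>k. 0 \<le> coord k \<beta>)"
proof
  assume "\<beta> \<in> af_pos_roots D"
  thus "\<beta> \<in> af_roots \<and> (\<forall>k. 0 \<le> coord k \<beta>)"
    unfolding af_pos_roots_def fin_pos_roots_def
    using pos_root_cone_iff[of \<beta>] by (auto simp: af_root_fin fin_root_span fin_root_int coord_pos_shift simp del: coord_simps)
next
  assume b: "\<beta> \<in> af_roots \<and> (\<forall>k. 0 \<le> coord k \<beta>)"
  then obtain \<gamma> n where g: "\<gamma> \<in> fin_roots D" "\<beta> = \<gamma> + real_of_int n *\<^sub>R \<delta>" by (meson af_rootE)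
  have "coord (node0 D) \<beta> = real_of_int n" using g by (simp add: coord_null_root mark_node0)
  hence "0 \<le> n" using b by (metis of_int_0_le_iff)
  then consider "n = 0" | "0 < n" by linarith
  thus "\<beta> \<in> af_pos_roots D"
  proof cases
    case 1
    thus ?thesis using b g pos_root_cone_iff[of \<gamma>]
      by (auto simp: af_pos_roots_def fin_pos_roots_def fin_root_span fin_root_int)
  qed (use g in \<open>auto simp: af_pos_roots_def\<close>)
qed

lemma af_root_cases:
  assumes "\<beta> \<in> af_roots"
  shows "\<beta> \<in> af_pos_roots D \<or> - \<beta> \<in> af_pos_roots D"
proof -
  obtain \<gamma> n where g: "\<gamma> \<in> fin_roots D" "\<beta> = \<gamma> + real_of_int n *\<^sub>R \<delta>" by (rule af_rootE[OF assms])
  consider "n = 0" | "0 < n" | "0 < - n" by linarith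
  thus ?thesis
  proof cases
    case 1
    thus ?thesis using fin_root_sign[OF g(1)] g assms af_root_neg[OF assms] by (auto simp: af_pos_root_iff)
  next
    case 2
    thus ?thesis using coord_pos_shift[OF g(1) 2] assms by (auto simp: af_pos_root_iff g(2))
  next
    case 3
    have "- \<beta> = - \<gamma> + real_of_int (- n) *\<^sub>R \<delta>" by (simp add: g)
    thus ?thesis using coord_pos_shift[OF fin_root_neg[OF g(1)] 3] af_root_neg[OF assms]
      by (auto simp: af_pos_root_iff simp del: coord_simps)
  qed
qed

lemma af_root_nonzero: "\<beta> \<in> af_roots \<Longrightarrow> \<beta> \<noteq> 0"
  using af_root_bform by force

lemma af_pos_root_not_neg: "\<beta> \<in> af_pos_roots D \<Longrightarrow> - \<beta> \<notin> af_pos_roots D"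
proof
  assume b: "\<beta> \<in> af_pos_roots D" "- \<beta> \<in> af_pos_roots D"
  hence "coord k \<beta> = coord k 0" for k by (auto simp: af_pos_root_iff intro!: order_antisym)
  hence "\<beta> = 0" using b by (intro root_span_eqI) (auto simp: af_pos_root_iff span_zero intro: af_root_span)
  thus False using b(1) af_root_nonzero by (auto simp: af_pos_root_iff)
qed

lemma af_root_not_pos: "\<beta> \<in> af_roots \<Longrightarrow> \<beta> \<notin> af_pos_roots D \<longleftrightarrow> - \<beta> \<in> af_pos_roots D"
  using af_root_cases af_pos_root_not_neg[of \<beta>] by blast

lemma af_pos_root_simple: "\<alpha> i \<in> af_pos_roots D"
  by (simp add: af_pos_root_iff af_root_simple)

text \<open>That affine roots are conjugate to simple roots is proved later with the help of this
  lemma, so the multiple is compared through the finite part: \<open>\<beta>\<close> itself, or a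
  multiple of \<open>\<theta>\<close> if \<open>i\<close> is node 0.\<close>

lemma af_root_multiple_simple:
  assumes "\<beta> \<in> af_roots" and eq: "\<beta> = c *\<^sub>R \<alpha> i" and c: "0 \<le> c"
  shows "c = 1"
proof -
  obtain \<gamma> n where g: "\<gamma> \<in> fin_roots D" "\<beta> = \<gamma> + real_of_int n *\<^sub>R \<delta>" by (rule af_rootE[OF assms(1)])
  have ci: "c \<in> \<int>" using af_root_int[OF assms(1), of i] by (simp add: eq)
  have n: "real_of_int n = coord (node0 D) \<beta>" using g by (simp add: coord_null_root mark_node0)
  obtain x j where x: "x \<in> weyl_fin D" "j \<in> fin_nodes D" "\<gamma> = x (\<alpha> j)" by (rule fin_rootE[OF g(1)])
  show ?thesis
  proof (cases "i = node0 D")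
    case False
    hence "n = 0" using n by (simp add: eq)
    hence "c *\<^sub>R id (\<alpha> i) = x (\<alpha> j)" using g eq x by simp
    from real_root_multiple[OF weyl_id(1) weyl_fin_sub[OF x(1)] ci this] c show ?thesis by auto
  next
    case True
    obtain y l where y: "y \<in> weyl_fin D" "l \<in> fin_nodes D" "\<theta> = y (\<alpha> l)" by (rule fin_rootE[OF theta_root])
    have "real_of_int n = c" using n True by (simp add: eq)
    hence "\<gamma> = c *\<^sub>R (\<alpha> (node0 D) - \<delta>)" using g True by (simp add: eq algebra_simps)
    also have "\<dots> = (- c) *\<^sub>R \<theta>" by (simp add: algebra_simps)
    finally have "(- c) *\<^sub>R y (\<alpha> l) = x (\<alpha> j)" by (simp only: y(3) x(3))
    from real_root_multiple[OF weyl_fin_sub[OF y(1)] weyl_fin_sub[OF x(1)] _ this] ci c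
    show ?thesis by auto
  qed
qed

text \<open>The reflection alters only the coordinate at \<open>i\<close>. If the sign flipped, all
  others would vanish and the root would be a multiple of \<open>\<alpha> i\<close>.\<close>

lemma refl_pos_root:
  assumes "\<beta> \<in> af_pos_roots D" "\<beta> \<noteq> \<alpha> i"
  shows "\<sigma> i \<beta> \<in> af_pos_roots D"
proof (rule ccontr)
  assume n: "\<sigma> i \<beta> \<notin> af_pos_roots D"
  have b: "\<beta> \<in> af_roots" "\<And>k. 0 \<le> coord k \<beta>" using assms by (auto simp: af_pos_root_iff)
  have "- \<sigma> i \<beta> \<in> af_pos_roots D" using n af_root_not_pos[OF af_root_refl[OF b(1)]] by blast
  hence le: "coord k (\<sigma> i \<beta>) \<le> 0" for k by (simp add: af_pos_root_iff)
  have "coord k \<beta> = 0" if "k \<noteq> i" for k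
    using le[of k] b(2)[of k] that by (simp add: simple_refl_def)
  hence "\<beta> = coord i \<beta> *\<^sub>R \<alpha> i"
    by (intro root_span_eqI) (auto simp: af_root_span b span_scale)
  with af_root_multiple_simple[OF b(1) this b(2)] assms(2) show False by simp
qed

lemma refl_pos_root_iff:
  assumes "\<beta> \<noteq> \<alpha> i" "\<beta> \<noteq> - \<alpha> i"
  shows "\<sigma> i \<beta> \<in> af_pos_roots D \<longleftrightarrow> \<beta> \<in> af_pos_roots D"
proof
  assume "\<sigma> i \<beta> \<in> af_pos_roots D"
  moreover have "\<sigma> i \<beta> \<noteq> \<alpha> i" using assms(2) by (metis refl_refl refl_simple)
  ultimately show "\<beta> \<in> af_pos_roots D" using refl_pos_root[of "\<sigma> i \<beta>" i] by simp
qed (use refl_pos_root assms in auto)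

text \<open>Induction on the height: a positive root that is not simple pairs positively with some
  simple coroot, because its norm is positive.\<close>

lemma af_pos_root_induct [consumes 1, case_names simple refl]:
  assumes "\<beta> \<in> af_pos_roots D" "\<And>i. P (\<alpha> i)"
    "\<And>\<beta> i. \<beta> \<in> af_pos_roots D \<Longrightarrow> \<beta> \<noteq> \<alpha> i \<Longrightarrow> \<sigma> i \<beta> \<in> af_pos_roots D \<Longrightarrow> 0 < \<kappa> i \<beta> \<Longrightarrow> P (\<sigma> i \<beta>) \<Longrightarrow> P \<beta>"
  shows "P \<beta>"
  using assms(1)
proof (induction "nat \<lfloor>\<Sum>k\<in>UNIV. coord k \<beta>\<rfloor>" arbitrary: \<beta> rule: less_induct)
  case less
  have b: "\<beta> \<in> af_roots" "\<And>k. 0 \<le> coord k \<beta>" using less(2) by (auto simp: af_pos_root_iff)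
  show ?case
  proof (cases "\<exists>i. \<beta> = \<alpha> i")
    case True thus ?thesis using assms(2) by auto
  next
    case False
    have "\<exists>i. 0 < \<kappa> i \<beta>"
    proof (rule ccontr)
      assume "\<nexists>i. 0 < \<kappa> i \<beta>"
      hence "bform \<beta> \<beta> \<le> 0"
        unfolding bform_def using b(2) symmetrizer_pos
        by (intro sum_nonpos mult_nonneg_nonpos mult_nonneg_nonneg) (auto simp: not_less less_imp_le)
      thus False using af_root_bform[OF b(1)] by simp
    qed
    then obtain i where i: "0 < \<kappa> i \<beta>" by blast
    have s: "\<sigma> i \<beta> \<in> af_pos_roots D" using less(2) False by (intro refl_pos_root) auto
    have "\<kappa> i \<beta> \<in> \<int>"
    proof -
      have "\<kappa> i \<beta> = (\<Sum>k\<in>UNIV. coord k \<beta> * \<kappa> i (\<alpha> k))"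
        by (subst root_span_eq[OF af_root_span[OF b(1)]]) simp
      thus ?thesis using af_root_int[OF b(1)] by (auto intro!: Ints_sum Ints_mult cartan_int)
    qed
    hence k1: "1 \<le> \<kappa> i \<beta>" using i by (auto elim!: Ints_cases)
    have "(\<Sum>k\<in>UNIV. coord k (\<sigma> i \<beta>)) = (\<Sum>k\<in>UNIV. coord k \<beta>) - \<kappa> i \<beta>"
    proof -
      have "(\<Sum>k\<in>UNIV. coord k (\<sigma> i \<beta>)) = (\<Sum>k\<in>UNIV. coord k \<beta>) - (\<Sum>k\<in>UNIV. if i = k then \<kappa> i \<beta> else 0)"
        unfolding sum_subtractf[symmetric] by (intro sum.cong) (auto simp: simple_refl_def)
      thus ?thesis by simp
    qed
    moreover have "0 \<le> (\<Sum>k\<in>UNIV. coord k (\<sigma> i \<beta>))" using s by (auto simp: af_pos_root_iff intro!: sum_nonneg)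
    ultimately have "nat \<lfloor>\<Sum>k\<in>UNIV. coord k (\<sigma> i \<beta>)\<rfloor> < nat \<lfloor>\<Sum>k\<in>UNIV. coord k \<beta>\<rfloor>"
      using k1 by linarith
    from less(1)[OF this s] show ?thesis using assms(3)[OF less(2) _ s i] False by auto
  qed
qed

text \<open>Simple reflections lower the height until a simple root is reached. This gives
  \<open>coroot_of\<close>, which is defined through such presentations, a meaning on every affine
  root.\<close>

lemma af_root_real:
  assumes "\<beta> \<in> af_roots"
  obtains x i where "x \<in> weyl_af D" "\<beta> = x (\<alpha> i)"
proof -
  have pos: "\<exists>x\<in>weyl_af D. \<exists>i. \<beta> = x (\<alpha> i)" if "\<beta> \<in> af_pos_roots D" for \<beta>
    using that
  proof (induction rule: af_pos_root_induct)
    case (simple i)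
    show ?case by (rule bexI[of _ id]) auto
  next
    case (refl \<beta> i)
    then obtain x j where x: "x \<in> weyl_af D" "\<sigma> i \<beta> = x (\<alpha> j)" by blast
    hence "\<beta> = (\<sigma> i \<circ> x) (\<alpha> j)" by (metis comp_apply refl_refl)
    thus ?case using weyl_refl_comp[OF x(1)] by blast
  qed
  from af_root_cases[OF assms] show ?thesis
  proof
    assume "\<beta> \<in> af_pos_roots D"
    thus ?thesis using pos that by blast
  next
    assume "- \<beta> \<in> af_pos_roots D"
    then obtain x i where x: "x \<in> weyl_af D" "- \<beta> = x (\<alpha> i)" using pos by blast
    hence "\<beta> = (x \<circ> \<sigma> i) (\<alpha> i)" by (simp add: weyl_simps) (metis minus_minus)
    thus ?thesis using that weyl_comp[OF x(1) weyl_refl] by blast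
  qed
qed

subsection \<open>Coroots and reflections\<close>

text \<open>By invariance of the form all presentations \<open>w (\<alpha> i)\<close> of the root
  yield the same functional, so the definite description succeeds.\<close>

lemma coroot_of_eq:
  assumes "\<beta> \<in> af_roots"
  shows "coroot_of D \<beta> \<mu> = 2 * bform \<beta> \<mu> / bform \<beta> \<beta>"
proof -
  have *: "\<kappa> i (inv x \<mu>) = 2 * bform (x (\<alpha> i)) \<mu> / bform (x (\<alpha> i)) (x (\<alpha> i))" if "x \<in> weyl_af D" for x i \<mu>
  proof -
    have "bform (x (\<alpha> i)) \<mu> = symmetrizer i * \<kappa> i (inv x \<mu>)"
      using weyl_bform[OF that simple_root_span, of i "inv x \<mu>"] that by simp
    thus ?thesis using that symmetrizer_pos[of i] by (simp add: bform_real_root)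
  qed
  obtain x i where x: "x \<in> weyl_af D" "\<beta> = x (\<alpha> i)" by (rule af_root_real[OF assms])
  have "coroot_of D \<beta> = (\<lambda>\<mu>. 2 * bform \<beta> \<mu> / bform \<beta> \<beta>)"
    unfolding coroot_of_def
  proof (rule the_equality)
    show "\<exists>w\<in>weyl_af D. \<exists>i. \<beta> = w (\<alpha> i) \<and> (\<lambda>\<mu>. 2 * bform \<beta> \<mu> / bform \<beta> \<beta>) = \<kappa> i \<circ> inv w"
      using x *[OF x(1)] by (intro bexI[OF _ x(1)] exI[of _ i]) (auto simp: fun_eq_iff)
  qed (use * in \<open>auto simp: fun_eq_iff\<close>)
  thus ?thesis by simp
qed

lemma coroot_of_simple [simp]: "coroot_of D (\<alpha> i) = \<kappa> i"
  using symmetrizer_pos[of i] by (simp add: fun_eq_iff coroot_of_eq af_root_simple)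

lemma root_refl_simple [simp]: "root_refl D (\<alpha> i) = \<sigma> i"
  by (simp add: fun_eq_iff root_refl_def simple_refl_def)

lemma coroot_of_weyl:
  "\<beta> \<in> af_roots \<Longrightarrow> x \<in> weyl_af D \<Longrightarrow> coroot_of D (x \<beta>) (x \<mu>) = coroot_of D \<beta> \<mu>"
  by (simp add: coroot_of_eq weyl_af_root weyl_bform af_root_span)

lemma root_refl_weyl:
  assumes "\<beta> \<in> af_roots" "x \<in> weyl_af D"
  shows "root_refl D (x \<beta>) \<circ> x = x \<circ> root_refl D \<beta>"
  using assms by (simp add: fun_eq_iff root_refl_def coroot_of_weyl weyl_simps)

lemma root_refl_in_weyl:
  assumes "\<beta> \<in> af_roots"
  shows "root_refl D \<beta> \<in> weyl_af D"
proof -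
  obtain x i where x: "x \<in> weyl_af D" "\<beta> = x (\<alpha> i)" by (rule af_root_real[OF assms])
  have "root_refl D \<beta> = x \<circ> \<sigma> i \<circ> inv x"
  proof
    fix \<mu>
    have "root_refl D \<beta> (x (inv x \<mu>)) = x (\<sigma> i (inv x \<mu>))"
      using root_refl_weyl[OF af_root_simple x(1), of i] by (simp add: fun_eq_iff x(2))
    thus "root_refl D \<beta> \<mu> = (x \<circ> \<sigma> i \<circ> inv x) \<mu>" using x by simp
  qed
  thus ?thesis using x by (auto intro!: weyl_comp weyl_inv weyl_refl)
qed

lemma linear_coroot_of: "\<beta> \<in> af_roots \<Longrightarrow> linear (coroot_of D \<beta>)"
  by (rule linearI) (simp_all add: coroot_of_eq distrib_left add_divide_distrib)

lemma coroot_of_self: "\<beta> \<in> af_roots \<Longrightarrow> coroot_of D \<beta> \<beta> = 2"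
  using af_root_bform[of \<beta>] by (simp add: coroot_of_eq)

lemma coroot_of_root_refl: "\<beta> \<in> af_roots \<Longrightarrow> coroot_of D \<beta> (root_refl D \<beta> \<mu>) = - coroot_of D \<beta> \<mu>"
  by (simp add: root_refl_def linear_diff[OF linear_coroot_of] linear_scale[OF linear_coroot_of] coroot_of_self)

lemma root_refl_involution: "\<beta> \<in> af_roots \<Longrightarrow> root_refl D \<beta> (root_refl D \<beta> \<mu>) = \<mu>"
  by (subst (1) root_refl_def) (simp add: coroot_of_root_refl, simp add: root_refl_def)

subsection \<open>The length function of the finite Weyl group\<close>

lemma symmetrizer_node0 [simp]: "symmetrizer (node0 D) = 1"
  by (simp add: symmetrizer_def mark_node0 comark_node0)

text \<open>Integral coordinates embed the roots into a finite box bounded by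
  \<open>\<theta>\<close>.\<close>

lemma finite_fin_roots: "finite (fin_roots D)"
proof (rule inj_on_finite)
  let ?F = "\<lambda>\<beta> k. \<lfloor>coord k \<beta>\<rfloor>"
  show "inj_on ?F (fin_roots D)"
  proof (rule inj_onI)
    fix \<beta> \<gamma> assume b: "\<beta> \<in> fin_roots D" "\<gamma> \<in> fin_roots D" "?F \<beta> = ?F \<gamma>"
    hence "coord k \<beta> = coord k \<gamma>" for k
      using fin_root_int[OF b(1), of k] fin_root_int[OF b(2), of k] fun_cong[OF b(3), of k]
      by (auto elim!: Ints_cases)
    thus "\<beta> = \<gamma>" using b by (intro root_span_eqI fin_root_span) auto
  qed
  have "- coord k \<theta> \<le> coord k \<beta>" "coord k \<beta> \<le> coord k \<theta>" if "\<beta> \<in> fin_roots D" for \<beta> k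
    using theta_coord_ge[OF that, of k] by linarith+
  hence "?F \<beta> \<in> (\<Pi>\<^sub>E k\<in>UNIV. {\<lfloor>- coord k \<theta>\<rfloor>..\<lfloor>coord k \<theta>\<rfloor>})" if "\<beta> \<in> fin_roots D" for \<beta>
    using that by (auto intro!: floor_mono simp del: coord_simps)
  thus "?F ` fin_roots D \<subseteq> (\<Pi>\<^sub>E k\<in>UNIV. {\<lfloor>- coord k \<theta>\<rfloor>..\<lfloor>coord k \<theta>\<rfloor>})" by blast
  show "finite (\<Pi>\<^sub>E k\<in>UNIV. {\<lfloor>- coord k \<theta>\<rfloor>..\<lfloor>coord k \<theta>\<rfloor>})"
    by (rule finite_PiE) auto
qed

lemma fin_pos_root_iff: "\<beta> \<in> fin_pos_roots D \<longleftrightarrow> \<beta> \<in> fin_roots D \<and> \<beta> \<in> af_pos_roots D"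
  using pos_root_cone_iff[of \<beta>]
  by (auto simp: fin_pos_roots_def af_pos_root_iff af_root_fin fin_root_span fin_root_int)

lemma finite_fin_pos_roots [simp]: "finite (fin_pos_roots D)"
  using finite_fin_roots by (rule rev_finite_subset) (auto simp: fin_pos_root_iff)

lemma fin_root_cases: "\<beta> \<in> fin_roots D \<Longrightarrow> \<beta> \<in> fin_pos_roots D \<or> - \<beta> \<in> fin_pos_roots D"
  using af_root_cases[OF af_root_fin] fin_root_neg by (auto simp: fin_pos_root_iff)

lemma fin_pos_root_not_neg: "\<beta> \<in> fin_pos_roots D \<Longrightarrow> - \<beta> \<notin> fin_pos_roots D"
  using af_pos_root_not_neg by (auto simp: fin_pos_root_iff)

lemma fin_pos_root_simple: "i \<in> fin_nodes D \<Longrightarrow> \<alpha> i \<in> fin_pos_roots D"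
  by (simp add: fin_pos_root_iff fin_root_simple af_pos_root_simple)

lemma fin_refl_pos_root:
  "\<beta> \<in> fin_pos_roots D \<Longrightarrow> i \<in> fin_nodes D \<Longrightarrow> \<beta> \<noteq> \<alpha> i \<Longrightarrow> \<sigma> i \<beta> \<in> fin_pos_roots D"
  using refl_pos_root weyl_fin_root[OF weyl_fin_refl] by (simp add: fin_pos_root_iff)

definition inversions :: "('v \<Rightarrow> 'v) \<Rightarrow> 'v set" where
  "inversions v = {\<beta> \<in> fin_pos_roots D. v \<beta> \<notin> fin_pos_roots D}"

lemma finite_inversions [simp]: "finite (inversions v)"
  by (simp add: inversions_def)

text \<open>\<open>\<sigma> i\<close> permutes the positive finite roots other than
  \<open>\<alpha> i\<close>, so the two inversion sets can differ only at the positive one among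
  \<open>inv v (\<alpha> i)\<close> and its negative.\<close>

lemma inversions_refl:
  assumes v: "v \<in> weyl_fin D" and i: "i \<in> fin_nodes D"
  shows "inv v (\<alpha> i) \<in> fin_pos_roots D \<Longrightarrow> card (inversions (\<sigma> i \<circ> v)) = card (inversions v) + 1"
    and "card (inversions (\<sigma> i \<circ> v)) \<le> card (inversions v) + 1"
proof -
  have va: "v \<in> weyl_af D" by (rule weyl_fin_sub[OF v])
  let ?\<gamma> = "inv v (\<alpha> i)"
  have sub: "\<beta> \<in> inversions v" if "\<beta> \<in> inversions (\<sigma> i \<circ> v)" "\<beta> \<noteq> ?\<gamma>" for \<beta>
  proof -
    have "v \<beta> \<noteq> \<alpha> i" using that(2) va by (metis weyl_inv_cancel(2))
    thus ?thesis using that(1) fin_refl_pos_root[OF _ i, of "v \<beta>"] by (auto simp: inversions_def)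
  qed
  hence "inversions (\<sigma> i \<circ> v) \<subseteq> insert ?\<gamma> (inversions v)" by blast
  hence "card (inversions (\<sigma> i \<circ> v)) \<le> card (insert ?\<gamma> (inversions v))" by (intro card_mono) auto
  also have "\<dots> \<le> card (inversions v) + 1" by (simp add: card_insert_if)
  finally show "card (inversions (\<sigma> i \<circ> v)) \<le> card (inversions v) + 1" .
  assume g: "?\<gamma> \<in> fin_pos_roots D"
  have vg: "v ?\<gamma> = \<alpha> i" using va by simp
  have nin: "?\<gamma> \<notin> inversions v" using vg fin_pos_root_simple[OF i] by (simp add: inversions_def)
  have sup: "\<beta> \<in> inversions (\<sigma> i \<circ> v)" if b: "\<beta> \<in> inversions v" for \<beta>
  proof -
    have p: "\<beta> \<in> fin_pos_roots D" "v \<beta> \<notin> fin_pos_roots D" using b by (auto simp: inversions_def)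
    have n: "v \<beta> \<noteq> - \<alpha> i"
    proof
      assume "v \<beta> = - \<alpha> i"
      hence "\<beta> = - ?\<gamma>" using va by (metis weyl_inv_cancel(2) weyl_simps(4) weyl_inv)
      thus False using p(1) fin_pos_root_not_neg[OF g] by simp
    qed
    have "\<sigma> i (v \<beta>) \<notin> fin_pos_roots D"
    proof
      assume "\<sigma> i (v \<beta>) \<in> fin_pos_roots D"
      moreover have "\<sigma> i (v \<beta>) \<noteq> \<alpha> i" using n by (metis refl_refl refl_simple)
      ultimately show False using fin_refl_pos_root[OF _ i, of "\<sigma> i (v \<beta>)"] p(2) by simp
    qed
    thus ?thesis using p by (simp add: inversions_def)
  qed
  have "?\<gamma> \<in> inversions (\<sigma> i \<circ> v)"
    using g vg fin_pos_root_not_neg[OF fin_pos_root_simple[OF i]] by (simp add: inversions_def)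
  hence "inversions (\<sigma> i \<circ> v) = insert ?\<gamma> (inversions v)" using sub sup by blast
  thus "card (inversions (\<sigma> i \<circ> v)) = card (inversions v) + 1" using nin by simp
qed

lemma weyl_word_fin: "w \<in> lists (fin_nodes D) \<Longrightarrow> weyl_word D w \<in> weyl_fin D"
  by (auto simp: weyl_fin_def)

lemma inv_weyl_comp: "x \<in> weyl_af D \<Longrightarrow> y \<in> weyl_af D \<Longrightarrow> inv (x \<circ> y) = inv y \<circ> inv x"
  by (simp add: o_inv_distrib weyl_bij)

lemma inv_refl [simp]: "inv (\<sigma> i) = \<sigma> i"
  by (rule inv_unique_comp) (simp_all add: fun_eq_iff)

text \<open>Strong exchange: \<open>\<beta>\<close> is transported along the word until it becomes
  the simple root of the next letter, and there that letter cancels. This must occur, since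
  otherwise \<open>\<beta>\<close> would stay positive to the end.\<close>

lemma exchange:
  assumes "w \<in> lists (fin_nodes D)" "\<beta> \<in> fin_pos_roots D" "inv (weyl_word D w) \<beta> \<notin> fin_pos_roots D"
  shows "\<exists>u\<in>lists (fin_nodes D). length u + 1 = length w \<and> root_refl D \<beta> \<circ> weyl_word D w = weyl_word D u"
  using assms
proof (induction w arbitrary: \<beta> rule: list.induct)
  case (Cons j w)
  have j: "j \<in> fin_nodes D" and w: "w \<in> lists (fin_nodes D)" using Cons.prems by auto
  show ?case
  proof (cases "\<beta> = \<alpha> j")
    case True
    thus ?thesis using w by (intro bexI[of _ w]) (simp_all add: o_assoc[symmetric])
  next
    case False
    have wa: "weyl_word D w \<in> weyl_af D" by (rule weyl_fin_sub[OF weyl_word_fin[OF w]])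
    have b: "\<sigma> j \<beta> \<in> fin_pos_roots D" by (rule fin_refl_pos_root[OF Cons.prems(2) j False])
    have "inv (weyl_word D w) (\<sigma> j \<beta>) \<notin> fin_pos_roots D"
    proof -
      have "inv (weyl_word D (j # w)) \<beta> = inv (weyl_word D w) (\<sigma> j \<beta>)"
        by (subst weyl_word_Cons, subst inv_weyl_comp[OF weyl_refl wa]) simp
      thus ?thesis using Cons.prems(3) by metis
    qed
    from Cons.IH[OF w b this] obtain u where u: "u \<in> lists (fin_nodes D)" "length u + 1 = length w"
      "root_refl D (\<sigma> j \<beta>) \<circ> weyl_word D w = weyl_word D u" by blast
    have "root_refl D \<beta> \<circ> \<sigma> j = \<sigma> j \<circ> root_refl D (\<sigma> j \<beta>)"
      using root_refl_weyl[OF _ weyl_refl, of "\<sigma> j \<beta>" j] b by (simp add: fin_pos_root_iff af_root_fin)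
    hence e: "root_refl D \<beta> \<circ> weyl_word D (j # w) = weyl_word D (j # u)"
      using u(3) by (simp add: fun_eq_iff)
    show ?thesis using u(1,2) j by (intro bexI[of _ "j # u"] conjI e) simp_all
  qed
qed auto

text \<open>In a word longer than its number of inversions some letter fails to add an inversion;
  exchange removes it together with a second letter.\<close>

lemma deletion:
  assumes "w \<in> lists (fin_nodes D)" "card (inversions (weyl_word D w)) < length w"
  shows "\<exists>u\<in>lists (fin_nodes D). length u < length w \<and> weyl_word D u = weyl_word D w"
  using assms
proof (induction w rule: list.induct)
  case (Cons i w)
  have i: "i \<in> fin_nodes D" and w: "w \<in> lists (fin_nodes D)" using Cons.prems by auto
  have wf: "weyl_word D w \<in> weyl_fin D" by (rule weyl_word_fin[OF w])
  show ?case
  proof (cases "card (inversions (weyl_word D w)) < length w")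
    case True
    then obtain u where "u \<in> lists (fin_nodes D)" "length u < length w" "weyl_word D u = weyl_word D w"
      using Cons.IH[OF w] by blast
    thus ?thesis using i by (intro bexI[of _ "i # u"]) auto
  next
    case False
    hence "inv (weyl_word D w) (\<alpha> i) \<notin> fin_pos_roots D"
      using inversions_refl(1)[OF wf i] Cons.prems(2) unfolding weyl_word_Cons list.size by linarith
    from exchange[OF w fin_pos_root_simple[OF i] this] obtain u
      where "u \<in> lists (fin_nodes D)" "length u + 1 = length w" "\<sigma> i \<circ> weyl_word D w = weyl_word D u"
      by auto
    thus ?thesis by (intro bexI[of _ u]) auto
  qed
qed simp

lemma inversions_le_length:
  "w \<in> lists (fin_nodes D) \<Longrightarrow> card (inversions (weyl_word D w)) \<le> length w"
proof (induction w)
  case (Cons i w)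
  have "card (inversions (\<sigma> i \<circ> weyl_word D w)) \<le> card (inversions (weyl_word D w)) + 1"
    using Cons by (intro inversions_refl weyl_word_fin) auto
  moreover have "card (inversions (weyl_word D w)) \<le> length w" using Cons by simp
  ultimately show ?case by (simp only: weyl_word_Cons list.size)
qed (simp add: inversions_def)

lemma weyl_length_inversions:
  assumes "v \<in> weyl_fin D"
  shows "weyl_length D v = card (inversions v)"
proof -
  let ?P = "\<lambda>k. \<exists>w\<in>lists (fin_nodes D). length w = k \<and> weyl_word D w = v"
  have "\<exists>k. ?P k" using assms by (auto simp: weyl_fin_def)
  hence "?P (weyl_length D v)" unfolding weyl_length_def by (rule LeastI_ex)
  then obtain w where w: "w \<in> lists (fin_nodes D)" "length w = weyl_length D v" "weyl_word D w = v" by blast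
  have "\<not> card (inversions (weyl_word D w)) < length w"
  proof
    assume "card (inversions (weyl_word D w)) < length w"
    from deletion[OF w(1) this] obtain u where "u \<in> lists (fin_nodes D)" "length u < length w" "weyl_word D u = v"
      using w by auto
    moreover from this have "weyl_length D v \<le> length u"
      unfolding weyl_length_def by (intro Least_le) blast
    ultimately show False using w by simp
  qed
  thus ?thesis using inversions_le_length[OF w(1)] w by simp
qed

subsection \<open>Translations\<close>

text \<open>Translations indexed by vectors instead of integer coordinates: composition becomes
  addition, and conjugation by a Weyl element acts on the index.\<close>

abbreviation transl :: "'v \<Rightarrow> 'v \<Rightarrow> 'v" where
  "transl \<nu> \<mu> \<equiv> \<mu> + central D \<mu> *\<^sub>R \<nu> - (bform \<nu> \<mu> + bform \<nu> \<nu> / 2 * central D \<mu>) *\<^sub>R \<delta>"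

lemma nu_coroot_eq: "nu_coroot D \<xi> = (\<Sum>i\<in>fin_nodes D. (real_of_int (\<xi> i) / symmetrizer i) *\<^sub>R \<alpha> i)"
  by (simp add: nu_coroot_def symmetrizer_def)

lemma nu_coroot_span [simp]: "nu_coroot D \<xi> \<in> root_span"
  by (simp add: nu_coroot_eq span_sum span_scale)

lemma bform_nu_coroot: "bform (nu_coroot D \<xi>) \<mu> = coroot_pairing D \<xi> \<mu>"
  unfolding nu_coroot_eq coroot_pairing_def
  using symmetrizer_pos by (simp add: less_imp_neq[THEN not_sym])

lemma translation_eq: "translation D \<xi> = transl (nu_coroot D \<xi>)"
  by (simp add: fun_eq_iff translation_def bform_nu_coroot)

lemma transl_comp:
  assumes "\<nu> \<in> root_span" "\<nu>' \<in> root_span"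
  shows "transl \<nu> (transl \<nu>' \<mu>) = transl (\<nu> + \<nu>') \<mu>"
  using assms bform_sym[OF assms]
  by (simp add: algebra_simps scaleR_left_distrib add_divide_distrib) 

lemma weyl_transl:
  assumes "w \<in> weyl_af D" "\<nu> \<in> root_span"
  shows "w (transl \<nu> \<mu>) = transl (w \<nu>) (w \<mu>)"
  using assms by (simp add: weyl_simps weyl_null weyl_central weyl_bform)

abbreviation "transl_lattice \<equiv> range (nu_coroot D)"

lemma transl_lattice_add: "\<nu> \<in> transl_lattice \<Longrightarrow> \<nu>' \<in> transl_lattice \<Longrightarrow> \<nu> + \<nu>' \<in> transl_lattice"
proof (elim imageE, simp only:)
  fix \<xi> \<xi>'
  show "nu_coroot D \<xi> + nu_coroot D \<xi>' \<in> transl_lattice"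
    by (rule range_eqI[of _ _ "\<lambda>i. \<xi> i + \<xi>' i"])
      (simp add: nu_coroot_eq add_divide_distrib scaleR_left_distrib sum.distrib)
qed

text \<open>The vector subtracted by the reflection is \<open>m\<close> times the image of the
  simple coroot. By symmetry of the form, \<open>m\<close> is a pairing of \<open>\<xi>\<close> with
  the simple root and so an integer.\<close>

lemma transl_lattice_refl:
  assumes "\<nu> \<in> transl_lattice" "i \<in> fin_nodes D"
  shows "\<sigma> i \<nu> \<in> transl_lattice"
proof -
  obtain \<xi> where n: "\<nu> = nu_coroot D \<xi>" using assms by blast
  have "symmetrizer i * \<kappa> i \<nu> = coroot_pairing D \<xi> (\<alpha> i)"
    unfolding bform_simple_left[symmetric] bform_nu_coroot[symmetric] n by (rule bform_sym) auto
  moreover have "coroot_pairing D \<xi> (\<alpha> i) \<in> \<int>"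
    unfolding coroot_pairing_def by (auto intro!: Ints_sum Ints_mult cartan_int)
  ultimately obtain m where m: "symmetrizer i * \<kappa> i \<nu> = real_of_int m" by (auto elim: Ints_cases)
  hence k: "\<kappa> i \<nu> = real_of_int m / symmetrizer i" using symmetrizer_pos[of i] by (simp add: field_simps)
  have "nu_coroot D (\<lambda>j. \<xi> j - (if j = i then m else 0)) =
      \<nu> - (\<Sum>j\<in>fin_nodes D. if j = i then \<kappa> i \<nu> *\<^sub>R \<alpha> i else 0)"
    unfolding k unfolding n nu_coroot_eq sum_subtractf[symmetric]
    by (intro sum.cong) (auto simp: diff_divide_distrib scaleR_left_diff_distrib)
  also have "(\<Sum>j\<in>fin_nodes D. if j = i then \<kappa> i \<nu> *\<^sub>R \<alpha> i else 0) = \<kappa> i \<nu> *\<^sub>R \<alpha> i"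
    using assms(2) by simp
  finally have e: "nu_coroot D (\<lambda>j. \<xi> j - (if j = i then m else 0)) = \<nu> - \<kappa> i \<nu> *\<^sub>R \<alpha> i" .
  show ?thesis unfolding simple_refl_def e[symmetric] by (rule rangeI)
qed

lemma transl_lattice_weyl: "w \<in> weyl_fin D \<Longrightarrow> \<nu> \<in> transl_lattice \<Longrightarrow> w \<nu> \<in> transl_lattice"
proof (induction rule: weyl_fin_induct)
  case (step w i)
  from transl_lattice_refl[OF step(3)[OF step(4)] step(2)] show ?case by simp
qed simp

text \<open>The comarks are the coordinates of the coroot of \<open>\<theta>\<close>, which is the
  central element without its term at node 0.\<close>

lemma theta_transl_lattice: "\<theta> \<in> transl_lattice"
proof (rule range_eqI)
  have "nu_coroot D (\<lambda>i. int (comark D i)) = (\<Sum>i\<in>fin_nodes D. real (mark D i) *\<^sub>R \<alpha> i)"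
    unfolding nu_coroot_def using comark_pos by (intro sum.cong) (auto simp: less_imp_neq[THEN not_sym])
  also have "\<dots> = \<theta>"
    unfolding null_root_def fin_nodes_def by (subst sum.remove[of UNIV "node0 D"]) (auto simp: mark_node0)
  finally show "\<theta> = nu_coroot D (\<lambda>i. int (comark D i))" ..
qed

lemma weyl_af_decomp:
  assumes "x \<in> weyl_af D"
  obtains v \<zeta> where "v \<in> weyl_fin D" "x = v \<circ> translation D \<zeta>"
proof -
  have "\<exists>v\<in>weyl_fin D. \<exists>\<nu>\<in>transl_lattice. x = v \<circ> transl \<nu>"
    using assms
  proof (induction rule: weyl_af_induct)
    case id
    have "nu_coroot D (\<lambda>_. 0) = 0" by (simp add: nu_coroot_def)
    hence "0 \<in> transl_lattice" by (metis rangeI)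
    thus ?case by (intro bexI[of _ id] bexI[of _ 0]) auto
  next
    case (step x i)
    then obtain v \<nu> where v: "v \<in> weyl_fin D" and nu: "\<nu> \<in> transl_lattice" and x: "x = v \<circ> transl \<nu>" by blast
    show ?case
    proof (cases "i = node0 D")
      case False
      hence "\<sigma> i \<circ> v \<in> weyl_fin D" using v by (intro weyl_fin_comp weyl_fin_refl) (auto simp: fin_nodes_def)
      moreover have "\<sigma> i \<circ> x = (\<sigma> i \<circ> v) \<circ> transl \<nu>" by (simp only: x o_assoc)
      ultimately show ?thesis using nu by blast
    next
      case True
      obtain s where s: "s \<in> weyl_fin D" "\<And>\<mu>. s \<mu> = \<mu> - (central D \<mu> - \<kappa> (node0 D) \<mu>) *\<^sub>R \<theta>"
        "\<And>\<beta>. \<beta> \<in> fin_roots D \<Longrightarrow> \<kappa> (node0 D) \<beta> \<in> \<int>"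
        using theta_reflection by blast
      have bt: "bform \<theta> \<theta> = 2" by simp
      \<comment> \<open>This is the identity
        \<open>r\<^sub>0 = t\<^sub>\<theta> s\<^sub>\<theta>\<close>, valid at every level.\<close>
      have 0: "\<sigma> i \<mu> = transl \<theta> (s \<mu>)" for \<mu>
      proof -
        have c: "central D (s \<mu>) = central D \<mu>" by (rule weyl_central[OF weyl_fin_sub[OF s(1)]])
        have b: "bform \<theta> (s \<mu>) = - (central D \<mu> - \<kappa> (node0 D) \<mu>)"
          by (simp add: s(2) algebra_simps)
        show ?thesis unfolding c b bt s(2)
          by (simp add: True simple_refl_def algebra_simps)
      qed
      let ?w = "s \<circ> v"
      have w: "?w \<in> weyl_fin D" by (rule weyl_fin_comp[OF s(1) v])
      note wa = weyl_fin_sub[OF w]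
      \<comment> \<open>Moving the translation by \<open>\<theta>\<close> from the left of
        \<open>?w\<close> to its right turns it into the translation by this vector.\<close>
      let ?\<nu> = "inv ?w \<theta>"
      have nu': "?\<nu> \<in> transl_lattice" by (rule transl_lattice_weyl[OF weyl_fin_inv[OF w] theta_transl_lattice])
      have span: "?\<nu> \<in> root_span" "\<nu> \<in> root_span" using nu' nu by auto
      have "(\<sigma> i \<circ> x) \<mu> = (?w \<circ> transl (?\<nu> + \<nu>)) \<mu>" for \<mu>
      proof -
        have "(\<sigma> i \<circ> x) \<mu> = transl (?w ?\<nu>) (?w (transl \<nu> \<mu>))"
          unfolding weyl_inv_cancel(1)[OF wa] by (simp only: 0 x comp_apply)
        also have "\<dots> = ?w (transl ?\<nu> (transl \<nu> \<mu>))" by (rule weyl_transl[OF wa span(1), symmetric])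
        also have "\<dots> = ?w (transl (?\<nu> + \<nu>) \<mu>)" by (subst transl_comp[OF span]) (rule refl)
        finally show ?thesis by simp
      qed
      hence "\<sigma> i \<circ> x = ?w \<circ> transl (?\<nu> + \<nu>)" by blast
      thus ?thesis using w transl_lattice_add[OF nu' nu] by blast
    qed
  qed
  then obtain v \<zeta> where "v \<in> weyl_fin D" "x = v \<circ> transl (nu_coroot D \<zeta>)" by blast
  thus ?thesis using that unfolding translation_eq[symmetric] by blast
qed

subsection \<open>The semi-infinite length as a signed count of inversions\<close>

text \<open>The least \<open>n\<close> such that \<open>\<beta> + n \<delta>\<close> is positive.\<close>

definition threshold :: "'v \<Rightarrow> real" where
  "threshold \<beta> = - coord (node0 D) \<beta> +
     (if \<beta> - coord (node0 D) \<beta> *\<^sub>R \<delta> \<in> fin_pos_roots D then 0 else 1)"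

lemma threshold_fin:
  "\<gamma> \<in> fin_roots D \<Longrightarrow> threshold (\<gamma> + c *\<^sub>R \<delta>) = - c + (if \<gamma> \<in> fin_pos_roots D then 0 else 1)"
  by (simp add: threshold_def coord_null_root mark_node0)

lemma threshold_iff:
  assumes "\<beta> \<in> af_roots"
  shows "\<beta> + real_of_int n *\<^sub>R \<delta> \<in> af_pos_roots D \<longleftrightarrow> threshold \<beta> \<le> real_of_int n"
proof -
  obtain \<gamma> m where g: "\<gamma> \<in> fin_roots D" "\<beta> = \<gamma> + real_of_int m *\<^sub>R \<delta>" by (rule af_rootE[OF assms])
  have e: "\<beta> + real_of_int n *\<^sub>R \<delta> = \<gamma> + real_of_int (m + n) *\<^sub>R \<delta>"
    by (simp add: g scaleR_left_distrib)
  have c0: "coord (node0 D) (\<gamma> + real_of_int (m + n) *\<^sub>R \<delta>) = real_of_int (m + n)"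
    using g by (simp add: coord_null_root mark_node0)
  have "\<gamma> + real_of_int (m + n) *\<^sub>R \<delta> \<in> af_pos_roots D \<longleftrightarrow> 0 < m + n \<or> (m + n = 0 \<and> \<gamma> \<in> fin_pos_roots D)"
  proof (cases "m + n" "0::int" rule: linorder_cases)
    case less
    have "\<not> 0 \<le> coord (node0 D) (\<gamma> + real_of_int (m + n) *\<^sub>R \<delta>)" unfolding c0 using less by linarith
    thus ?thesis using less by (auto simp: af_pos_root_iff simp del: coord_simps)
  next
    case equal
    hence "real_of_int m + real_of_int n = 0" by linarith
    thus ?thesis using equal g by (simp add: fin_pos_root_iff)
  next
    case greater
    thus ?thesis using coord_pos_shift[OF g(1) greater] af_rootI[OF g(1), of "m + n"]
      by (simp add: af_pos_root_iff del: coord_simps)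
  qed
  also have "\<dots> \<longleftrightarrow> threshold \<beta> \<le> real_of_int n"
    unfolding g(2) threshold_fin[OF g(1)] by auto
  finally show ?thesis unfolding e .
qed

lemma threshold_int: "\<beta> \<in> af_roots \<Longrightarrow> threshold \<beta> \<in> \<int>"
  by (auto simp: threshold_def intro!: Ints_add Ints_minus af_root_int)

lemma threshold_eqI:
  assumes "\<beta> \<in> af_roots" "\<gamma> \<in> af_roots"
    "\<And>n. \<beta> + real_of_int n *\<^sub>R \<delta> \<in> af_pos_roots D \<longleftrightarrow> \<gamma> + real_of_int n *\<^sub>R \<delta> \<in> af_pos_roots D"
  shows "threshold \<beta> = threshold \<gamma>"
proof -
  obtain a where a: "threshold \<beta> = real_of_int a" using threshold_int[OF assms(1)] by (auto elim: Ints_cases)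
  obtain b where b: "threshold \<gamma> = real_of_int b" using threshold_int[OF assms(2)] by (auto elim: Ints_cases)
  have "a \<le> n \<longleftrightarrow> b \<le> n" for n
    using assms(3)[of n] threshold_iff[OF assms(1), of n] threshold_iff[OF assms(2), of n] a b by simp
  from this[of a] this[of b] show ?thesis using a b by simp
qed

text \<open>Node 0 is no exception: its simple root \<open>- \<theta> + \<delta>\<close> has a
  negative finite part, whose threshold 1 is cancelled by the shift.\<close>

lemma simple_shift_pos: "\<alpha> i + real_of_int n *\<^sub>R \<delta> \<in> af_pos_roots D \<longleftrightarrow> 0 \<le> n"
proof -
  have "threshold (\<alpha> i) = 0"
  proof (cases "i = node0 D")
    case True
    have "\<alpha> i = - \<theta> + 1 *\<^sub>R \<delta>" using True by simp
    moreover have "- \<theta> \<notin> fin_pos_roots D"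
    proof
      assume a: "- \<theta> \<in> fin_pos_roots D"
      have "0 \<le> coord k \<theta>" for k using theta_coord_ge[OF theta_root, of k] by linarith
      hence "\<theta> \<in> fin_pos_roots D"
        using theta_root by (simp add: fin_pos_root_iff af_pos_root_iff af_root_fin)
      thus False using a fin_pos_root_not_neg by blast
    qed
    ultimately show ?thesis using threshold_fin[OF fin_root_neg[OF theta_root], of 1] by simp
  next
    case False
    hence "i \<in> fin_nodes D" by (simp add: fin_nodes_def)
    thus ?thesis using threshold_fin[OF fin_root_simple, of i 0] fin_pos_root_simple by simp
  qed
  thus ?thesis using threshold_iff[OF af_root_simple, of i n] by simp
qed

lemma neg_simple_shift_pos: "- \<alpha> i + real_of_int n *\<^sub>R \<delta> \<in> af_pos_roots D \<longleftrightarrow> 0 < n"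
proof -
  have r: "\<alpha> i + real_of_int (- n) *\<^sub>R \<delta> \<in> af_roots" by (rule af_root_shift[OF af_root_simple])
  have e: "- \<alpha> i + real_of_int n *\<^sub>R \<delta> = - (\<alpha> i + real_of_int (- n) *\<^sub>R \<delta>)" by simp
  show ?thesis unfolding e af_root_not_pos[OF r, symmetric] simple_shift_pos by auto
qed

lemma threshold_simple: "threshold (\<alpha> i + real_of_int n *\<^sub>R \<delta>) = - real_of_int n"
  and threshold_neg_simple: "threshold (- \<alpha> i + real_of_int n *\<^sub>R \<delta>) = 1 - real_of_int n"
proof -
  have r: "\<alpha> i + real_of_int n *\<^sub>R \<delta> \<in> af_roots" by (rule af_root_shift[OF af_root_simple])
  have r': "- \<alpha> i + real_of_int n *\<^sub>R \<delta> \<in> af_roots" by (rule af_root_shift[OF af_root_neg[OF af_root_simple]])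
  obtain a where a: "threshold (\<alpha> i + real_of_int n *\<^sub>R \<delta>) = real_of_int a"
    using threshold_int[OF r] by (auto elim: Ints_cases)
  obtain b where b: "threshold (- \<alpha> i + real_of_int n *\<^sub>R \<delta>) = real_of_int b"
    using threshold_int[OF r'] by (auto elim: Ints_cases)
  have "a \<le> m \<longleftrightarrow> 0 \<le> n + m" for m
    using threshold_iff[OF r, of m] simple_shift_pos[of i "n + m"] a
    by (simp add: scaleR_left_distrib add.assoc)
  from this[of a] this[of "- n"] show "threshold (\<alpha> i + real_of_int n *\<^sub>R \<delta>) = - real_of_int n" using a by simp
  have "b \<le> m \<longleftrightarrow> 0 < n + m" for m
  proof -
    have e: "- \<alpha> i + real_of_int n *\<^sub>R \<delta> + real_of_int m *\<^sub>R \<delta> = - \<alpha> i + real_of_int (n + m) *\<^sub>R \<delta>"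
      by (simp only: of_int_add scaleR_left_distrib add.assoc)
    show ?thesis using threshold_iff[OF r', of m] unfolding e b neg_simple_shift_pos by simp
  qed
  from this[of b] this[of "1 - n"] show "threshold (- \<alpha> i + real_of_int n *\<^sub>R \<delta>) = 1 - real_of_int n" using b by simp
qed

text \<open>\<open>\<sigma> i\<close> permutes the positive roots other than
  \<open>\<alpha> i\<close>, so positivity changes only in the two \<open>\<delta>\<close>-strings
  through \<open>\<alpha> i\<close> and its negative. These are interchanged, and their thresholds
  differ by one.\<close>

lemma threshold_refl:
  assumes b: "\<beta> \<in> af_roots"
  shows "threshold (\<sigma> i \<beta>) = threshold \<beta>
      + (if \<exists>n. \<beta> = \<alpha> i + real_of_int n *\<^sub>R \<delta> then 1 else 0)
      - (if \<exists>n. \<beta> = - \<alpha> i + real_of_int n *\<^sub>R \<delta> then 1 else 0)"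
proof -
  have disj: "\<alpha> i + real_of_int n *\<^sub>R \<delta> \<noteq> - \<alpha> i + real_of_int m *\<^sub>R \<delta>" for n m
  proof
    assume "\<alpha> i + real_of_int n *\<^sub>R \<delta> = - \<alpha> i + real_of_int m *\<^sub>R \<delta>"
    hence "\<kappa> i (\<alpha> i + real_of_int n *\<^sub>R \<delta>) = \<kappa> i (- \<alpha> i + real_of_int m *\<^sub>R \<delta>)" by simp
    thus False by simp
  qed
  have s: "\<sigma> i (\<gamma> + real_of_int n *\<^sub>R \<delta>) = \<sigma> i \<gamma> + real_of_int n *\<^sub>R \<delta>" for \<gamma> n
    by (simp add: linear_add[OF linear_refl] linear_scale[OF linear_refl])
  have sn: "\<sigma> i (- \<alpha> i) = \<alpha> i" by (simp add: linear_neg[OF linear_refl])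
  consider n where "\<beta> = \<alpha> i + real_of_int n *\<^sub>R \<delta>" | n where "\<beta> = - \<alpha> i + real_of_int n *\<^sub>R \<delta>"
    | "\<nexists>n. \<beta> = \<alpha> i + real_of_int n *\<^sub>R \<delta>" "\<nexists>n. \<beta> = - \<alpha> i + real_of_int n *\<^sub>R \<delta>" by blast
  thus ?thesis
  proof cases
    case 1
    thus ?thesis using disj s by (auto simp: threshold_simple threshold_neg_simple threshold_neg_simple[simplified])
  next
    case 2
    hence e: "\<sigma> i \<beta> = \<alpha> i + real_of_int n *\<^sub>R \<delta>" by (simp only: s sn)
    show ?thesis unfolding e threshold_simple using 2 disj[symmetric]
      by (auto simp: threshold_neg_simple[simplified])
  next
    case 3
    have "threshold (\<sigma> i \<beta>) = threshold \<beta>"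
    proof (rule threshold_eqI[OF af_root_refl[OF b] b])
      fix n
      have "\<beta> + real_of_int n *\<^sub>R \<delta> \<noteq> \<gamma>" if "\<nexists>n. \<beta> = \<gamma> + real_of_int n *\<^sub>R \<delta>" for \<gamma>
      proof
        assume "\<beta> + real_of_int n *\<^sub>R \<delta> = \<gamma>"
        hence "\<beta> = \<gamma> + real_of_int (- n) *\<^sub>R \<delta>" by auto
        thus False using that by blast
      qed
      with 3 show "\<sigma> i \<beta> + real_of_int n *\<^sub>R \<delta> \<in> af_pos_roots D \<longleftrightarrow> \<beta> + real_of_int n *\<^sub>R \<delta> \<in> af_pos_roots D"
        unfolding s[symmetric] by (intro refl_pos_root_iff) blast+
    qed
    thus ?thesis using 3 by simp
  qed
qed

text \<open>If \<open>x\<close> is \<open>v\<close> after the translation by \<open>\<zeta>\<close>,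
  a positive root contributes its pairing with \<open>\<zeta>\<close>, plus 1 if \<open>v\<close>
  inverts it. The sum involves \<open>x\<close> alone, so the definite description is independent of
  the decomposition.\<close>

lemma semi_inf_length_eq:
  assumes "x \<in> weyl_af D"
  shows "semi_inf_length D x = (\<Sum>\<beta>\<in>fin_pos_roots D. threshold (x \<beta>))"
proof -
  have *: "real (weyl_length D v) + 2 * coroot_pairing D \<zeta> (half_sum_pos D) =
      (\<Sum>\<beta>\<in>fin_pos_roots D. threshold ((v \<circ> translation D \<zeta>) \<beta>))" if v: "v \<in> weyl_fin D" for v \<zeta>
  proof -
    have va: "v \<in> weyl_af D" by (rule weyl_fin_sub[OF v])
    have "threshold ((v \<circ> translation D \<zeta>) \<beta>) = bform (nu_coroot D \<zeta>) \<beta> + (if \<beta> \<in> inversions v then 1 else 0)"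
      if b: "\<beta> \<in> fin_pos_roots D" for \<beta>
    proof -
      have bf: "\<beta> \<in> fin_roots D" using b by (simp add: fin_pos_root_iff)
      have "(v \<circ> translation D \<zeta>) \<beta> = v \<beta> + (- bform (nu_coroot D \<zeta>) \<beta>) *\<^sub>R \<delta>"
        using va bf by (simp add: translation_eq fin_root_span weyl_simps weyl_null)
      thus ?thesis using b by (simp only: threshold_fin[OF weyl_fin_root[OF v bf]]) (auto simp: inversions_def)
    qed
    hence "(\<Sum>\<beta>\<in>fin_pos_roots D. threshold ((v \<circ> translation D \<zeta>) \<beta>)) =
        (\<Sum>\<beta>\<in>fin_pos_roots D. bform (nu_coroot D \<zeta>) \<beta>) + (\<Sum>\<beta>\<in>fin_pos_roots D. if \<beta> \<in> inversions v then 1 else 0)"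
      by (simp add: sum.distrib)
    also have "(\<Sum>\<beta>\<in>fin_pos_roots D. if \<beta> \<in> inversions v then 1 else (0::real)) = real (card (inversions v))"
      by (simp add: sum.If_cases inversions_def Int_def)
    finally show ?thesis
      by (simp add: weyl_length_inversions[OF v] half_sum_pos_def bform_nu_coroot[symmetric])
  qed
  obtain v \<zeta> where v: "v \<in> weyl_fin D" "x = v \<circ> translation D \<zeta>" by (rule weyl_af_decomp[OF assms])
  show ?thesis
    unfolding semi_inf_length_def
  proof (rule the_equality)
    show "\<exists>v\<in>weyl_fin D. \<exists>\<zeta>. x = v \<circ> translation D \<zeta> \<and>
        (\<Sum>\<beta>\<in>fin_pos_roots D. threshold (x \<beta>)) = real (weyl_length D v) + 2 * coroot_pairing D \<zeta> (half_sum_pos D)"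
      using v *[OF v(1), of \<zeta>] by (intro bexI[OF _ v(1)] exI[of _ \<zeta>]) simp
  qed (use * in auto)
qed

subsection \<open>The weight lattice\<close>

lemma weight_lattice_0: "0 \<in> weight_lattice D"
  and weight_lattice_add: "\<mu> \<in> weight_lattice D \<Longrightarrow> \<nu> \<in> weight_lattice D \<Longrightarrow> \<mu> + \<nu> \<in> weight_lattice D"
  and weight_lattice_scale: "\<mu> \<in> weight_lattice D \<Longrightarrow> real_of_int m *\<^sub>R \<mu> \<in> weight_lattice D"
proof -
  obtain B where B: "weight_lattice D = range (\<lambda>n :: 'v \<Rightarrow> int. \<Sum>b\<in>B. real_of_int (n b) *\<^sub>R b)"
    using lattice by blast
  show "0 \<in> weight_lattice D" unfolding B by (rule range_eqI[of _ _ "\<lambda>_. 0"]) simp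
  show "\<mu> \<in> weight_lattice D \<Longrightarrow> \<nu> \<in> weight_lattice D \<Longrightarrow> \<mu> + \<nu> \<in> weight_lattice D"
    unfolding B
  proof (elim imageE, simp only:)
    fix n n' :: "'v \<Rightarrow> int"
    show "(\<Sum>b\<in>B. real_of_int (n b) *\<^sub>R b) + (\<Sum>b\<in>B. real_of_int (n' b) *\<^sub>R b)
        \<in> range (\<lambda>n. \<Sum>b\<in>B. real_of_int (n b) *\<^sub>R b)"
      by (rule range_eqI[of _ _ "\<lambda>b. n b + n' b"]) (simp add: scaleR_left_distrib sum.distrib)
  qed
  show "\<mu> \<in> weight_lattice D \<Longrightarrow> real_of_int m *\<^sub>R \<mu> \<in> weight_lattice D"
    unfolding B
  proof (elim imageE, simp only:)
    fix n :: "'v \<Rightarrow> int"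
    show "real_of_int m *\<^sub>R (\<Sum>b\<in>B. real_of_int (n b) *\<^sub>R b) \<in> range (\<lambda>n. \<Sum>b\<in>B. real_of_int (n b) *\<^sub>R b)"
      by (rule range_eqI[of _ _ "\<lambda>b. m * n b"]) (simp add: scaleR_right.sum)
  qed
qed

lemma weight_lattice_scale_Ints: "\<mu> \<in> weight_lattice D \<Longrightarrow> c \<in> \<int> \<Longrightarrow> c *\<^sub>R \<mu> \<in> weight_lattice D"
  using weight_lattice_scale by (auto elim!: Ints_cases)

lemma weight_lattice_neg: "\<mu> \<in> weight_lattice D \<Longrightarrow> - \<mu> \<in> weight_lattice D"
  using weight_lattice_scale[of \<mu> "-1"] by simp

lemma weight_lattice_diff: "\<mu> \<in> weight_lattice D \<Longrightarrow> \<nu> \<in> weight_lattice D \<Longrightarrow> \<mu> - \<nu> \<in> weight_lattice D"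
  using weight_lattice_add[OF _ weight_lattice_neg] by fastforce

lemma weight_lattice_sum: "(\<And>x. x \<in> A \<Longrightarrow> f x \<in> weight_lattice D) \<Longrightarrow> sum f A \<in> weight_lattice D"
  by (induction A rule: infinite_finite_induct) (auto intro: weight_lattice_0 weight_lattice_add)

lemma weyl_weight_lattice: "x \<in> weyl_af D \<Longrightarrow> \<mu> \<in> weight_lattice D \<Longrightarrow> x \<mu> \<in> weight_lattice D"
proof (induction rule: weyl_af_induct)
  case (step x i)
  thus ?case
    by (auto simp: simple_refl_def intro!: weight_lattice_diff weight_lattice_scale_Ints simple_root_in_lattice coroot_integral)
qed simp

lemma af_root_weight_lattice:
  assumes "\<beta> \<in> af_roots"
  shows "\<beta> \<in> weight_lattice D"
proof -
  obtain x i where "x \<in> weyl_af D" "\<beta> = x (\<alpha> i)" by (rule af_root_real[OF assms])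
  thus ?thesis using weyl_weight_lattice simple_root_in_lattice by simp
qed

lemma central_fund_weight: "central D (fund_weight D i) = real (comark D i)"
  by (simp add: central_def coroot_fund_weight if_distrib cong: if_cong)

end

subsection \<open>Dominant weights of level zero\<close>

locale dominant_weight = untwisted_affine D
  for D :: "('i::finite, 'v::real_vector) affine_datum" +
  fixes lam :: 'v
  assumes dominant: "lam \<in> dominant_weights D"
begin

abbreviation "J \<equiv> stab_nodes D lam"

lemma central_lam [simp]: "central D lam = 0"
  and lam_lattice: "lam \<in> weight_lattice D"
  and coroot_lam_nonneg: "k \<in> fin_nodes D \<Longrightarrow> 0 \<le> \<kappa> k lam"
proof -
  obtain n :: "'i \<Rightarrow> nat" where n: "lam = (\<Sum>i\<in>fin_nodes D. real (n i) *\<^sub>R level_zero_fund_weight D i)"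
    using dominant by (auto simp: dominant_weights_def)
  show "central D lam = 0"
    by (simp add: n level_zero_fund_weight_def central_fund_weight comark_node0)
  have "level_zero_fund_weight D i \<in> weight_lattice D" for i
    unfolding level_zero_fund_weight_def central_fund_weight
    by (intro weight_lattice_diff weight_lattice_scale_Ints fund_weight_in_lattice) auto
  thus "lam \<in> weight_lattice D"
    unfolding n by (intro weight_lattice_sum weight_lattice_scale_Ints) auto
  show "0 \<le> \<kappa> k lam" if "k \<in> fin_nodes D"
    using that by (auto simp: n level_zero_fund_weight_def coroot_fund_weight fin_nodes_def intro!: sum_nonneg)
qed

text \<open>All summands of the pairing are nonnegative, so it can vanish only termwise.\<close>

lemma fin_pos_root_lam:
  assumes "\<beta> \<in> fin_pos_roots D"
  shows "0 \<le> bform \<beta> lam" and "bform \<beta> lam = 0 \<longleftrightarrow> (\<forall>k. k \<notin> J \<longrightarrow> coord k \<beta> = 0)"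
proof -
  have c: "0 \<le> coord k \<beta>" "coord (node0 D) \<beta> = 0" for k
    using assms by (auto simp: fin_pos_root_iff af_pos_root_iff)
  have t: "0 \<le> coord k \<beta> * symmetrizer k * \<kappa> k lam" for k
  proof (cases "k = node0 D")
    case False
    thus ?thesis using c(1)[of k] coroot_lam_nonneg[of k] symmetrizer_pos[of k]
      by (intro mult_nonneg_nonneg) (auto simp: fin_nodes_def)
  qed (simp add: c)
  show "0 \<le> bform \<beta> lam" unfolding bform_def by (intro sum_nonneg t)
  have "bform \<beta> lam = 0 \<longleftrightarrow> (\<forall>k. coord k \<beta> * symmetrizer k * \<kappa> k lam = 0)"
    unfolding bform_def by (subst sum_nonneg_eq_0_iff) (use t in auto)
  also have "\<dots> \<longleftrightarrow> (\<forall>k. k \<notin> J \<longrightarrow> coord k \<beta> = 0)"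
    using c(2) symmetrizer_pos by (auto simp: stab_nodes_def fin_nodes_def less_imp_neq[THEN not_sym])
  finally show "bform \<beta> lam = 0 \<longleftrightarrow> (\<forall>k. k \<notin> J \<longrightarrow> coord k \<beta> = 0)" .
qed

text \<open>Replaces the subset \<open>J\<close> by orthogonality to \<open>lam\<close>, a condition
  that the invariant form carries along with a Weyl element.\<close>

lemma root_lattice_J_iff:
  assumes "\<beta> \<in> fin_roots D"
  shows "\<beta> \<in> root_lattice D J \<longleftrightarrow> bform \<beta> lam = 0"
proof -
  have "bform \<beta> lam = 0 \<longleftrightarrow> (\<forall>k. k \<notin> J \<longrightarrow> coord k \<beta> = 0)"
    using fin_root_cases[OF assms] fin_pos_root_lam(2)[of \<beta>] fin_pos_root_lam(2)[of "- \<beta>"] by auto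
  also have "\<dots> \<longleftrightarrow> \<beta> \<in> root_lattice D J"
  proof
    assume z: "\<forall>k. k \<notin> J \<longrightarrow> coord k \<beta> = 0"
    have "\<exists>n. \<forall>k. coord k \<beta> = real_of_int (n k)"
      by (rule choice) (use fin_root_int[OF assms] in \<open>auto elim!: Ints_cases\<close>)
    then obtain n where n: "\<And>k. coord k \<beta> = real_of_int (n k)" by blast
    have "\<beta> = (\<Sum>k\<in>UNIV. coord k \<beta> *\<^sub>R \<alpha> k)" by (rule root_span_eq[OF fin_root_span[OF assms]])
    also have "\<dots> = (\<Sum>k\<in>J. coord k \<beta> *\<^sub>R \<alpha> k)" using z by (intro sum.mono_neutral_right) auto
    finally show "\<beta> \<in> root_lattice D J" unfolding n root_lattice_def by (rule range_eqI[of _ _ n])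
  next
    assume "\<beta> \<in> root_lattice D J"
    then obtain n :: "'i \<Rightarrow> int" where n: "\<beta> = (\<Sum>j\<in>J. real_of_int (n j) *\<^sub>R \<alpha> j)"
      by (auto simp: root_lattice_def)
    show "\<forall>k. k \<notin> J \<longrightarrow> coord k \<beta> = 0" by (auto simp: n intro!: sum.neutral)
  qed
  finally show ?thesis by simp
qed

lemma af_pos_roots_J_iff: "\<beta> \<in> af_pos_roots_J D J \<longleftrightarrow> \<beta> \<in> af_pos_roots D \<and> bform \<beta> lam = 0"
proof -
  have "\<beta> \<in> af_pos_roots_J D J" if b: "\<beta> \<in> af_pos_roots D" "bform \<beta> lam = 0"
  proof -
    have "\<beta> \<in> af_roots" using b by (simp add: af_pos_root_iff)
    then obtain \<gamma> n where g: "\<gamma> \<in> fin_roots D" "\<beta> = \<gamma> + real_of_int n *\<^sub>R \<delta>" by (rule af_rootE)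
    moreover have "\<gamma> \<in> root_lattice D J" using b g by (simp add: root_lattice_J_iff)
    ultimately show ?thesis using b by (auto simp: af_pos_roots_J_def)
  qed
  moreover have "bform \<beta> lam = 0" if "\<beta> \<in> af_pos_roots_J D J"
    using that by (auto simp: af_pos_roots_J_def root_lattice_J_iff)
  ultimately show ?thesis by (auto simp: af_pos_roots_J_def)
qed

abbreviation "WJ \<equiv> weyl_J_af D J"

lemma WJ_iff: "x \<in> WJ \<longleftrightarrow> x \<in> weyl_af D \<and>
    (\<forall>\<beta>\<in>af_pos_roots D. bform \<beta> lam = 0 \<longrightarrow> x \<beta> \<in> af_pos_roots D)"
  by (auto simp: weyl_J_af_def af_pos_roots_J_iff)

lemma WJ_weyl: "x \<in> WJ \<Longrightarrow> x \<in> weyl_af D" by (simp add: WJ_iff)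

text \<open>Roots orthogonal to \<open>lam\<close> are carried by \<open>x\<close> to roots
  orthogonal to \<open>x lam\<close>. The nonzero pairing excludes \<open>\<alpha> i\<close> among
  them, the only positive root that the reflection makes negative.\<close>

lemma WJ_refl:
  assumes x: "x \<in> WJ" and nz: "\<kappa> i (x lam) \<noteq> 0"
  shows "\<sigma> i \<circ> x \<in> WJ"
proof -
  note xa = WJ_weyl[OF x]
  have "\<sigma> i (x \<beta>) \<in> af_pos_roots D" if b: "\<beta> \<in> af_pos_roots D" "bform \<beta> lam = 0" for \<beta>
  proof (rule refl_pos_root)
    show "x \<beta> \<in> af_pos_roots D" using x b by (auto simp: WJ_iff)
    show "x \<beta> \<noteq> \<alpha> i"
    proof
      assume e: "x \<beta> = \<alpha> i"
      have "bform (x \<beta>) (x lam) = 0"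
        using b xa by (simp add: weyl_bform af_pos_root_iff af_root_span)
      thus False unfolding e using nz symmetrizer_pos[of i] by simp
    qed
  qed
  thus ?thesis using xa by (auto simp: WJ_iff weyl_refl_comp)
qed

subsection \<open>The semi-infinite length relative to the stabilizer\<close>

text \<open>Roots orthogonal to \<open>lam\<close> are left out. On \<open>WJ\<close> their
  thresholds vanish, whereas on the whole group they would record a change of length even when
  \<open>\<sigma> i\<close> fixes \<open>x lam\<close>.\<close>

definition rel_length :: "('v \<Rightarrow> 'v) \<Rightarrow> real" where
  "rel_length x = (\<Sum>\<beta>\<in>{\<beta> \<in> fin_pos_roots D. 0 < bform \<beta> lam}. threshold (x \<beta>))"

text \<open>For a positive finite \<open>\<beta>\<close> orthogonal to \<open>lam\<close>, both
  \<open>\<beta>\<close> and \<open>- \<beta> + \<delta>\<close> stay positive under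
  \<open>x\<close>. This confines the integral threshold of \<open>x \<beta>\<close> to 0.\<close>

lemma semi_inf_length_WJ:
  assumes x: "x \<in> WJ"
  shows "semi_inf_length D x = rel_length x"
proof -
  note xa = WJ_weyl[OF x]
  have "threshold (x \<beta>) = 0" if b: "\<beta> \<in> fin_pos_roots D" "bform \<beta> lam = 0" for \<beta>
  proof -
    have bf: "\<beta> \<in> fin_roots D" "\<beta> \<in> af_pos_roots D" using b by (auto simp: fin_pos_root_iff)
    have xb: "x \<beta> \<in> af_roots" using bf xa weyl_af_root af_root_fin by blast
    have "x \<beta> \<in> af_pos_roots D" using x bf b by (auto simp: WJ_iff)
    hence 1: "threshold (x \<beta>) \<le> 0" using threshold_iff[OF xb, of 0] by simp
    have "- \<beta> + real_of_int 1 *\<^sub>R \<delta> \<in> af_pos_roots D"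
      using coord_pos_shift[OF fin_root_neg[OF bf(1)], of 1] af_rootI[OF fin_root_neg[OF bf(1)], of 1]
      unfolding af_pos_root_iff using zero_less_one by blast
    hence "x (- \<beta> + real_of_int 1 *\<^sub>R \<delta>) \<in> af_pos_roots D"
      using x b unfolding WJ_iff by auto
    moreover have "x (- \<beta> + real_of_int 1 *\<^sub>R \<delta>) = - (x \<beta> + real_of_int (-1) *\<^sub>R \<delta>)"
      using xa by (simp add: weyl_simps weyl_null)
    ultimately have "x \<beta> + real_of_int (-1) *\<^sub>R \<delta> \<notin> af_pos_roots D"
      using af_pos_root_not_neg by fastforce
    hence "\<not> threshold (x \<beta>) \<le> -1" using threshold_iff[OF xb, of "-1"] by simp
    moreover obtain z where "threshold (x \<beta>) = real_of_int z" using threshold_int[OF xb] by (auto elim: Ints_cases)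
    ultimately show ?thesis using 1 by simp
  qed
  moreover have "0 < bform \<beta> lam \<or> bform \<beta> lam = 0" if "\<beta> \<in> fin_pos_roots D" for \<beta>
    using fin_pos_root_lam(1)[OF that] by linarith
  ultimately show ?thesis
    unfolding semi_inf_length_eq[OF xa] rel_length_def by (intro sum.mono_neutral_right) auto
qed

text \<open>Only the strings through \<open>\<alpha> i\<close> and its negative matter, that is, the
  terms at \<open>\<gamma>\<close> and \<open>- \<gamma>\<close> for the finite part
  \<open>\<gamma>\<close> of \<open>inv x (\<alpha> i)\<close>. The sign of
  \<open>bform \<gamma> lam\<close> decides which of them is summed, and neither is when it is
  zero.\<close>

lemma rel_length_refl:
  assumes x: "x \<in> weyl_af D"
  shows "rel_length (\<sigma> i \<circ> x) = rel_length x + sgn (\<kappa> i (x lam))"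
proof -
  let ?A = "{\<beta> \<in> fin_pos_roots D. 0 < bform \<beta> lam}"
  have "inv x (\<alpha> i) \<in> af_roots" by (rule weyl_af_root[OF weyl_inv[OF x] af_root_simple])
  then obtain \<gamma> m where g: "\<gamma> \<in> fin_roots D" "inv x (\<alpha> i) = \<gamma> + real_of_int m *\<^sub>R \<delta>" by (rule af_rootE)
  have ai: "\<alpha> i = x \<gamma> + real_of_int m *\<^sub>R \<delta>"
    using g(2) x by (metis weyl_inv_cancel(1) weyl_null weyl_simps(1,3))
  have inj: "x \<beta> = x \<beta>' \<longleftrightarrow> \<beta> = \<beta>'" for \<beta> \<beta>' using x by (metis weyl_inv_cancel(2))
  have shift: "\<exists>n. \<beta> = \<beta>' + real_of_int n *\<^sub>R \<delta> \<Longrightarrow> \<beta> = \<beta>'"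
    if "\<beta> \<in> fin_roots D" "\<beta>' \<in> fin_roots D" for \<beta> \<beta>'
  proof -
    assume "\<exists>n. \<beta> = \<beta>' + real_of_int n *\<^sub>R \<delta>"
    then obtain n where n: "\<beta> = \<beta>' + real_of_int n *\<^sub>R \<delta>" by blast
    have "coord (node0 D) \<beta> = real_of_int n" using that(2) by (simp add: n coord_null_root mark_node0)
    hence "n = 0" using fin_root_coord0[OF that(1)] by simp
    thus "\<beta> = \<beta>'" using n by simp
  qed
  have pos: "(\<exists>n. x \<beta> = \<alpha> i + real_of_int n *\<^sub>R \<delta>) \<longleftrightarrow> \<beta> = \<gamma>" if b: "\<beta> \<in> fin_roots D" for \<beta>
  proof
    assume "\<exists>n. x \<beta> = \<alpha> i + real_of_int n *\<^sub>R \<delta>"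
    then obtain n where "x \<beta> = \<alpha> i + real_of_int n *\<^sub>R \<delta>" by blast
    hence "x \<beta> = x (\<gamma> + real_of_int (m + n) *\<^sub>R \<delta>)"
      using x by (simp add: weyl_simps weyl_null ai scaleR_left_distrib)
    hence "\<beta> = \<gamma> + real_of_int (m + n) *\<^sub>R \<delta>" unfolding inj .
    thus "\<beta> = \<gamma>" using shift[OF b g(1)] by blast
  next
    assume "\<beta> = \<gamma>"
    hence "x \<beta> = \<alpha> i + real_of_int (- m) *\<^sub>R \<delta>" by (simp add: ai)
    thus "\<exists>n. x \<beta> = \<alpha> i + real_of_int n *\<^sub>R \<delta>" by blast
  qed
  have neg: "(\<exists>n. x \<beta> = - \<alpha> i + real_of_int n *\<^sub>R \<delta>) \<longleftrightarrow> \<beta> = - \<gamma>" if b: "\<beta> \<in> fin_roots D" for \<beta>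
  proof
    assume "\<exists>n. x \<beta> = - \<alpha> i + real_of_int n *\<^sub>R \<delta>"
    then obtain n where "x \<beta> = - \<alpha> i + real_of_int n *\<^sub>R \<delta>" by blast
    hence "x \<beta> = x (- \<gamma> + real_of_int (n - m) *\<^sub>R \<delta>)"
      using x by (simp add: weyl_simps weyl_null ai scaleR_left_diff_distrib)
    hence "\<beta> = - \<gamma> + real_of_int (n - m) *\<^sub>R \<delta>" unfolding inj .
    thus "\<beta> = - \<gamma>" using shift[OF b fin_root_neg[OF g(1)]] by blast
  next
    assume "\<beta> = - \<gamma>"
    hence "x \<beta> = - \<alpha> i + real_of_int m *\<^sub>R \<delta>" using x by (simp add: ai weyl_simps)
    thus "\<exists>n. x \<beta> = - \<alpha> i + real_of_int n *\<^sub>R \<delta>" by blast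
  qed
  have fin: "finite ?A" by simp
  have "rel_length (\<sigma> i \<circ> x) = (\<Sum>\<beta>\<in>?A. threshold (x \<beta>) + (if \<beta> = \<gamma> then 1 else 0) - (if \<beta> = - \<gamma> then 1 else 0))"
    unfolding rel_length_def
  proof (intro sum.cong refl)
    fix \<beta> assume "\<beta> \<in> ?A"
    hence b: "\<beta> \<in> fin_roots D" by (simp add: fin_pos_root_iff)
    show "threshold ((\<sigma> i \<circ> x) \<beta>) = threshold (x \<beta>) + (if \<beta> = \<gamma> then 1 else 0) - (if \<beta> = - \<gamma> then 1 else 0)"
      using threshold_refl[OF weyl_af_root[OF x af_root_fin[OF b]], of i] unfolding pos[OF b] neg[OF b] by simp
  qed
  also have "\<dots> = rel_length x + (if \<gamma> \<in> ?A then 1 else 0) - (if - \<gamma> \<in> ?A then 1 else 0)"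
    unfolding rel_length_def sum_subtractf sum.distrib sum.delta[OF fin] by simp
  also have "(if \<gamma> \<in> ?A then 1 else 0) - (if - \<gamma> \<in> ?A then 1 else 0) = sgn (bform \<gamma> lam)"
    using fin_root_cases[OF g(1)] fin_pos_root_lam(1)[of \<gamma>] fin_pos_root_lam(1)[of "- \<gamma>"]
      fin_pos_root_not_neg[of \<gamma>] fin_pos_root_not_neg[of "- \<gamma>"] by (auto simp: sgn_if)
  hence "rel_length x + (if \<gamma> \<in> ?A then 1 else 0) - (if - \<gamma> \<in> ?A then 1 else 0) = rel_length x + sgn (bform \<gamma> lam)"
    by linarith
  also have "bform \<gamma> lam = symmetrizer i * \<kappa> i (x lam)"
  proof -
    have "bform (\<alpha> i) (x lam) = bform (inv x (\<alpha> i)) (inv x (x lam))"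
      by (rule weyl_bform[OF weyl_inv[OF x], symmetric]) simp
    thus ?thesis using x by (simp add: g(2))
  qed
  also have "sgn (symmetrizer i * \<kappa> i (x lam)) = sgn (\<kappa> i (x lam))"
    using symmetrizer_pos[of i] by (simp add: sgn_mult)
  finally show ?thesis .
qed

text \<open>Conjugation by \<open>\<sigma> i\<close> lowers the height of \<open>\<beta>\<close> and
  costs the signs of the \<open>i\<close>-th slope before and after the reflection. That slope does
  not grow, because \<open>\<beta>\<close> pairs positively with the simple coroot. Stating the gain
  as \<open>sgn\<close> keeps the case of pairing zero in the induction.\<close>

lemma rel_length_root_refl:
  assumes "\<beta> \<in> af_pos_roots D" "x \<in> weyl_af D" "0 \<le> coroot_of D \<beta> (x lam)"
  shows "rel_length x + sgn (coroot_of D \<beta> (x lam)) \<le> rel_length (root_refl D \<beta> \<circ> x)"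
  using assms
proof (induction arbitrary: x rule: af_pos_root_induct)
  case (simple i)
  show ?case unfolding root_refl_simple coroot_of_simple rel_length_refl[OF simple(1)] by simp
next
  case (refl \<beta> i)
  let ?\<gamma> = "\<sigma> i \<beta>" and ?y = "\<sigma> i \<circ> x" and ?p = "coroot_of D \<beta> (x lam)"
  have br: "\<beta> \<in> af_roots" using refl.hyps by (simp add: af_pos_root_iff)
  have ya: "?y \<in> weyl_af D" by (rule weyl_refl_comp[OF refl.prems(1)])
  have p: "coroot_of D ?\<gamma> (?y lam) = ?p" using coroot_of_weyl[OF br weyl_refl, of i "x lam"] by simp
  let ?z = "root_refl D ?\<gamma> \<circ> ?y"
  have gr: "?\<gamma> \<in> af_roots" by (rule af_root_refl[OF br])
  have za: "?z \<in> weyl_af D" by (rule weyl_comp[OF root_refl_in_weyl[OF gr] ya])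
  have "root_refl D ?\<gamma> \<circ> \<sigma> i = \<sigma> i \<circ> root_refl D \<beta>" by (rule root_refl_weyl[OF br weyl_refl])
  hence z: "?z = \<sigma> i \<circ> (root_refl D \<beta> \<circ> x)" by (simp add: fun_eq_iff)
  have "\<kappa> i (?z lam) = - \<kappa> i ((root_refl D \<beta> \<circ> x) lam)" unfolding z by (simp add: simple_refl_def)
  moreover have "root_refl D \<beta> \<circ> x = \<sigma> i \<circ> ?z" unfolding z by (simp add: fun_eq_iff)
  ultimately have 1: "rel_length (root_refl D \<beta> \<circ> x) = rel_length ?z - sgn (\<kappa> i ((root_refl D \<beta> \<circ> x) lam))"
    using rel_length_refl[OF za, of i] by (simp add: sgn_minus)
  have 2: "rel_length ?y + sgn ?p \<le> rel_length ?z"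
    by (rule refl.IH[OF ya, unfolded p, OF refl.prems(2)])
  have 3: "rel_length ?y = rel_length x + sgn (\<kappa> i (x lam))" by (rule rel_length_refl[OF refl.prems(1)])
  have "\<kappa> i ((root_refl D \<beta> \<circ> x) lam) \<le> \<kappa> i (x lam)"
    using refl.prems(2) refl.hyps by (simp add: root_refl_def)
  hence "sgn (\<kappa> i ((root_refl D \<beta> \<circ> x) lam)) \<le> sgn (\<kappa> i (x lam))" by (auto simp: sgn_if)
  thus ?case using 1 2 3 by linarith
qed

subsection \<open>Edges and paths of the semi-infinite Bruhat graph\<close>

lemma SiB_edgeD:
  assumes "SiB_edge D J x \<beta> y"
  shows "x \<in> WJ" "y \<in> WJ" "\<beta> \<in> af_pos_roots D" "\<beta> \<in> af_roots" "y = root_refl D \<beta> \<circ> x"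
    "rel_length y = rel_length x + 1" "0 < coroot_of D \<beta> (x lam)"
    "y lam = x lam - coroot_of D \<beta> (x lam) *\<^sub>R \<beta>"
proof -
  show e: "x \<in> WJ" "y \<in> WJ" "\<beta> \<in> af_pos_roots D" "y = root_refl D \<beta> \<circ> x"
    using assms unfolding SiB_edge_def by blast+
  show r: "\<beta> \<in> af_roots" using e by (simp add: af_pos_root_iff)
  show l: "rel_length y = rel_length x + 1"
    using assms unfolding SiB_edge_def semi_inf_length_WJ[OF e(1), symmetric] semi_inf_length_WJ[OF e(2), symmetric]
    by blast
  \<comment> \<open>A nonpositive pairing at \<open>x\<close> is a nonnegative one at
    \<open>y\<close>, and then the step back to \<open>x\<close> could not shorten the
    length.\<close>
  show "0 < coroot_of D \<beta> (x lam)"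
  proof (rule ccontr)
    assume "\<not> 0 < coroot_of D \<beta> (x lam)"
    hence n: "0 \<le> coroot_of D \<beta> (y lam)" using coroot_of_root_refl[OF r] by (simp add: e(4))
    have "root_refl D \<beta> \<circ> y = x" using root_refl_involution[OF r] by (simp add: e(4) fun_eq_iff)
    hence "rel_length y + sgn (coroot_of D \<beta> (y lam)) \<le> rel_length x"
      using rel_length_root_refl[OF e(3) WJ_weyl[OF e(2)] n] by simp
    thus False using l n by (auto simp: sgn_if split: if_splits)
  qed
  show "y lam = x lam - coroot_of D \<beta> (x lam) *\<^sub>R \<beta>" by (simp add: e(4) root_refl_def)
qed

lemma SiB_edge_refl:
  assumes x: "x \<in> WJ" and p: "0 < \<kappa> i (x lam)"
  shows "SiB_edge D J x (\<alpha> i) (\<sigma> i \<circ> x)"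
proof -
  have y: "\<sigma> i \<circ> x \<in> WJ" using WJ_refl[OF x] p by simp
  show ?thesis
    unfolding SiB_edge_def semi_inf_length_WJ[OF x] semi_inf_length_WJ[OF y]
    using x y p rel_length_refl[OF WJ_weyl[OF x], of i] by (simp add: af_pos_root_simple)
qed

text \<open>Reflecting an edge, lengths change by the two signs; since the pairing of the reflected edge
  is still positive, the reflected length must still increase.\<close>

lemma SiB_edge_sgn:
  assumes e: "SiB_edge D J x \<beta> y" and b: "\<beta> \<noteq> \<alpha> i"
  shows "sgn (\<kappa> i (x lam)) \<le> sgn (\<kappa> i (y lam))"
proof -
  note E = SiB_edgeD[OF e]
  have xa: "x \<in> weyl_af D" and ya: "y \<in> weyl_af D" using E WJ_weyl by blast+
  have g: "\<sigma> i \<beta> \<in> af_pos_roots D" by (rule refl_pos_root[OF E(3) b])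
  have eq: "root_refl D (\<sigma> i \<beta>) \<circ> (\<sigma> i \<circ> x) = \<sigma> i \<circ> y"
    using root_refl_weyl[OF E(4) weyl_refl, of i] by (simp add: E(5) fun_eq_iff)
  have c: "coroot_of D (\<sigma> i \<beta>) ((\<sigma> i \<circ> x) lam) = coroot_of D \<beta> (x lam)"
    using coroot_of_weyl[OF E(4) weyl_refl, of i "x lam"] by simp
  have "rel_length (\<sigma> i \<circ> x) + 1 \<le> rel_length (\<sigma> i \<circ> y)"
    using rel_length_root_refl[OF g weyl_refl_comp[OF xa], of i] E(7) unfolding c eq by simp
  thus ?thesis using rel_length_refl[OF xa, of i] rel_length_refl[OF ya, of i] E(6) by simp
qed

text \<open>Equal signs change both lengths by the same amount, so their difference stays 1; nonzero
  signs keep both ends in \<open>WJ\<close>.\<close>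

lemma SiB_edge_reflected:
  assumes e: "SiB_edge D J x \<beta> y" and b: "\<beta> \<noteq> \<alpha> i"
    and s: "sgn (\<kappa> i (x lam)) = sgn (\<kappa> i (y lam))" and nz: "\<kappa> i (x lam) \<noteq> 0"
  shows "SiB_edge D J (\<sigma> i \<circ> x) (\<sigma> i \<beta>) (\<sigma> i \<circ> y)"
    and "coroot_of D (\<sigma> i \<beta>) ((\<sigma> i \<circ> x) lam) = coroot_of D \<beta> (x lam)"
proof -
  note E = SiB_edgeD[OF e]
  have xa: "x \<in> weyl_af D" and ya: "y \<in> weyl_af D" using E WJ_weyl by blast+
  have g: "\<sigma> i \<beta> \<in> af_pos_roots D" by (rule refl_pos_root[OF E(3) b])
  have eq: "root_refl D (\<sigma> i \<beta>) \<circ> (\<sigma> i \<circ> x) = \<sigma> i \<circ> y"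
    using root_refl_weyl[OF E(4) weyl_refl, of i] by (simp add: E(5) fun_eq_iff)
  have sx: "\<sigma> i \<circ> x \<in> WJ" by (rule WJ_refl[OF E(1) nz])
  have "\<kappa> i (y lam) \<noteq> 0" using s nz by (auto simp: sgn_if split: if_splits)
  hence sy: "\<sigma> i \<circ> y \<in> WJ" by (rule WJ_refl[OF E(2)])
  show "SiB_edge D J (\<sigma> i \<circ> x) (\<sigma> i \<beta>) (\<sigma> i \<circ> y)"
    unfolding SiB_edge_def semi_inf_length_WJ[OF sx] semi_inf_length_WJ[OF sy]
    using sx sy g eq[symmetric] rel_length_refl[OF xa, of i] rel_length_refl[OF ya, of i] E(6) s by simp
  show "coroot_of D (\<sigma> i \<beta>) ((\<sigma> i \<circ> x) lam) = coroot_of D \<beta> (x lam)"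
    using coroot_of_weyl[OF E(4) weyl_refl, of i "x lam"] by simp
qed

section \<open>Integrality and reflection of paths in SiB(lambda; a)\<close>

definition a_edge :: "real \<Rightarrow> ('v \<Rightarrow> 'v) \<Rightarrow> ('v \<Rightarrow> 'v) \<Rightarrow> bool" where
  "a_edge a x y \<longleftrightarrow> (\<exists>\<beta>. SiB_edge D J x \<beta> y \<and> a * coroot_of D \<beta> (x lam) \<in> \<int>)"

lemma SiB_path_eq: "SiB_path D lam a = (a_edge a)\<^sup>*\<^sup>*"
  by (simp add: SiB_path_def a_edge_def[abs_def])

lemma SiB_path_refl [simp]: "SiB_path D lam a x x"
  by (simp add: SiB_path_eq)

lemma SiB_path_trans: "SiB_path D lam a x y \<Longrightarrow> SiB_path D lam a y z \<Longrightarrow> SiB_path D lam a x z"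
  unfolding SiB_path_eq by (rule rtranclp_trans)

lemma SiB_path_edge: "SiB_edge D J x \<beta> y \<Longrightarrow> a * coroot_of D \<beta> (x lam) \<in> \<int> \<Longrightarrow> SiB_path D lam a x y"
  unfolding SiB_path_eq a_edge_def[abs_def] by blast

lemma SiB_path_si_le: "SiB_path D lam a x y \<Longrightarrow> si_le D J x y"
  unfolding SiB_path_eq si_le_def by (erule rtranclp_mono[THEN predicate2D, rotated]) (auto simp: a_edge_def)

text \<open>By \<open>SiB_edge_sgn\<close> only the label \<open>\<alpha> i\<close> can lower the
  sign. The two ends are then mirror images of each other, which the path lemmas below use as a
  shortcut.\<close>

lemma a_edge_sgn_change:
  assumes "SiB_edge D J x \<beta> y" "sgn (\<kappa> i (y lam)) < sgn (\<kappa> i (x lam))"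
  shows "\<beta> = \<alpha> i" "y = \<sigma> i \<circ> x" "x = \<sigma> i \<circ> y" "0 < \<kappa> i (x lam)" "\<kappa> i (y lam) = - \<kappa> i (x lam)"
    "coroot_of D \<beta> (x lam) = \<kappa> i (x lam)"
proof -
  note E = SiB_edgeD[OF assms(1)]
  show b: "\<beta> = \<alpha> i" using SiB_edge_sgn[OF assms(1), of i] assms(2) by force
  show y: "y = \<sigma> i \<circ> x" using E(5) b by simp
  show "x = \<sigma> i \<circ> y" by (simp add: y fun_eq_iff)
  show "0 < \<kappa> i (x lam)" using E(7) b by simp
  show "\<kappa> i (y lam) = - \<kappa> i (x lam)" by (simp add: y simple_refl_def)
  show "coroot_of D \<beta> (x lam) = \<kappa> i (x lam)" by (simp add: b)
qed

lemma a_edge_diff: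
  assumes "SiB_edge D J x \<beta> y" "a * coroot_of D \<beta> (x lam) \<in> \<int>"
  shows "a *\<^sub>R (y lam - x lam) \<in> weight_lattice D"
proof -
  note E = SiB_edgeD[OF assms(1)]
  have "a *\<^sub>R (y lam - x lam) = - ((a * coroot_of D \<beta> (x lam)) *\<^sub>R \<beta>)" by (simp add: E(8))
  thus ?thesis
    using weight_lattice_neg[OF weight_lattice_scale_Ints[OF af_root_weight_lattice[OF E(4)] assms(2)]] by simp
qed

text \<open>Scaled by \<open>a\<close>, each edge moves \<open>x lam\<close> by an integral multiple
  of its label. Consequently, whether \<open>a\<close> times a slope is an integer can be tested at
  any vertex of the path.\<close>

lemma SiB_path_diff: "SiB_path D lam a x y \<Longrightarrow> a *\<^sub>R (y lam - x lam) \<in> weight_lattice D"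
  unfolding SiB_path_eq
proof (induction rule: rtranclp_induct)
  case (step y z)
  have "a *\<^sub>R (z lam - x lam) = a *\<^sub>R (z lam - y lam) + a *\<^sub>R (y lam - x lam)"
    by (simp add: scaleR_right_diff_distrib)
  moreover have "a *\<^sub>R (z lam - y lam) \<in> weight_lattice D" using step(2) a_edge_diff unfolding a_edge_def by blast
  ultimately show ?case using weight_lattice_add step(3) by simp
qed (simp add: weight_lattice_0)

lemma SiB_path_int_iff:
  assumes "SiB_path D lam a x y"
  shows "a * \<kappa> i (x lam) \<in> \<int> \<longleftrightarrow> a * \<kappa> i (y lam) \<in> \<int>"
proof -
  have d: "a * \<kappa> i (y lam) - a * \<kappa> i (x lam) \<in> \<int>"
    using coroot_integral[OF SiB_path_diff[OF assms], of i] by (simp add: right_diff_distrib)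
  show ?thesis
    using Ints_add[OF d, of "a * \<kappa> i (x lam)"] Ints_diff[OF _ d, of "a * \<kappa> i (y lam)"] by auto
qed

lemma SiB_path_length: "SiB_path D lam a x y \<Longrightarrow> x = y \<or> rel_length x < rel_length y"
  unfolding SiB_path_eq by (induction rule: rtranclp_induct) (auto simp: a_edge_def dest: SiB_edgeD(6))

text \<open>Lengths increase along edges, so the graph has no cycles. This later shows that a
  reflected direction differs from its neighbour.\<close>

lemma SiB_path_antisym: "SiB_path D lam a x y \<Longrightarrow> SiB_path D lam b y x \<Longrightarrow> x = y"
  using SiB_path_length[of a x y] SiB_path_length[of b y x] by fastforce

lemma SiB_path_refl_up:
  assumes "x \<in> WJ" "0 < \<kappa> i (x lam)" "a * \<kappa> i (x lam) \<in> \<int>"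
  shows "SiB_path D lam a x (\<sigma> i \<circ> x)"
  by (rule SiB_path_edge[OF SiB_edge_refl[OF assms(1,2)]]) (simp add: assms(3))

lemma SiB_path_refl_down:
  assumes "x \<in> WJ" "\<kappa> i (x lam) < 0" "a * \<kappa> i (x lam) \<in> \<int>"
  shows "SiB_path D lam a (\<sigma> i \<circ> x) x"
proof -
  have "\<sigma> i \<circ> x \<in> WJ" using WJ_refl assms by simp
  moreover have "\<kappa> i ((\<sigma> i \<circ> x) lam) = - \<kappa> i (x lam)" by (simp add: simple_refl_def)
  ultimately show ?thesis using SiB_path_refl_up[of "\<sigma> i \<circ> x" i a] assms by simp
qed

lemma a_edge_reflected:
  assumes "a_edge a x y" "sgn (\<kappa> i (x lam)) = sgn (\<kappa> i (y lam))" "\<kappa> i (x lam) \<noteq> 0"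
  shows "a_edge a (\<sigma> i \<circ> x) (\<sigma> i \<circ> y)"
proof -
  obtain \<beta> where b: "SiB_edge D J x \<beta> y" "a * coroot_of D \<beta> (x lam) \<in> \<int>" using assms unfolding a_edge_def by blast
  have "\<beta> \<noteq> \<alpha> i"
  proof
    assume "\<beta> = \<alpha> i"
    hence "y = \<sigma> i \<circ> x" using SiB_edgeD(5)[OF b(1)] by simp
    hence "\<kappa> i (y lam) = - \<kappa> i (x lam)" by (simp add: simple_refl_def)
    thus False using assms(2,3) by (auto simp: sgn_if split: if_splits)
  qed
  from SiB_edge_reflected[OF b(1) this assms(2,3)] b(2) show ?thesis unfolding a_edge_def by (intro exI[of _ "\<sigma> i \<beta>"]) simp
qed

text \<open>Follow the path to its last entry into the negative side. That edge is labelled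
  \<open>\<alpha> i\<close>, its source is the mirror image of its target, and the negative tail
  behind it can be reflected. The same edge supplies the integrality.\<close>

lemma SiB_path_upper:
  assumes "SiB_path D lam a x y" "0 \<le> \<kappa> i (x lam)" "\<kappa> i (y lam) < 0"
  shows "SiB_path D lam a x (\<sigma> i \<circ> y) \<and> a * \<kappa> i (y lam) \<in> \<int>"
  using assms unfolding SiB_path_eq
proof (induction rule: rtranclp_induct)
  case (step y z)
  then obtain \<beta> where b: "SiB_edge D J y \<beta> z" "a * coroot_of D \<beta> (y lam) \<in> \<int>" unfolding a_edge_def by blast
  show ?case
  proof (cases "\<kappa> i (y lam) < 0")
    case True
    have "a_edge a (\<sigma> i \<circ> y) (\<sigma> i \<circ> z)"
      by (rule a_edge_reflected[OF step(2)]) (use True step.prems in auto)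
    moreover have "a * \<kappa> i (z lam) \<in> \<int>"
      using SiB_path_int_iff[OF SiB_path_edge[OF b], of i] step.IH[OF step.prems(1) True] by simp
    ultimately show ?thesis using step.IH[OF step.prems(1) True] by (meson rtranclp.rtrancl_into_rtrancl)
  next
    case False
    have s: "sgn (\<kappa> i (z lam)) < sgn (\<kappa> i (y lam))" using False step.prems by (auto simp: sgn_if)
    note c = a_edge_sgn_change[OF b(1) s]
    show ?thesis using step(1) b(2) by (simp add: c(3)[symmetric] c(5,6))
  qed
qed simp

text \<open>Dual to \<open>SiB_path_upper\<close>: the positive initial part is reflected, up to the
  edge that leaves the positive side and joins a vertex to its mirror image.\<close>

lemma SiB_path_lower:
  assumes "SiB_path D lam a x y" "0 < \<kappa> i (x lam)" "\<kappa> i (y lam) \<le> 0"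
  shows "SiB_path D lam a (\<sigma> i \<circ> x) y \<and> a * \<kappa> i (x lam) \<in> \<int>"
  using assms unfolding SiB_path_eq
proof (induction rule: converse_rtranclp_induct)
  case (step x z)
  then obtain \<beta> where b: "SiB_edge D J x \<beta> z" "a * coroot_of D \<beta> (x lam) \<in> \<int>" unfolding a_edge_def by blast
  show ?case
  proof (cases "0 < \<kappa> i (z lam)")
    case True
    have "a_edge a (\<sigma> i \<circ> x) (\<sigma> i \<circ> z)"
      by (rule a_edge_reflected[OF step(1)]) (use True step.prems in auto)
    moreover have "a * \<kappa> i (x lam) \<in> \<int>"
      using SiB_path_int_iff[OF SiB_path_edge[OF b], of i] step.IH[OF True step.prems(2)] by simp
    ultimately show ?thesis using step.IH[OF True step.prems(2)] by (meson converse_rtranclp_into_rtranclp)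
  next
    case False
    have s: "sgn (\<kappa> i (z lam)) < sgn (\<kappa> i (x lam))" using False step.prems by (auto simp: sgn_if)
    note c = a_edge_sgn_change[OF b(1) s]
    show ?thesis using step(2) b(2) by (simp add: c(2)[symmetric] c(6))
  qed
qed simp

text \<open>The path may leave the negative side in between, where edges cannot be reflected. At its
  last return the mirror image of the vertex lies on the old path, and the old path is reached from
  \<open>\<sigma> i \<circ> x\<close> by the edge to \<open>x\<close>.\<close>

lemma SiB_path_reflected_neg:
  assumes "SiB_path D lam a x y" "x \<in> WJ" "\<kappa> i (x lam) < 0" "\<kappa> i (y lam) < 0"
  shows "SiB_path D lam a (\<sigma> i \<circ> x) (\<sigma> i \<circ> y)"
  using assms unfolding SiB_path_eq
proof (induction rule: rtranclp_induct)
  case (step y z)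
  show ?case
  proof (cases "\<kappa> i (y lam) < 0")
    case True
    have "a_edge a (\<sigma> i \<circ> y) (\<sigma> i \<circ> z)"
      by (rule a_edge_reflected[OF step(2)]) (use True step.prems in auto)
    thus ?thesis using step.IH[OF step.prems(1,2) True] by (meson rtranclp.rtrancl_into_rtrancl)
  next
    case False
    obtain \<beta> where b: "SiB_edge D J y \<beta> z" "a * coroot_of D \<beta> (y lam) \<in> \<int>" using step(2) unfolding a_edge_def by blast
    have s: "sgn (\<kappa> i (z lam)) < sgn (\<kappa> i (y lam))" using False step.prems by (auto simp: sgn_if)
    note c = a_edge_sgn_change[OF b(1) s]
    have p: "SiB_path D lam a x y" using step(1) by (simp add: SiB_path_eq)
    have "a * \<kappa> i (x lam) \<in> \<int>" using SiB_path_int_iff[OF p, of i] b(2) c(6) by simp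
    from SiB_path_refl_down[OF step.prems(1,2) this] show ?thesis
      using step(1) unfolding c(3)[symmetric] SiB_path_eq by (meson rtranclp_trans)
  qed
qed simp

text \<open>Dually, the first edge leaving the positive side lands on the mirror image of its
  source. From there the old path leads to \<open>y\<close>, and one more edge to
  \<open>\<sigma> i \<circ> y\<close>.\<close>

lemma SiB_path_reflected_pos:
  assumes "SiB_path D lam a x y" "y \<in> WJ" "0 < \<kappa> i (x lam)" "0 < \<kappa> i (y lam)"
  shows "SiB_path D lam a (\<sigma> i \<circ> x) (\<sigma> i \<circ> y)"
  using assms unfolding SiB_path_eq
proof (induction rule: converse_rtranclp_induct)
  case (step x z)
  show ?case
  proof (cases "0 < \<kappa> i (z lam)")
    case True
    have "a_edge a (\<sigma> i \<circ> x) (\<sigma> i \<circ> z)"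
      by (rule a_edge_reflected[OF step(1)]) (use True step.prems in auto)
    thus ?thesis using step.IH[OF step.prems(1) True step.prems(3)] by (meson converse_rtranclp_into_rtranclp)
  next
    case False
    obtain \<beta> where b: "SiB_edge D J x \<beta> z" "a * coroot_of D \<beta> (x lam) \<in> \<int>" using step(1) unfolding a_edge_def by blast
    have s: "sgn (\<kappa> i (z lam)) < sgn (\<kappa> i (x lam))" using False step.prems by (auto simp: sgn_if)
    note c = a_edge_sgn_change[OF b(1) s]
    have p: "SiB_path D lam a x y"
      using step(1,2) unfolding SiB_path_eq by (rule converse_rtranclp_into_rtranclp)
    have "a * \<kappa> i (y lam) \<in> \<int>" using SiB_path_int_iff[OF p, of i] b(2) c(6) by simp
    from SiB_path_refl_up[OF step.prems(1,3) this] show ?thesis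
      using step(2) unfolding c(2)[symmetric] SiB_path_eq by (meson rtranclp_trans)
  qed
qed simp

end

subsection \<open>Piecewise linear functions with integral turning points\<close>

text \<open>\<open>a\<close> are the break points and \<open>S\<close> the slopes. The two turning
  conditions put the strict inequality on opposite sides: both ends of a flat stretch at the bottom
  are covered, and reversal of time interchanges the conditions.\<close>

locale piecewise_linear =
  fixes n :: nat and a S :: "nat \<Rightarrow> real" and H :: "real \<Rightarrow> real"
  assumes a_0: "a 0 = 0" and a_n: "a n = 1"
    and a_step: "u < n \<Longrightarrow> a u < a (Suc u)"
    and lin: "u < n \<Longrightarrow> a u \<le> t \<Longrightarrow> t \<le> a (Suc u) \<Longrightarrow> H t = H (a u) + (t - a u) * S u"
    and H_0: "H 0 = 0" and H_1: "H 1 \<in> \<int>"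
    and turn_down: "Suc u < n \<Longrightarrow> S u < 0 \<Longrightarrow> 0 \<le> S (Suc u) \<Longrightarrow> H (a (Suc u)) \<in> \<int>"
    and turn_up: "Suc u < n \<Longrightarrow> S u \<le> 0 \<Longrightarrow> 0 < S (Suc u) \<Longrightarrow> H (a (Suc u)) \<in> \<int>"
begin

lemma a_less: "u < v \<Longrightarrow> v \<le> n \<Longrightarrow> a u < a v"
proof (induction v)
  case (Suc v)
  thus ?case using a_step[of v] by (cases "u = v") auto
qed simp

lemma a_le: "u \<le> v \<Longrightarrow> v \<le> n \<Longrightarrow> a u \<le> a v"
  using a_less[of u v] by (cases "u = v") auto

lemma a_range: "u \<le> n \<Longrightarrow> a u \<in> {0..1}"
  using a_le[of 0 u] a_le[of u n] by (simp add: a_0 a_n)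

lemma n_pos: "0 < n"
  using a_0 a_n by (cases n) auto

lemma cover:
  assumes "0 \<le> t" "0 < k" "k \<le> n" "t \<le> a k"
  obtains u where "u < k" "a u \<le> t" "t \<le> a (Suc u)"
proof -
  have "\<exists>u<k. a u \<le> t \<and> t \<le> a (Suc u)"
    using assms
  proof (induction k)
    case (Suc k)
    show ?case
    proof (cases "0 < k \<and> t \<le> a k")
      case True
      thus ?thesis using Suc less_Suc_eq by auto
    next
      case False
      hence "a k \<le> t" using Suc.prems a_0 by (cases k) auto
      thus ?thesis using Suc.prems by blast
    qed
  qed simp
  thus ?thesis using that by blast
qed

lemma cover_01:
  assumes "t \<in> {0..1}"
  obtains u where "u < n" "a u \<le> t" "t \<le> a (Suc u)"
  using cover[of t n] assms n_pos a_n by auto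

lemma H_step: "u < n \<Longrightarrow> H (a (Suc u)) = H (a u) + (a (Suc u) - a u) * S u"
  using lin[of u "a (Suc u)"] a_step[of u] by simp

lemma slope_neg: "u < n \<Longrightarrow> H (a (Suc u)) < H (a u) \<Longrightarrow> S u < 0"
  using H_step[of u] a_step[of u] by (auto simp: mult_less_0_iff)

lemma slope_nonneg: "u < n \<Longrightarrow> H (a u) \<le> H (a (Suc u)) \<Longrightarrow> 0 \<le> S u"
  using H_step[of u] a_step[of u] by (auto simp: zero_le_mult_iff)

lemma lin_from_right:
  "u < n \<Longrightarrow> a u \<le> t \<Longrightarrow> t \<le> a (Suc u) \<Longrightarrow> H t = H (a (Suc u)) - (a (Suc u) - t) * S u"
  using lin[of u t] H_step[of u] by (simp add: algebra_simps)

lemma interpolate_ge: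
  assumes "u < n" "a u \<le> t" "t \<le> a (Suc u)" "c \<le> H (a u)" "c \<le> H (a (Suc u))"
  shows "c \<le> H t"
proof (cases "0 \<le> S u")
  case True
  hence "0 \<le> (t - a u) * S u" using assms by simp
  thus ?thesis using lin[of u t] assms by linarith
next
  case False
  hence "(a (Suc u) - t) * S u \<le> 0" using assms by (simp add: mult_nonneg_nonpos)
  thus ?thesis using lin_from_right[of u t] assms by linarith
qed

lemma interpolate_gt:
  assumes "u < n" "a u \<le> t" "t < a (Suc u)" "c < H (a u)" "c \<le> H (a (Suc u))"
  shows "c < H t"
proof (cases "0 \<le> S u")
  case True
  hence "0 \<le> (t - a u) * S u" using assms by simp
  thus ?thesis using lin[of u t] assms by linarith
next
  case False
  hence "(a (Suc u) - t) * S u < 0" using assms by (simp add: mult_pos_neg)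
  thus ?thesis using lin_from_right[of u t] assms by linarith
qed

lemma min_exists: "\<exists>m\<in>H ` {0..1}. \<forall>t\<in>{0..1}. m \<le> H t"
proof -
  let ?M = "Min ((\<lambda>u. H (a u)) ` {..n})"
  have "?M \<in> (\<lambda>u. H (a u)) ` {..n}" by (rule Min_in) auto
  then obtain u where u: "u \<le> n" "?M = H (a u)" by (auto simp: image_iff simp del: Min_in)
  have le: "?M \<le> H (a v)" if "v \<le> n" for v using that by (intro Min_le) auto
  have "?M \<le> H t" if t: "t \<in> {0..1}" for t
  proof -
    obtain v where "v < n" "a v \<le> t" "t \<le> a (Suc v)" by (rule cover_01[OF t])
    thus ?thesis using le[of v] le[of "Suc v"] interpolate_ge[of v t ?M] by simp
  qed
  moreover have "?M \<in> H ` {0..1}" unfolding u(2) using a_range[OF u(1)] by (rule imageI)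
  ultimately show ?thesis by blast
qed

text \<open>\<open>q\<close> is the first break point at the minimum, and segment \<open>u\<close>
  contains the last earlier time at the level \<open>m + 1\<close>. Turning values are integers, so
  no turn fits strictly between \<open>m\<close> and \<open>m + 1\<close>; hence \<open>H\<close>
  descends from \<open>t0\<close> to \<open>a q\<close> and stays above \<open>m + 1\<close>
  before.\<close>

lemma descent_to_min:
  assumes min: "\<And>t. t \<in> {0..1} \<Longrightarrow> m \<le> H t" and att: "m \<in> H ` {0..1}" and neg: "m < 0"
  obtains u q t0 where "u < q" "q \<le> n" "a u \<le> t0" "t0 < a (Suc u)" "H t0 = m + 1" "H (a q) = m" "m \<in> \<int>"
    "\<And>t. 0 \<le> t \<Longrightarrow> t < a q \<Longrightarrow> m < H t"
    "\<And>t. t0 < t \<Longrightarrow> t \<le> a q \<Longrightarrow> H t < m + 1"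
    "\<And>t. 0 \<le> t \<Longrightarrow> t \<le> t0 \<Longrightarrow> m + 1 \<le> H t"
    "\<And>v. u \<le> v \<Longrightarrow> v < q \<Longrightarrow> S v < 0"
    "q < n \<Longrightarrow> 0 \<le> S q"
proof -
  have bmin: "m \<le> H (a v)" if "v \<le> n" for v using min a_range that by blast
  have ex: "\<exists>q\<le>n. H (a q) = m"
  proof -
    obtain t where t: "t \<in> {0..1}" "H t = m" using att by auto
    obtain v where v: "v < n" "a v \<le> t" "t \<le> a (Suc v)" by (rule cover_01[OF t(1)])
    show ?thesis
    proof (rule ccontr)
      assume "\<not> ?thesis"
      moreover have "v \<le> n" "Suc v \<le> n" using v by auto
      ultimately have "m < H (a v)" "m < H (a (Suc v))"
        using bmin[of v] bmin[of "Suc v"] unfolding order.strict_iff_order by metis+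
      hence "m < H t" using interpolate_gt[OF v(1,2), of m] v(3) by (cases "t = a (Suc v)") auto
      thus False using t by simp
    qed
  qed
  define q where "q = (LEAST q. q \<le> n \<and> H (a q) = m)"
  have q: "q \<le> n" "H (a q) = m" using LeastI_ex[OF ex] unfolding q_def by auto
  have before: "m < H (a v)" if "v < q" for v
    using not_less_Least[of v "\<lambda>q. q \<le> n \<and> H (a q) = m"] that q(1) bmin[of v] unfolding q_def by force
  have first: "m < H t" if t: "0 \<le> t" "t < a q" for t
  proof -
    have "0 < q" using t a_0 by (cases q) auto
    then obtain v where v: "v < q" "a v \<le> t" "t \<le> a (Suc v)" using cover[of t q] t q by auto
    have "m \<le> H (a (Suc v))" using bmin[of "Suc v"] v q by simp
    show ?thesis
    proof (cases "t = a (Suc v)")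
      case True
      have "Suc v < q" using t True v(1) by (cases "Suc v = q") auto
      thus ?thesis using before True by simp
    next
      case False
      thus ?thesis using interpolate_gt[of v t m] v before[OF v(1)] \<open>m \<le> H (a (Suc v))\<close> q by simp
    qed
  qed
  have q0: "0 < q" using q(2) neg a_0 H_0 by (cases q) auto
  have Sq: "0 \<le> S q" if "q < n"
    using slope_nonneg[OF that] bmin[of "Suc q"] q that by simp
  have Sq1: "S (q - 1) < 0"
    using slope_neg[of "q - 1"] before[of "q - 1"] q q0 by simp
  \<comment> \<open>The first minimum is either a turning point or the end time 1.\<close>
  have mint: "m \<in> \<int>"
  proof (cases "q < n")
    case True
    thus ?thesis using turn_down[of "q - 1"] Sq1 Sq q q0 by simp
  next
    case False
    thus ?thesis using H_1 q a_n by (metis le_neq_implies_less)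
  qed
  hence m1: "m + 1 \<le> 0" using neg by (auto elim!: Ints_cases)
  have noint: "x \<notin> \<int>" if "m < x" "x < m + 1" for x
    using mint that by (auto elim!: Ints_cases)
  let ?U = "{u. u < q \<and> m + 1 \<le> H (a u)}"
  define u where "u = Max ?U"
  have "0 \<in> ?U" using q0 m1 a_0 H_0 by simp
  hence "u \<in> ?U" unfolding u_def by (intro Max_in) auto
  hence u: "u < q" "m + 1 \<le> H (a u)" by auto
  have after: "H (a v) < m + 1" if "u < v" "v \<le> q" for v
  proof (cases "v = q")
    case False
    have "v \<notin> ?U" using Max_ge[of ?U v] that unfolding u_def[symmetric] by auto
    thus ?thesis using that False by auto
  qed (simp add: q)
  have un: "u < n" using u q by simp
  have Su: "S u < 0" using slope_neg[OF un] after[of "Suc u"] u by simp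
  have Sneg: "S v < 0" if "u \<le> v" "v < q" for v
    using that
  proof (induction v rule: dec_induct)
    case (step v)
    show ?case
    proof (rule ccontr)
      assume "\<not> S (Suc v) < 0"
      hence "H (a (Suc v)) \<in> \<int>" using turn_down[of v] step q by simp
      thus False using noint before[of "Suc v"] after[of "Suc v"] step by simp
    qed
  qed (rule Su)
  \<comment> \<open>The time at which the linear piece starting at \<open>a u\<close> meets the
    level \<open>m + 1\<close>.\<close>
  define t0 where "t0 = a u + (m + 1 - H (a u)) / S u"
  have t0_ge: "a u \<le> t0" using u Su by (simp add: t0_def divide_nonpos_neg)
  have t0_less: "t0 < a (Suc u)"
  proof -
    have "(a (Suc u) - a u) * S u < m + 1 - H (a u)" using H_step[OF un] after[of "Suc u"] u by simp
    hence "(m + 1 - H (a u)) / S u < a (Suc u) - a u" using Su by (simp add: neg_divide_less_eq)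
    thus ?thesis by (simp add: t0_def)
  qed
  have Ht0: "H t0 = m + 1"
    using lin[OF un t0_ge less_imp_le[OF t0_less]] Su by (simp add: t0_def)
  have lin0: "H t = m + 1 + (t - t0) * S u" if "a u \<le> t" "t \<le> a (Suc u)" for t
    using lin[OF un that] lin[OF un t0_ge less_imp_le[OF t0_less]] Ht0 by (simp add: algebra_simps)
  have late: "H t < m + 1" if t: "t0 < t" "t \<le> a q" for t
  proof -
    have "0 \<le> t" using t0_ge a_range[of u] t un by auto
    then obtain v where v: "v < q" "a v \<le> t" "t \<le> a (Suc v)" using cover[of t q] q0 q t by auto
    have uv: "u \<le> v"
    proof (rule ccontr)
      assume "\<not> u \<le> v"
      hence "a (Suc v) \<le> a u" using a_le[of "Suc v" u] un by simp
      thus False using v t t0_ge by linarith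
    qed
    show ?thesis
    proof (cases "u = v")
      case True
      hence "(t - t0) * S u < 0" using t Su by (simp add: mult_pos_neg)
      thus ?thesis using lin0[of t] v True by simp
    next
      case False
      have "(t - a v) * S v \<le> 0" using v Sneg[OF uv v(1)] by (simp add: mult_nonneg_nonpos)
      thus ?thesis using lin[of v t] v q after[of v] uv False by simp
    qed
  qed
  \<comment> \<open>A violation gives, at the first break point with least value up to
    \<open>u\<close>, a turn whose value lies strictly between \<open>m\<close> and
    \<open>m + 1\<close>.\<close>
  have early_b: "m + 1 \<le> H (a v)" if "v \<le> u" for v
  proof (rule ccontr)
    assume "\<not> m + 1 \<le> H (a v)"
    define M where "M = Min ((\<lambda>w. H (a w)) ` {..u})"
    have Mle: "M \<le> H (a w)" if "w \<le> u" for w unfolding M_def using that by (intro Min_le) auto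
    have "M \<in> (\<lambda>w. H (a w)) ` {..u}" unfolding M_def by (intro Min_in) auto
    hence exw: "\<exists>w. w \<le> u \<and> H (a w) = M" by auto
    define w where "w = (LEAST w. w \<le> u \<and> H (a w) = M)"
    have w: "w \<le> u" "H (a w) = M" using LeastI_ex[OF exw] unfolding w_def by auto
    have wl: "M < H (a w')" if "w' < w" for w'
      using not_less_Least[of w' "\<lambda>w. w \<le> u \<and> H (a w) = M"] that w(1) Mle[of w'] unfolding w_def by force
    have M: "M < m + 1" using Mle[OF that] \<open>\<not> m + 1 \<le> H (a v)\<close> by linarith
    have "w \<noteq> u" using u M w by auto
    moreover have "w \<noteq> 0"
    proof
      assume "w = 0"
      hence "M = 0" using w a_0 H_0 by simp
      thus False using M m1 by simp
    qed
    ultimately have wu: "0 < w" "w < u" using w by auto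
    have "S (w - 1) < 0" using slope_neg[of "w - 1"] wl[of "w - 1"] w wu un by simp
    moreover have "0 \<le> S w" using slope_nonneg[of w] Mle[of "Suc w"] w wu un by simp
    ultimately have "H (a w) \<in> \<int>" using turn_down[of "w - 1"] wu un by simp
    thus False using noint M w before[of w] wu u by simp
  qed
  have early: "m + 1 \<le> H t" if t: "0 \<le> t" "t \<le> t0" for t
  proof (cases "a u \<le> t")
    case True
    hence "0 \<le> (t - t0) * S u" using t Su by (simp add: mult_nonpos_nonpos)
    thus ?thesis using lin0[of t] True t t0_less by simp
  next
    case False
    hence "0 < u" using t a_0 by (cases u) auto
    then obtain v where v: "v < u" "a v \<le> t" "t \<le> a (Suc v)" using cover[of t u] False t un by auto
    thus ?thesis using early_b[of v] early_b[of "Suc v"] un interpolate_ge[of v t "m + 1"] by simp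
  qed
  show ?thesis
    by (rule that[of u q t0])
      (use u q t0_ge t0_less Ht0 mint first late early Sneg Sq in auto)
qed

text \<open>Reversal of time exchanges the two root operators.\<close>

lemma reversed: "piecewise_linear n (\<lambda>u. 1 - a (n - u)) (\<lambda>u. - S (n - 1 - u)) (\<lambda>t. H (1 - t) - H 1)"
proof
  fix u t assume u: "u < n"
  hence e: "n - u = Suc (n - Suc u)" "n - 1 - u = n - Suc u" "n - Suc u < n" by auto
  show "1 - a (n - u) < 1 - a (n - Suc u)" using a_step[of "n - Suc u"] e by simp
  assume "1 - a (n - u) \<le> t" "t \<le> 1 - a (n - Suc u)"
  thus "H (1 - t) - H 1 = H (1 - (1 - a (n - u))) - H 1 + (t - (1 - a (n - u))) * - S (n - 1 - u)"
    using lin_from_right[of "n - Suc u" "1 - t"] e by (simp add: algebra_simps)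
next
  fix u assume u: "Suc u < n"
  hence e: "n - Suc u = Suc (n - 1 - Suc u)" "n - 1 - u = Suc (n - 1 - Suc u)" by auto
  { assume "- S (n - 1 - u) < 0" "0 \<le> - S (n - 1 - Suc u)"
    hence "H (a (n - Suc u)) \<in> \<int>" using turn_up[of "n - 1 - Suc u"] e by simp
    thus "H (1 - (1 - a (n - Suc u))) - H 1 \<in> \<int>" using H_1 by simp }
  { assume "- S (n - 1 - u) \<le> 0" "0 < - S (n - 1 - Suc u)"
    hence "H (a (n - Suc u)) \<in> \<int>" using turn_down[of "n - 1 - Suc u"] e by simp
    thus "H (1 - (1 - a (n - Suc u))) - H 1 \<in> \<int>" using H_1 by simp }
qed (use a_0 a_n H_0 H_1 in auto)

lemma ascent_from_min:
  assumes min: "\<And>t. t \<in> {0..1} \<Longrightarrow> m \<le> H t" and att: "m \<in> H ` {0..1}" and neg: "m < H 1"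
  obtains p q t1 where "p \<le> q" "q < n" "a q < t1" "t1 \<le> a (Suc q)" "H t1 = m + 1" "H (a p) = m" "m \<in> \<int>"
    "\<And>t. a p < t \<Longrightarrow> t \<le> 1 \<Longrightarrow> m < H t"
    "\<And>t. a p \<le> t \<Longrightarrow> t < t1 \<Longrightarrow> H t < m + 1"
    "\<And>t. t1 \<le> t \<Longrightarrow> t \<le> 1 \<Longrightarrow> m + 1 \<le> H t"
    "\<And>v. p \<le> v \<Longrightarrow> v \<le> q \<Longrightarrow> 0 < S v"
    "0 < p \<Longrightarrow> S (p - 1) \<le> 0"
proof -
  interpret R: piecewise_linear n "\<lambda>u. 1 - a (n - u)" "\<lambda>u. - S (n - 1 - u)" "\<lambda>t. H (1 - t) - H 1"
    by (rule reversed)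
  obtain t where "t \<in> {0..1}" "m = H t" using att by auto
  hence att': "m - H 1 \<in> (\<lambda>t. H (1 - t) - H 1) ` {0..1}" by (intro image_eqI[of _ _ "1 - t"]) auto
  have min': "m - H 1 \<le> H (1 - t) - H 1" if "t \<in> {0..1}" for t using min[of "1 - t"] that by simp
  obtain u q t0 where *: "u < q" "q \<le> n" "1 - a (n - u) \<le> t0" "t0 < 1 - a (n - Suc u)"
      "H (1 - t0) - H 1 = m - H 1 + 1" "H (1 - (1 - a (n - q))) - H 1 = m - H 1" "m - H 1 \<in> \<int>"
    and **: "\<And>t. 0 \<le> t \<Longrightarrow> t < 1 - a (n - q) \<Longrightarrow> m - H 1 < H (1 - t) - H 1"
      "\<And>t. t0 < t \<Longrightarrow> t \<le> 1 - a (n - q) \<Longrightarrow> H (1 - t) - H 1 < m - H 1 + 1"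
      "\<And>t. 0 \<le> t \<Longrightarrow> t \<le> t0 \<Longrightarrow> m - H 1 + 1 \<le> H (1 - t) - H 1"
      "\<And>v. u \<le> v \<Longrightarrow> v < q \<Longrightarrow> - S (n - 1 - v) < 0"
      "q < n \<Longrightarrow> 0 \<le> - S (n - 1 - q)"
    using R.descent_to_min[OF min' att'] neg by auto
  have e: "Suc (n - Suc u) = n - u" using * by simp
  show ?thesis
  \<comment> \<open>Under reversal break point \<open>k\<close> becomes break point
    \<open>n - k\<close>, but segment \<open>k\<close> becomes segment
    \<open>n - 1 - k\<close>.\<close>
  proof (rule that[of "n - q" "n - Suc u" "1 - t0"])
    show "m \<in> \<int>" using Ints_add[OF *(7) H_1] by simp
    show "m < H t" if "a (n - q) < t" "t \<le> 1" for t using **(1)[of "1 - t"] that by simp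
    show "H t < m + 1" if "a (n - q) \<le> t" "t < 1 - t0" for t using **(2)[of "1 - t"] that by simp
    show "m + 1 \<le> H t" if "1 - t0 \<le> t" "t \<le> 1" for t using **(3)[of "1 - t"] that by simp
    show "0 < S v" if "n - q \<le> v" "v \<le> n - Suc u" for v
    proof -
      have "u \<le> n - 1 - v" "n - 1 - v < q" "n - 1 - (n - 1 - v) = v" using that * by auto
      thus ?thesis using **(4)[of "n - 1 - v"] by simp
    qed
    show "S (n - q - 1) \<le> 0" if "0 < n - q" using **(5) that by (simp add: diff_commute)
  qed (use * e in auto)
qed

end

subsection \<open>Paths as lists of directions with end times\<close>

text \<open>Start times are not stored: a segment starts where its predecessor ends, and the empty
  path ends at time 0.\<close>

definition end_time :: "('x \<times> real) list \<Rightarrow> real" where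
  "end_time zs = last (0 # map snd zs)"

lemma end_time_Nil [simp]: "end_time [] = 0"
  by (simp add: end_time_def)

lemma end_time_append [simp]: "ws \<noteq> [] \<Longrightarrow> end_time (zs @ ws) = end_time ws"
  by (simp add: end_time_def)

lemma end_time_last: "zs \<noteq> [] \<Longrightarrow> end_time zs = snd (last zs)"
  by (simp add: end_time_def last_map)

text \<open>The parameter \<open>c\<close> is the start time of the first entry, so a suffix of a
  path can be evaluated on its own.\<close>

fun list_path :: "'v::real_vector \<Rightarrow> real \<Rightarrow> (('v \<Rightarrow> 'v) \<times> real) list \<Rightarrow> real \<Rightarrow> 'v" where
  "list_path lam c [] t = 0"
| "list_path lam c (z # zs) t = (min t (snd z) - min t c) *\<^sub>R fst z lam + list_path lam (snd z) zs t"

definition of_pairs :: "(('v \<Rightarrow> 'v) \<times> real) list \<Rightarrow> 'v sils" where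
  "of_pairs zs = (map fst zs, 0 # map snd zs)"

lemma sils_path_list_path: "sils_path lam (map fst zs, c # map snd zs) t = list_path lam c zs t"
proof (induction zs arbitrary: c)
  case (Cons z zs)
  show ?case using Cons[of "snd z"]
    by (simp add: sum.lessThan_Suc_shift del: sum.lessThan_Suc)
qed simp

lemma sils_path_of_pairs: "sils_path lam (of_pairs zs) t = list_path lam 0 zs t"
  by (simp add: of_pairs_def sils_path_list_path del: sils_path.simps)

lemma list_path_append:
  "list_path lam c (zs @ ws) t = list_path lam c zs t + list_path lam (last (c # map snd zs)) ws t"
  by (induction zs arbitrary: c) auto

lemma list_path_append_0:
  "list_path lam 0 (zs @ ws) t = list_path lam 0 zs t + list_path lam (end_time zs) ws t"
  by (simp add: list_path_append end_time_def)

text \<open>A break point inside a straight segment is invisible. This permits inserting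
  \<open>t0\<close> or \<open>t1\<close> and accounts for the entries that the root operators
  drop.\<close>

lemma list_path_split: "list_path lam c ((x, s) # (x, a) # zs) t = list_path lam c ((x, a) # zs) t"
  by (simp add: algebra_simps)

lemma list_path_before: "\<forall>z\<in>set zs. snd z \<le> s \<Longrightarrow> c \<le> s \<Longrightarrow> list_path lam c zs (min t s) = list_path lam c zs t"
  by (induction zs arbitrary: c) (auto simp: min.assoc min.absorb2)

lemma list_path_after: "\<forall>z\<in>set zs. s \<le> snd z \<Longrightarrow> s \<le> c \<Longrightarrow> list_path lam c zs (min t s) = 0"
  by (induction zs arbitrary: c) (auto simp: min.assoc min.absorb1)

lemma list_path_map:
  assumes "linear r"
  shows "list_path lam c (map (apfst ((\<circ>) r)) zs) t = r (list_path lam c zs t)"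
  by (induction zs arbitrary: c) (auto simp: linear_0[OF assms] linear_add[OF assms] linear_scale[OF assms])

text \<open>\<open>min t s\<close> freezes the path at time \<open>s\<close>, so the displacement
  made by the block \<open>B\<close> is a difference of two frozen positions of the whole path. The
  effect of reflecting \<open>B\<close> can then be read off the heights.\<close>

lemma list_path_middle:
  assumes "sorted (0 # map snd (A @ B @ C))" "s = end_time A" "s' = end_time (A @ B)"
  shows "list_path lam s B t = list_path lam 0 (A @ B @ C) (min t s') - list_path lam 0 (A @ B @ C) (min t s)"
proof -
  have le: "snd z \<le> end_time zs" if "sorted (0 # map snd zs)" "z \<in> set zs" for z and zs :: "(('v \<Rightarrow> 'v) \<times> real) list"
    using that by (cases zs rule: rev_cases) (auto simp: end_time_def sorted_append)
  have le0: "0 \<le> end_time zs" if "sorted (0 # map snd zs)" for zs :: "(('v \<Rightarrow> 'v) \<times> real) list"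
    using that by (cases zs rule: rev_cases) (auto simp: end_time_def sorted_append)
  have sA: "sorted (0 # map snd A)" "sorted (0 # map snd (A @ B))"
    using assms(1) by (auto simp: sorted_append)
  have A: "\<forall>z\<in>set A. snd z \<le> s" "\<forall>z\<in>set (A @ B). snd z \<le> s'"
    using le[OF sA(1)] le[OF sA(2)] assms(2,3) by auto
  have s: "0 \<le> s" "0 \<le> s'"
    using le0[OF sA(1)] le0[OF sA(2)] assms(2,3) by auto
  have ge: "\<forall>z\<in>set ws. end_time zs \<le> snd z" if "sorted (0 # map snd (zs @ ws))"
    for zs ws :: "(('v \<Rightarrow> 'v) \<times> real) list"
    using that by (cases zs rule: rev_cases) (auto simp: end_time_def sorted_append)
  have B: "\<forall>z\<in>set B. s \<le> snd z" and C: "\<forall>z\<in>set C. s' \<le> snd z"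
    using ge[of A "B @ C"] ge[of "A @ B" C] assms by auto
  have ss: "s \<le> s'"
  proof (cases "B = []")
    case False
    hence "snd (last B) \<le> s'" "s \<le> snd (last B)" using A B by auto
    thus ?thesis by linarith
  qed (use assms in simp)
  have C': "\<forall>z\<in>set C. s \<le> snd z" using C ss by force
  have A': "\<forall>z\<in>set A. snd z \<le> s'" "\<forall>z\<in>set B. snd z \<le> s'" using A by auto
  have e: "list_path lam 0 (A @ B @ C) \<tau> = list_path lam 0 A \<tau> + list_path lam s B \<tau> + list_path lam s' C \<tau>" for \<tau>
    using list_path_append_0[of lam "A @ B" C \<tau>] list_path_append_0[of lam A B \<tau>] assms(2,3) by simp
  show ?thesis
    unfolding e list_path_before[OF A'(1) s(2)] list_path_before[OF A'(2) ss] list_path_before[OF A(1) s(1)]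
      list_path_after[OF C order_refl] list_path_after[OF B order_refl] list_path_after[OF C' ss]
    by simp
qed

context dominant_weight
begin

subsection \<open>Semi-infinite Lakshmibai-Seshadri paths as lists\<close>

text \<open>\<open>snd z\<close> is the turning time between the two directions; the graph path
  leads from the later direction back to the earlier one.\<close>

definition ls_step :: "('v \<Rightarrow> 'v) \<times> real \<Rightarrow> ('v \<Rightarrow> 'v) \<times> real \<Rightarrow> bool" where
  "ls_step z w \<longleftrightarrow> snd z < snd w \<and> fst w \<noteq> fst z \<and> SiB_path D lam (snd z) (fst w) (fst z)"

definition ls_list :: "(('v \<Rightarrow> 'v) \<times> real) list \<Rightarrow> bool" where
  "ls_list zs \<longleftrightarrow> zs \<noteq> [] \<and> snd (last zs) = 1 \<and>
     (\<forall>z\<in>set zs. fst z \<in> WJ \<and> snd z \<in> \<rat> \<and> 0 < snd z) \<and> successively ls_step zs"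

abbreviation "height i zs t \<equiv> \<kappa> i (list_path lam 0 zs t)"
abbreviation "slope i x \<equiv> \<kappa> i (x lam)"

lemma ls_list_sorted:
  assumes "ls_list zs"
  shows "sorted_wrt (<) (0 # map snd zs)"
proof -
  have "successively (\<lambda>z w. snd z < snd w) zs"
    using assms unfolding ls_list_def by (auto intro: successively_mono simp: ls_step_def)
  hence "successively (<) (map snd zs)" by (simp add: successively_map)
  hence "sorted_wrt (<) (map snd zs)" by (subst (asm) successively_conv_sorted_wrt) (auto intro: transpI)
  thus ?thesis using assms by (auto simp: ls_list_def)
qed

lemma ls_list_sorted_le: "ls_list zs \<Longrightarrow> sorted (0 # map snd zs)"
  using ls_list_sorted strict_sorted_iff by blast

text \<open>A path in \<open>SiB(\<lambda>; a)\<close> is also one in the full graph, so between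
  distinct directions it yields the strict order.\<close>

lemma SiLS_of_pairs: "of_pairs zs \<in> SiLS D lam \<longleftrightarrow> ls_list zs"
proof
  assume l: "ls_list zs"
  let ?as = "0 # map snd zs"
  have st: "ls_step (zs ! (u - 1)) (zs ! u)" if "u \<in> {1..<length zs}" for u
    using l that unfolding ls_list_def successively_conv_nth by (cases u) auto
  have m: "?as ! u < ?as ! Suc u" if "u < length zs" for u
    using sorted_wrt_nth_less[OF ls_list_sorted[OF l], of u "Suc u"] that by simp
  have n: "?as ! u = snd (zs ! (u - 1))" if "u \<in> {1..length zs}" for u
    using that by (cases u) auto
  have ne: "zs \<noteq> []" and la: "snd (last zs) = 1" and mem: "\<forall>z\<in>set zs. fst z \<in> WJ \<and> snd z \<in> \<rat> \<and> 0 < snd z"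
    using l by (auto simp: ls_list_def)
  have path: "SiB_path D lam (?as ! u) (map fst zs ! u) (map fst zs ! (u - 1))" "map fst zs ! u \<noteq> map fst zs ! (u - 1)"
    if u: "u \<in> {1..<length zs}" for u
    using st[OF u] n[of u] u by (auto simp: ls_step_def)
  show "of_pairs zs \<in> SiLS D lam"
    unfolding SiLS_def of_pairs_def mem_Collect_eq prod.case
  proof (intro conjI ballI allI impI)
    show "set (map fst zs) \<subseteq> WJ" "set ?as \<subseteq> \<rat>" using mem by auto
    show "?as ! length (map fst zs) = 1" using n[of "length zs"] ne la by (simp add: last_conv_nth)
    show "?as ! u < ?as ! (u + 1)" if "u < length (map fst zs)" for u using m[of u] that by simp
    fix u assume "u \<in> {1..<length (map fst zs)}"
    hence u: "u \<in> {1..<length zs}" by simp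
    show "si_less D J (map fst zs ! u) (map fst zs ! (u - 1))"
      unfolding si_less_def using path[OF u] SiB_path_si_le by blast
    show "SiB_path D lam (?as ! u) (map fst zs ! u) (map fst zs ! (u - 1))" by (rule path(1)[OF u])
  qed auto
next
  assume "of_pairs zs \<in> SiLS D lam"
  hence x: "set (map fst zs) \<subseteq> WJ"
    and lt: "\<forall>u\<in>{1..<length (map fst zs)}. si_less D J (map fst zs ! u) (map fst zs ! (u - 1))"
    and r: "set (0 # map snd zs) \<subseteq> \<rat>" and l: "(0 # map snd zs) ! length (map fst zs) = 1"
    and m: "\<forall>u<length (map fst zs). (0 # map snd zs) ! u < (0 # map snd zs) ! (u + 1)"
    and p: "\<forall>u\<in>{1..<length (map fst zs)}.
        SiB_path D lam ((0 # map snd zs) ! u) (map fst zs ! u) (map fst zs ! (u - 1))"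
    unfolding SiLS_def of_pairs_def by auto
  have ne: "zs \<noteq> []" using l by auto
  have n: "(0 # map snd zs) ! Suc u = snd (zs ! u)" if "u < length zs" for u using that by simp
  have "ls_step (zs ! u) (zs ! Suc u)" if u: "Suc u < length zs" for u
    using m[rule_format, of "Suc u"] lt[rule_format, of "Suc u"] p[rule_format, of "Suc u"] u
    by (auto simp: ls_step_def si_less_def)
  hence s: "successively ls_step zs" by (simp add: successively_conv_nth)
  have "0 < snd (zs ! u)" if "u < length zs" for u
    using that
  proof (induction u)
    case 0 thus ?case using m[rule_format, of 0] by simp
  next
    case (Suc u) thus ?case using m[rule_format, of "Suc u"] by simp
  qed
  hence "\<forall>z\<in>set zs. 0 < snd z" by (metis in_set_conv_nth)
  thus "ls_list zs"
    using x r l ne s by (auto simp: ls_list_def last_conv_nth nth_Cons')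
qed

lemma SiLS_cases:
  assumes "\<eta> \<in> SiLS D lam"
  obtains zs where "\<eta> = of_pairs zs" "ls_list zs"
proof -
  obtain xs as where e: "\<eta> = (xs, as)" by (cases \<eta>)
  have l: "length as = length xs + 1" "as ! 0 = 0" using assms unfolding e SiLS_def by auto
  then obtain bs where bs: "as = 0 # bs" "length bs = length xs" by (cases as) auto
  have "\<eta> = of_pairs (zip xs bs)" using bs by (simp add: e of_pairs_def)
  thus ?thesis using that assms SiLS_of_pairs by metis
qed

lemma nth_end_time: "(0 # map snd (A @ C)) ! length A = end_time A"
  by (cases A rule: rev_cases) (auto simp: end_time_def nth_append)

lemma nth_end_time_take: "u \<le> length zs \<Longrightarrow> (0 # map snd zs) ! u = end_time (take u zs)"
  using nth_end_time[of "take u zs" "drop u zs"] by simp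

lemma list_path_segment:
  assumes "sorted (0 # map snd (A @ z # C))" "end_time A \<le> t" "t \<le> snd z"
  shows "list_path lam 0 (A @ z # C) t = list_path lam 0 (A @ z # C) (end_time A) + (t - end_time A) *\<^sub>R fst z lam"
proof -
  have "list_path lam (end_time A) [z] t =
      list_path lam 0 (A @ [z] @ C) (min t (snd z)) - list_path lam 0 (A @ [z] @ C) (min t (end_time A))"
    by (rule list_path_middle) (use assms in \<open>simp_all add: end_time_last\<close>)
  thus ?thesis using assms(2,3) by (simp add: min_absorb1 min_absorb2)
qed

text \<open>When the direction changes at time \<open>a\<close>, the reference point
  \<open>t\<close> times the direction jumps by \<open>a\<close> times the difference of the
  directions, a lattice vector by \<open>SiB_path_diff\<close>.\<close>

lemma list_path_lattice:
  assumes "ls_list (A @ z # C)" "end_time A \<le> t" "t \<le> snd z"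
  shows "list_path lam 0 (A @ z # C) t - t *\<^sub>R fst z lam \<in> weight_lattice D"
  using assms
proof (induction A arbitrary: z C t rule: rev_induct)
  case Nil
  thus ?case using list_path_segment[OF ls_list_sorted_le[OF Nil(1)], of t]
      list_path_after[of "z # C" 0 0 lam 0] ls_list_sorted_le[OF Nil(1)]
    by (auto simp: weight_lattice_0)
next
  case (snoc w A)
  let ?zs = "A @ w # z # C"
  have l: "ls_list ?zs" using snoc.prems by simp
  have s: "ls_step w z" using l by (auto simp: ls_list_def successively_append_iff)
  have srt: "sorted (0 # map snd ?zs)" by (rule ls_list_sorted_le[OF l])
  have ew: "end_time A \<le> snd w"
    using srt by (cases A rule: rev_cases) (auto simp: end_time_def sorted_append)
  have IH: "list_path lam 0 ?zs (snd w) - snd w *\<^sub>R fst w lam \<in> weight_lattice D"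
    using snoc.IH[OF l ew] by simp
  have "list_path lam 0 ((A @ [w]) @ z # C) t = list_path lam 0 ((A @ [w]) @ z # C) (snd w) + (t - snd w) *\<^sub>R fst z lam"
    using list_path_segment[of "A @ [w]" z C t] srt snoc.prems by (simp add: end_time_last)
  hence "list_path lam 0 ?zs t - t *\<^sub>R fst z lam =
      (list_path lam 0 ?zs (snd w) - snd w *\<^sub>R fst w lam) + snd w *\<^sub>R (fst w lam - fst z lam)"
    by (simp add: algebra_simps)
  moreover have "snd w *\<^sub>R (fst w lam - fst z lam) \<in> weight_lattice D"
    using s by (intro SiB_path_diff) (simp add: ls_step_def)
  ultimately show ?case using weight_lattice_add[OF IH] by simp
qed

lemma height_int_iff:
  assumes "ls_list (A @ z # C)" "end_time A \<le> t" "t \<le> snd z"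
  shows "height i (A @ z # C) t \<in> \<int> \<longleftrightarrow> t * slope i (fst z) \<in> \<int>"
proof -
  have d: "height i (A @ z # C) t - t * slope i (fst z) \<in> \<int>"
    using coroot_integral[OF list_path_lattice[OF assms], of i] by simp
  show ?thesis
    using Ints_add[OF d, of "t * slope i (fst z)"] Ints_diff[OF _ d, of "height i (A @ z # C) t"] by auto
qed

lemma WJ_weight: "x \<in> WJ \<Longrightarrow> x lam \<in> weight_lattice D"
  using weyl_weight_lattice[OF WJ_weyl lam_lattice] .

lemma slope_int: "x \<in> WJ \<Longrightarrow> slope i x \<in> \<int>"
  using coroot_integral[OF WJ_weight] .

lemma Rats_of_slope: "x \<in> WJ \<Longrightarrow> slope i x \<noteq> 0 \<Longrightarrow> t * slope i x \<in> \<int> \<Longrightarrow> t \<in> \<rat>"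
proof -
  assume "x \<in> WJ" "slope i x \<noteq> 0" "t * slope i x \<in> \<int>"
  hence "(t * slope i x) / slope i x \<in> \<rat>" using slope_int[of x i] Ints_subset_Rats by (intro Rats_divide) auto
  thus ?thesis using \<open>slope i x \<noteq> 0\<close> by simp
qed

lemma list_path_end:
  assumes "ls_list zs"
  shows "list_path lam 0 zs 1 \<in> weight_lattice D"
proof -
  obtain A z where zs: "zs = A @ [z]" using assms by (cases zs rule: rev_cases) (auto simp: ls_list_def)
  have z: "snd z = 1" "fst z \<in> WJ" using assms by (auto simp: ls_list_def zs)
  have "end_time A \<le> snd z"
    using ls_list_sorted_le[OF assms] by (cases A rule: rev_cases) (auto simp: zs end_time_def sorted_append)
  hence "list_path lam 0 zs 1 - fst z lam \<in> weight_lattice D"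
    using list_path_lattice[of A z "[]" 1] assms z by (simp add: zs)
  from weight_lattice_add[OF this WJ_weight[OF z(2)]] show ?thesis by simp
qed

text \<open>At a turn, \<open>SiB_path_upper\<close> or \<open>SiB_path_lower\<close> shows that the
  time multiplied by the slope is an integer, and \<open>height_int_iff\<close> transfers this to
  the height.\<close>

lemma height_piecewise_linear:
  assumes l: "ls_list zs"
  shows "piecewise_linear (length zs) (\<lambda>u. (0 # map snd zs) ! u) (\<lambda>u. slope i (fst (zs ! u))) (height i zs)"
proof
  have ne: "zs \<noteq> []" "snd (last zs) = 1" using l by (auto simp: ls_list_def)
  thus "(0 # map snd zs) ! length zs = 1" by (simp add: last_conv_nth nth_Cons')
  show "height i zs 0 = 0"
    using list_path_after[of zs 0 0 lam 0] ls_list_sorted_le[OF l] by auto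
  show "height i zs 1 \<in> \<int>" by (rule coroot_integral[OF list_path_end[OF l]])
  fix u assume u: "u < length zs"
  show "(0 # map snd zs) ! u < (0 # map snd zs) ! Suc u"
    using sorted_wrt_nth_less[OF ls_list_sorted[OF l], of u "Suc u"] u by simp
  have zs: "zs = take u zs @ zs ! u # drop (Suc u) zs" by (rule id_take_nth_drop[OF u])
  fix t assume "(0 # map snd zs) ! u \<le> t" "t \<le> (0 # map snd zs) ! Suc u"
  hence t: "end_time (take u zs) \<le> t" "t \<le> snd (zs ! u)"
    unfolding nth_end_time_take[OF less_imp_le[OF u]] using u by auto
  have "list_path lam 0 zs t = list_path lam 0 zs (end_time (take u zs)) + (t - end_time (take u zs)) *\<^sub>R fst (zs ! u) lam"
    using list_path_segment[of "take u zs" "zs ! u" "drop (Suc u) zs" t] t ls_list_sorted_le[OF l]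
    unfolding zs[symmetric] by blast
  thus "height i zs t = height i zs ((0 # map snd zs) ! u) + (t - (0 # map snd zs) ! u) * slope i (fst (zs ! u))"
    unfolding nth_end_time_take[OF less_imp_le[OF u]] by simp
next
  fix u assume u: "Suc u < length zs"
  hence u': "u < length zs" by simp
  have s: "ls_step (zs ! u) (zs ! Suc u)" using l u unfolding ls_list_def successively_conv_nth by blast
  have zs: "zs = take u zs @ zs ! u # drop (Suc u) zs" by (rule id_take_nth_drop[OF u'])
  have "end_time (take u zs) < snd (zs ! u)"
    using sorted_wrt_nth_less[OF ls_list_sorted[OF l], of u "Suc u"] u nth_end_time_take[of u zs] by simp
  hence int: "height i zs (snd (zs ! u)) \<in> \<int> \<longleftrightarrow> snd (zs ! u) * slope i (fst (zs ! u)) \<in> \<int>"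
    using height_int_iff[of "take u zs" "zs ! u" "drop (Suc u) zs" "snd (zs ! u)" i] l unfolding zs[symmetric] by simp
  have p: "SiB_path D lam (snd (zs ! u)) (fst (zs ! Suc u)) (fst (zs ! u))" using s by (simp add: ls_step_def)
  { assume "slope i (fst (zs ! u)) < 0" "0 \<le> slope i (fst (zs ! Suc u))"
    hence "snd (zs ! u) * slope i (fst (zs ! u)) \<in> \<int>" using SiB_path_upper[OF p] by blast
    thus "height i zs ((0 # map snd zs) ! Suc u) \<in> \<int>" using int u by simp }
  { assume "slope i (fst (zs ! u)) \<le> 0" "0 < slope i (fst (zs ! Suc u))"
    hence "snd (zs ! u) * slope i (fst (zs ! Suc u)) \<in> \<int>" using SiB_path_lower[OF p] by blast
    hence "snd (zs ! u) * slope i (fst (zs ! u)) \<in> \<int>" using SiB_path_int_iff[OF p] by simp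
    thus "height i zs ((0 # map snd zs) ! Suc u) \<in> \<int>" using int u by simp }
qed simp

section \<open>Minimum of the height and the data of the root operators\<close>

definition height_min :: "'i \<Rightarrow> (('v \<Rightarrow> 'v) \<times> real) list \<Rightarrow> real" where
  "height_min i zs = (LEAST y. y \<in> height i zs ` {0..1})"

lemma H_fun_of_pairs: "H_fun D lam i (of_pairs zs) = height i zs"
  by (simp add: fun_eq_iff H_fun_def sils_path_of_pairs)

lemma H_min_of_pairs: "H_min D lam i (of_pairs zs) = height_min i zs"
  by (simp add: H_min_def height_min_def H_fun_of_pairs)

lemma height_min_eqI:
  "m \<in> height i zs ` {0..1} \<Longrightarrow> (\<And>t. t \<in> {0..1} \<Longrightarrow> m \<le> height i zs t) \<Longrightarrow> height_min i zs = m"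
  unfolding height_min_def by (rule Least_equality) auto

lemma height_min:
  assumes "ls_list zs"
  shows "height_min i zs \<in> height i zs ` {0..1}" "t \<in> {0..1} \<Longrightarrow> height_min i zs \<le> height i zs t"
    "height_min i zs \<le> 0"
proof -
  obtain m where m: "m \<in> height i zs ` {0..1}" "\<forall>t\<in>{0..1}. m \<le> height i zs t"
    using piecewise_linear.min_exists[OF height_piecewise_linear[OF assms]] by blast
  have e: "height_min i zs = m" by (rule height_min_eqI) (use m in auto)
  show "height_min i zs \<in> height i zs ` {0..1}" "t \<in> {0..1} \<Longrightarrow> height_min i zs \<le> height i zs t"
    using m by (auto simp: e)
  show "height_min i zs \<le> 0"
    using m piecewise_linear.H_0[OF height_piecewise_linear[OF assms], of i] by (force simp: e)
qed

text \<open>\<open>B\<close> collects the entries \<open>p\<close> to \<open>q\<close> of the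
  operator: \<open>A\<close> has length \<open>p - 1\<close>, and \<open>A @ B\<close> ends at
  \<open>t\<^sub>1\<close>. The quantified clauses make \<open>t\<^sub>1\<close> the first time at
  the minimum and \<open>t0\<close> the last time before it at one level higher.\<close>

definition e_data where
  "e_data i zs A B C t0 \<longleftrightarrow> zs = A @ B @ C \<and> B \<noteq> [] \<and> end_time A \<le> t0 \<and> t0 < snd (hd B) \<and>
     height i zs t0 = height_min i zs + 1 \<and> height i zs (end_time (A @ B)) = height_min i zs \<and>
     (\<forall>t. 0 \<le> t \<and> t < end_time (A @ B) \<longrightarrow> height_min i zs < height i zs t) \<and>
     (\<forall>t. t0 < t \<and> t \<le> end_time (A @ B) \<longrightarrow> height i zs t < height_min i zs + 1)"

text \<open>Here \<open>B\<close> collects the entries \<open>p + 1\<close> to \<open>q + 1\<close>;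
  \<open>A\<close> ends at \<open>t\<^sub>0\<close>, and \<open>t1\<close> lies in the last segment
  of \<open>B\<close>.\<close>

definition f_data where
  "f_data i zs A B C t1 \<longleftrightarrow> zs = A @ B @ C \<and> B \<noteq> [] \<and> end_time (A @ butlast B) < t1 \<and> t1 \<le> snd (last B) \<and>
     height i zs t1 = height_min i zs + 1 \<and> height i zs (end_time A) = height_min i zs \<and>
     (\<forall>t. end_time A < t \<and> t \<le> 1 \<longrightarrow> height_min i zs < height i zs t) \<and>
     (\<forall>t. end_time A \<le> t \<and> t < t1 \<longrightarrow> height i zs t < height_min i zs + 1)"

lemma e_data_exists:
  assumes l: "ls_list zs" and m: "height_min i zs \<noteq> 0"
  obtains A B C t0 where "e_data i zs A B C t0" "height_min i zs \<in> \<int>" "\<forall>z\<in>set B. slope i (fst z) < 0"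
    "C \<noteq> [] \<longrightarrow> 0 \<le> slope i (fst (hd C))" "\<And>t. 0 \<le> t \<Longrightarrow> t \<le> t0 \<Longrightarrow> height_min i zs + 1 \<le> height i zs t"
proof -
  let ?m = "height_min i zs"
  define a where "a u = (0 # map snd zs) ! u" for u
  define S where "S u = slope i (fst (zs ! u))" for u
  interpret piecewise_linear "length zs" a S "height i zs"
    using height_piecewise_linear[OF l, of i] unfolding a_def[symmetric] S_def[symmetric] .
  have "?m < 0" using height_min(3)[OF l, of i] m by simp
  then obtain u q t0 where *: "u < q" "q \<le> length zs" "a u \<le> t0" "t0 < a (Suc u)" "height i zs t0 = ?m + 1"
      "height i zs (a q) = ?m" "?m \<in> \<int>"
    and first: "\<And>t. 0 \<le> t \<Longrightarrow> t < a q \<Longrightarrow> ?m < height i zs t"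
    and late: "\<And>t. t0 < t \<Longrightarrow> t \<le> a q \<Longrightarrow> height i zs t < ?m + 1"
    and early: "\<And>t. 0 \<le> t \<Longrightarrow> t \<le> t0 \<Longrightarrow> ?m + 1 \<le> height i zs t"
    and neg: "\<And>v. u \<le> v \<Longrightarrow> v < q \<Longrightarrow> S v < 0" and nn: "q < length zs \<Longrightarrow> 0 \<le> S q"
    using descent_to_min[OF height_min(2)[OF l] height_min(1)[OF l]] by auto
  define A B C where "A = take u zs" and "B = take (q - u) (drop u zs)" and "C = drop q zs"
  have AB: "A @ B = take q zs" unfolding A_def B_def using * by (simp add: take_add[symmetric])
  have zs: "zs = A @ B @ C" using AB by (simp add: C_def flip: append_assoc)
  have ua: "a u = end_time A" "a q = end_time (A @ B)"
    unfolding AB unfolding A_def a_def using * by (intro nth_end_time_take; simp)+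
  have B0: "B \<noteq> []" "hd B = zs ! u" using * by (auto simp: B_def hd_drop_conv_nth)
  have hb: "snd (hd B) = a (Suc u)" using B0 * by (simp add: a_def)
  show ?thesis
  proof (rule that)
    show "e_data i zs A B C t0"
      unfolding e_data_def ua[symmetric] hb using zs B0(1) * first late by blast
    show "\<forall>z\<in>set B. slope i (fst z) < 0"
    proof
      fix z assume "z \<in> set B"
      then obtain k where "k < length B" "z = B ! k" by (auto simp: in_set_conv_nth)
      thus "slope i (fst z) < 0" using neg[of "u + k"] * by (simp add: B_def S_def)
    qed
    show "C \<noteq> [] \<longrightarrow> 0 \<le> slope i (fst (hd C))" using nn by (simp add: C_def S_def hd_drop_conv_nth)
  qed (use * early in auto)
qed

lemma f_data_exists:
  assumes l: "ls_list zs" and m: "height i zs 1 \<noteq> height_min i zs"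
  obtains A B C t1 where "f_data i zs A B C t1" "height_min i zs \<in> \<int>" "\<forall>z\<in>set B. 0 < slope i (fst z)"
    "A \<noteq> [] \<longrightarrow> slope i (fst (last A)) \<le> 0" "\<And>t. t1 \<le> t \<Longrightarrow> t \<le> 1 \<Longrightarrow> height_min i zs + 1 \<le> height i zs t"
proof -
  let ?m = "height_min i zs"
  define a where "a u = (0 # map snd zs) ! u" for u
  define S where "S u = slope i (fst (zs ! u))" for u
  interpret piecewise_linear "length zs" a S "height i zs"
    using height_piecewise_linear[OF l, of i] unfolding a_def[symmetric] S_def[symmetric] .
  have "?m < height i zs 1" using height_min(2)[OF l, of 1 i] m by simp
  then obtain p q t1 where *: "p \<le> q" "q < length zs" "a q < t1" "t1 \<le> a (Suc q)" "height i zs t1 = ?m + 1"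
      "height i zs (a p) = ?m" "?m \<in> \<int>"
    and late: "\<And>t. a p < t \<Longrightarrow> t \<le> 1 \<Longrightarrow> ?m < height i zs t"
    and early: "\<And>t. a p \<le> t \<Longrightarrow> t < t1 \<Longrightarrow> height i zs t < ?m + 1"
    and after: "\<And>t. t1 \<le> t \<Longrightarrow> t \<le> 1 \<Longrightarrow> ?m + 1 \<le> height i zs t"
    and pos: "\<And>v. p \<le> v \<Longrightarrow> v \<le> q \<Longrightarrow> 0 < S v" and np: "0 < p \<Longrightarrow> S (p - 1) \<le> 0"
    using ascent_from_min[OF height_min(2)[OF l] height_min(1)[OF l]] by auto
  define A B C where "A = take p zs" and "B = take (Suc q - p) (drop p zs)" and "C = drop (Suc q) zs"
  have AB: "A @ B = take (Suc q) zs" unfolding A_def B_def using * by (simp add: take_add[symmetric] del: take_Suc)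
  have B0: "B \<noteq> []" using * by (auto simp: B_def)
  have AB': "A @ butlast B = take q zs" using AB B0 * by (metis butlast_append butlast_take diff_Suc_1 Suc_leI)
  have zs: "zs = A @ B @ C" using AB by (simp add: C_def flip: append_assoc)
  have ua: "a p = end_time A" "a q = end_time (A @ butlast B)" "a (Suc q) = end_time (A @ B)"
    unfolding AB AB' unfolding A_def a_def using * by (intro nth_end_time_take; simp)+
  have eB: "end_time (A @ B) = snd (last B)" using B0 by (simp add: end_time_last)
  show ?thesis
  proof (rule that)
    show "f_data i zs A B C t1"
      unfolding f_data_def using zs B0 * early late eB by (simp add: ua[symmetric])
    show "\<forall>z\<in>set B. 0 < slope i (fst z)"
    proof
      fix z assume "z \<in> set B"
      then obtain k where "k < length B" "z = B ! k" by (auto simp: in_set_conv_nth)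
      thus "0 < slope i (fst z)" using pos[of "p + k"] * by (simp add: B_def S_def)
    qed
    show "A \<noteq> [] \<longrightarrow> slope i (fst (last A)) \<le> 0"
      using np * by (auto simp: A_def S_def last_conv_nth min_def)
  qed (use * after in auto)
qed

subsection \<open>The root operators on lists\<close>

abbreviation reflect :: "'i \<Rightarrow> ('v \<Rightarrow> 'v) \<times> real \<Rightarrow> ('v \<Rightarrow> 'v) \<times> real" where
  "reflect i \<equiv> apfst ((\<circ>) (\<sigma> i))"

lemma reflect_reflect [simp]: "reflect i (reflect i z) = z"
  by (cases z) simp

lemma map_reflect_reflect [simp]: "map (reflect i) (map (reflect i) zs) = zs"
  by (simp add: map_idI)

lemma map_reflect_snoc:
  assumes "B \<noteq> []"
  shows "map (reflect i) B = map (reflect i) (butlast B) @ [(\<sigma> i \<circ> fst (last B), snd (last B))]"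
proof -
  have "map (reflect i) B = map (reflect i) (butlast B @ [last B])" using assms by simp
  thus ?thesis by (simp add: apfst_def map_prod_def split_beta)
qed

text \<open>Dropping \<open>x\<^sub>q\<^sub>+\<^sub>1, a\<^sub>q\<close> means here deleting the
  reflected last entry of \<open>B\<close>: the head of \<open>C\<close> has the same direction and
  carries the later end time.\<close>

definition e_list where
  "e_list i A B C t0 =
     (A @ (if t0 = end_time A then [] else [(fst (hd B), t0)])) @
     (if C \<noteq> [] \<and> \<sigma> i \<circ> fst (last B) = fst (hd C) then map (reflect i) (butlast B) else map (reflect i) B) @ C"

text \<open>The dropped \<open>x\<^sub>p, a\<^sub>p\<close> is the last entry of \<open>A\<close>,
  absorbed by the first reflected entry. The last entry of \<open>B\<close> survives as a remainder
  unless \<open>t1\<close> is its end.\<close>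

definition f_list where
  "f_list i A B C t1 =
     (if A \<noteq> [] \<and> fst (last A) = \<sigma> i \<circ> fst (hd B) then butlast A else A) @
     (map (reflect i) (butlast B) @ [(\<sigma> i \<circ> fst (last B), t1)]) @
     (if t1 = snd (last B) then C else last B # C)"

lemma slope_refl [simp]: "slope i (\<sigma> i \<circ> x) = - slope i x"
  by (simp add: simple_refl_def)

lemma refl_neq: "slope i x \<noteq> 0 \<Longrightarrow> \<sigma> i \<circ> x \<noteq> x"
  using slope_refl[of i x] by force

lemma refl_inj: "\<sigma> i \<circ> x = \<sigma> i \<circ> y \<longleftrightarrow> x = y"
  using refl_comp_refl by metis

lemma ls_step_mono: "ls_step z (x, b) \<Longrightarrow> b \<le> c \<Longrightarrow> ls_step z (x, c)"
  by (simp add: ls_step_def)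

lemma end_time_less:
  assumes "ls_list (A @ B @ C)" "B \<noteq> []"
  shows "0 \<le> end_time A" "end_time A < snd (hd B)" "end_time A < snd (last B)" "end_time A \<le> end_time (A @ butlast B)"
    "end_time (A @ butlast B) < snd (last B)" "0 \<le> end_time (A @ butlast B)" "snd (last B) \<le> 1"
    "C \<noteq> [] \<Longrightarrow> snd (last B) < snd (hd C)"
proof -
  have s: "sorted_wrt (<) (0 # map snd (A @ B @ C))" by (rule ls_list_sorted[OF assms(1)])
  obtain B' y where B: "B = B' @ [y]" using assms(2) by (cases B rule: rev_cases) auto
  have A: "end_time A = 0 \<and> A = [] \<or> (end_time A = snd (last A) \<and> A \<noteq> [])" by (cases "A = []") (auto simp: end_time_last)
  have l: "\<And>z. A \<noteq> [] \<Longrightarrow> z \<in> set (B @ C) \<Longrightarrow> snd (last A) < snd z" "\<And>z. z \<in> set (A @ B @ C) \<Longrightarrow> 0 < snd z"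
  proof -
    have "\<forall>x\<in>set A. \<forall>z\<in>set (B @ C). snd x < snd z" using s by (simp add: sorted_wrt_append ball_Un)
    thus "\<And>z. A \<noteq> [] \<Longrightarrow> z \<in> set (B @ C) \<Longrightarrow> snd (last A) < snd z" using last_in_set by blast
    show "\<And>z. z \<in> set (A @ B @ C) \<Longrightarrow> 0 < snd z" using s by auto
  qed
  show A0: "0 \<le> end_time A" using A l(2)[of "last A"] by auto
  show "end_time A < snd (hd B)" using A l(1)[of "hd B"] l(2)[of "hd B"] assms(2) by auto
  show l1: "end_time A < snd (last B)" using A l(1)[of "last B"] l(2)[of "last B"] assms(2) by auto
  have b: "B' \<noteq> [] \<Longrightarrow> end_time A < snd (last B')" using A l(1)[of "last B'"] l(2)[of "last B'"] B by auto
  show l2: "end_time A \<le> end_time (A @ butlast B)"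
    using b by (cases "B' = []") (auto simp: B end_time_last)
  show "end_time (A @ butlast B) < snd (last B)"
    using l1 s by (cases "B' = []") (auto simp: B end_time_last sorted_wrt_append)
  show "0 \<le> end_time (A @ butlast B)" using A0 l2 by linarith
  show lc: "C \<noteq> [] \<Longrightarrow> snd (last B) < snd (hd C)" using s by (auto simp: B sorted_wrt_append)
  have one: "snd (last (A @ B @ C)) = 1" using assms(1) by (simp add: ls_list_def)
  show "snd (last B) \<le> 1"
  proof (cases "C = []")
    case False
    hence "snd y < snd (last C)" using s by (auto simp: B sorted_wrt_append)
    thus ?thesis using one False by (simp add: B)
  qed (use one in \<open>simp add: B\<close>)
qed

lemma ls_list_parts:
  assumes "ls_list (A @ B @ C)" "B \<noteq> []"
  shows "successively ls_step A" "successively ls_step B" "successively ls_step C"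
    "A \<noteq> [] \<Longrightarrow> ls_step (last A) (hd B)" "C \<noteq> [] \<Longrightarrow> ls_step (last B) (hd C)"
    "z \<in> set A \<union> set B \<union> set C \<Longrightarrow> fst z \<in> WJ" "z \<in> set A \<union> set B \<union> set C \<Longrightarrow> snd z \<in> \<rat>"
    "z \<in> set A \<union> set B \<union> set C \<Longrightarrow> 0 < snd z" "C \<noteq> [] \<Longrightarrow> snd (last C) = 1" "C = [] \<Longrightarrow> snd (last B) = 1"
  using assms by (auto simp: ls_list_def successively_append_iff)

text \<open>Three kinds of joints are checked. Inside the block, negative slopes allow reflecting
  the graph paths; at \<open>t0\<close>, integrality of the height gives the edge between a
  direction and its mirror image; at the right end, \<open>SiB_path_upper\<close> applies.\<close>

lemma ls_list_e_list:
  assumes l: "ls_list zs" and e: "e_data i zs A B C t0" and int: "height_min i zs \<in> \<int>"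
    and neg: "\<forall>z\<in>set B. slope i (fst z) < 0" and C: "C \<noteq> [] \<longrightarrow> 0 \<le> slope i (fst (hd C))"
  shows "ls_list (e_list i A B C t0)"
proof -
  have zs: "zs = A @ B @ C" and B: "B \<noteq> []" and t0: "end_time A \<le> t0" "t0 < snd (hd B)"
    and h: "height i zs t0 = height_min i zs + 1" using e by (auto simp: e_data_def)
  note P = ls_list_parts[OF l[unfolded zs] B] and T = end_time_less[OF l[unfolded zs] B]
  let ?x = "fst (hd B)" and ?y = "fst (last B)" and ?R = "map (reflect i) B"
  define A1 where "A1 = A @ (if t0 = end_time A then [] else [(?x, t0)])"
  have x: "?x \<in> WJ" "slope i ?x < 0" and y: "slope i ?y < 0" using P(6) neg B by auto
  obtain B' where B': "B = hd B # B'" using B by (cases B) auto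
  have "height i zs t0 \<in> \<int> \<longleftrightarrow> t0 * slope i ?x \<in> \<int>"
    using height_int_iff[of A "hd B" "B' @ C" t0 i] l t0 unfolding zs by (metis B' append_Cons less_imp_le)
  hence ti: "t0 * slope i ?x \<in> \<int>" using h int by simp
  have rx: "SiB_path D lam t0 (\<sigma> i \<circ> ?x) ?x" by (rule SiB_path_refl_down[OF x ti])
  have nx: "\<sigma> i \<circ> ?x \<noteq> ?x" using refl_neq[of i ?x] x by simp
  have sR: "successively ls_step ?R"
    unfolding successively_map
  proof (rule successively_mono[OF P(2)])
    fix z w assume zw: "z \<in> set B" "w \<in> set B" "ls_step z w"
    hence "fst w \<in> WJ" "slope i (fst w) < 0" "slope i (fst z) < 0" using P(6) neg by auto
    thus "ls_step (reflect i z) (reflect i w)"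
      using SiB_path_reflected_neg zw(3) by (simp add: ls_step_def refl_inj)
  qed
  have hR: "hd ?R = (\<sigma> i \<circ> ?x, snd (hd B))" and lR: "last ?R = (\<sigma> i \<circ> ?y, snd (last B))"
    using B by (simp_all add: hd_map last_map apfst_def map_prod_def split_beta)
  have s1: "successively ls_step (A1 @ ?R)"
  proof (cases "t0 = end_time A")
    case True
    have "ls_step (last A) (hd ?R)" if A: "A \<noteq> []"
    proof -
      have s: "ls_step (last A) (hd B)" by (rule P(4)[OF A])
      have e: "snd (last A) = t0" using True A by (simp add: end_time_last)
      have p: "SiB_path D lam t0 ?x (fst (last A))" using s e by (simp add: ls_step_def)
      \<comment> \<open>Otherwise paths in both directions would connect \<open>?x\<close> and its
        mirror image.\<close>
      have "fst (last A) \<noteq> \<sigma> i \<circ> ?x"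
      proof
        assume "fst (last A) = \<sigma> i \<circ> ?x"
        hence "SiB_path D lam t0 ?x (\<sigma> i \<circ> ?x)" using p by simp
        from SiB_path_antisym[OF this rx] show False using nx by simp
      qed
      thus ?thesis unfolding hR using SiB_path_trans[OF rx p] e t0 by (auto simp: ls_step_def)
    qed
    thus ?thesis using True P(1) sR B by (auto simp: A1_def successively_append_iff)
  next
    case False
    have "ls_step (?x, t0) (hd ?R)" unfolding hR using t0 rx nx by (simp add: ls_step_def)
    moreover have "ls_step (last A) (?x, t0)" if "A \<noteq> []"
      using P(4)[OF that] that False t0 by (auto simp: ls_step_def end_time_last)
    ultimately show ?thesis using False P(1) sR B by (auto simp: A1_def successively_append_iff successively_Cons)
  qed
  have s: "successively ls_step (e_list i A B C t0)"
  proof (cases "C \<noteq> [] \<and> \<sigma> i \<circ> ?y = fst (hd C)")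
    case True
    have R: "?R = map (reflect i) (butlast B) @ [(fst (hd C), snd (last B))]"
      using map_reflect_snoc[OF B, of i] True by simp
    have "successively ls_step ((A1 @ map (reflect i) (butlast B)) @ [(fst (hd C), snd (last B))])"
      using s1 unfolding R by simp
    hence s2: "successively ls_step (A1 @ map (reflect i) (butlast B))"
      "A1 @ map (reflect i) (butlast B) \<noteq> [] \<longrightarrow> ls_step (last (A1 @ map (reflect i) (butlast B))) (fst (hd C), snd (last B))"
      unfolding successively_append_iff by auto
    \<comment> \<open>The end time of the second entry enters only through an inequality, so the
      merged segment may end later.\<close>
    have "ls_step (last (A1 @ map (reflect i) (butlast B))) (hd C)" if "A1 @ map (reflect i) (butlast B) \<noteq> []"
      using ls_step_mono[OF s2(2)[rule_format, OF that], of "snd (hd C)"] T(8) True by simp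
    hence "successively ls_step ((A1 @ map (reflect i) (butlast B)) @ C)"
      using s2(1) P(3) by (subst successively_append_iff) blast
    thus ?thesis using True by (simp add: e_list_def A1_def)
  next
    case False
    have "ls_step (last (A1 @ ?R)) (hd C)" if c: "C \<noteq> []"
    proof -
      have st: "ls_step (last B) (hd C)" by (rule P(5)[OF c])
      have "SiB_path D lam (snd (last B)) (fst (hd C)) (\<sigma> i \<circ> ?y)"
        using SiB_path_upper[of "snd (last B)" "fst (hd C)" ?y i] st C c y by (simp add: ls_step_def)
      thus ?thesis using False c T(8) B lR by (auto simp: ls_step_def)
    qed
    hence "successively ls_step ((A1 @ ?R) @ C)"
      using s1 P(3) by (subst successively_append_iff) blast
    thus ?thesis using False by (auto simp: e_list_def A1_def)
  qed
  have mem: "fst z \<in> WJ \<and> snd z \<in> \<rat> \<and> 0 < snd z" if z: "z \<in> set (e_list i A B C t0)" for z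
  proof -
    have sub: "set (e_list i A B C t0) \<subseteq> set A \<union> set C \<union> (if t0 = end_time A then {} else {(?x, t0)}) \<union> reflect i ` set B"
      by (auto simp: e_list_def dest: in_set_butlastD)
    have "fst (reflect i w) \<in> WJ \<and> snd (reflect i w) \<in> \<rat> \<and> 0 < snd (reflect i w)" if "w \<in> set B" for w
      using P(6-8)[of w] WJ_refl[of "fst w" i] neg that by force
    moreover have "t0 \<in> \<rat>" using Rats_of_slope[OF x(1) _ ti] x by simp
    moreover have "t0 \<noteq> end_time A \<Longrightarrow> 0 < t0" using T(1) t0 by simp
    moreover have "z \<in> set A \<union> set C \<or> t0 \<noteq> end_time A \<and> z = (?x, t0) \<or> (\<exists>w\<in>set B. z = reflect i w)"
      using subsetD[OF sub z] unfolding Un_iff image_iff by (cases "t0 = end_time A") simp_all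
    ultimately show ?thesis using P(6-8)[of z] x(1) by (elim disjE bexE conjE) (simp_all, blast)
  qed
  have "e_list i A B C t0 \<noteq> [] \<and> snd (last (e_list i A B C t0)) = 1"
    using P(9,10) B lR by (cases "C = []") (auto simp: e_list_def last_map)
  thus ?thesis using s mem by (auto simp: ls_list_def)
qed

text \<open>Dual to \<open>ls_list_e_list\<close>: positive slopes inside the block, the new break
  at \<open>t1\<close>, and \<open>SiB_path_lower\<close> at the left end.\<close>

lemma ls_list_f_list:
  assumes l: "ls_list zs" and e: "f_data i zs A B C t1" and int: "height_min i zs \<in> \<int>"
    and pos: "\<forall>z\<in>set B. 0 < slope i (fst z)" and A: "A \<noteq> [] \<longrightarrow> slope i (fst (last A)) \<le> 0"
  shows "ls_list (f_list i A B C t1)"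
proof -
  have zs: "zs = A @ B @ C" and B: "B \<noteq> []" and t1: "end_time (A @ butlast B) < t1" "t1 \<le> snd (last B)"
    and h: "height i zs t1 = height_min i zs + 1" using e by (auto simp: f_data_def)
  note P = ls_list_parts[OF l[unfolded zs] B] and T = end_time_less[OF l[unfolded zs] B]
  let ?x = "fst (hd B)" and ?y = "fst (last B)" and ?R = "map (reflect i) B"
  define M where "M = map (reflect i) (butlast B) @ [(\<sigma> i \<circ> ?y, t1)]"
  have y: "?y \<in> WJ" "0 < slope i ?y" and x: "0 < slope i ?x" using P(6) pos B by auto
  have B': "zs = (A @ butlast B) @ last B # C" using B by (simp add: zs)
  have "height i zs t1 \<in> \<int> \<longleftrightarrow> t1 * slope i ?y \<in> \<int>"
    using height_int_iff[of "A @ butlast B" "last B" C t1 i] l t1 unfolding B' by (metis less_imp_le)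
  hence ti: "t1 * slope i ?y \<in> \<int>" using h int by simp
  have ry: "SiB_path D lam t1 ?y (\<sigma> i \<circ> ?y)" by (rule SiB_path_refl_up[OF y ti])
  have ny: "\<sigma> i \<circ> ?y \<noteq> ?y" using refl_neq[of i ?y] y by simp
  have sR: "successively ls_step ?R"
    unfolding successively_map
  proof (rule successively_mono[OF P(2)])
    fix z w assume zw: "z \<in> set B" "w \<in> set B" "ls_step z w"
    hence "fst z \<in> WJ" "0 < slope i (fst w)" "0 < slope i (fst z)" using P(6) pos by auto
    thus "ls_step (reflect i z) (reflect i w)"
      using SiB_path_reflected_pos zw(3) by (simp add: ls_step_def refl_inj)
  qed
  note R = map_reflect_snoc[OF B, of i]
  have sM: "successively ls_step M"
  proof -
    have "ls_step (last (map (reflect i) (butlast B))) (\<sigma> i \<circ> ?y, t1)" if "butlast B \<noteq> []"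
    proof -
      have "ls_step (last (map (reflect i) (butlast B))) (\<sigma> i \<circ> ?y, snd (last B))"
        using sR that unfolding R successively_append_iff by simp
      moreover have "snd (last (map (reflect i) (butlast B))) < t1"
        using t1 that by (simp add: end_time_last last_map)
      ultimately show ?thesis by (simp add: ls_step_def)
    qed
    thus ?thesis using sR unfolding R M_def successively_append_iff by auto
  qed
  define E where "E = (if t1 = snd (last B) then C else last B # C)"
  have sE: "successively ls_step (M @ E)"
  proof (cases "t1 = snd (last B)")
    case True
    have "ls_step (\<sigma> i \<circ> ?y, t1) (hd C)" if c: "C \<noteq> []"
    proof -
      have p: "SiB_path D lam t1 (fst (hd C)) ?y" using P(5)[OF c] True by (simp add: ls_step_def)
      have "fst (hd C) \<noteq> \<sigma> i \<circ> ?y"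
      proof
        assume "fst (hd C) = \<sigma> i \<circ> ?y"
        hence "SiB_path D lam t1 (\<sigma> i \<circ> ?y) ?y" using p by simp
        from SiB_path_antisym[OF this ry] show False using ny by simp
      qed
      thus ?thesis using SiB_path_trans[OF p ry] T(8)[OF c] True by (simp add: ls_step_def)
    qed
    thus ?thesis using sM P(3) True by (auto simp: successively_append_iff successively_Cons E_def M_def)
  next
    case False
    have "ls_step (\<sigma> i \<circ> ?y, t1) (last B)" using False t1 ry ny by (simp add: ls_step_def)
    moreover have "successively ls_step (last B # C)" using P(3,5) by (auto simp: successively_Cons)
    ultimately show ?thesis using sM False by (auto simp: successively_append_iff E_def M_def)
  qed
  \<comment> \<open>The end time of the first reflected entry: that of the head of \<open>B\<close>,
    or \<open>t1\<close> if \<open>B\<close> has only one entry.\<close>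
  define b where "b = snd (hd M)"
  have hM: "hd (M @ E) = (\<sigma> i \<circ> ?x, b)" and b: "end_time A < b"
  proof -
    have "hd M = (\<sigma> i \<circ> ?x, b) \<and> end_time A < b"
    proof (cases "butlast B = []")
      case True
      hence "hd B = last B" using B by (metis append_butlast_last_id append_Nil list.sel(1))
      thus ?thesis using True t1 by (simp add: M_def b_def)
    next
      case False
      hence "hd (butlast B) = hd B" using B by (cases B) auto
      thus ?thesis using False T(2) by (simp add: M_def b_def hd_map apfst_def map_prod_def split_beta)
    qed
    thus "hd (M @ E) = (\<sigma> i \<circ> ?x, b)" "end_time A < b" by (auto simp: M_def hd_append)
  qed
  define L where "L = (if A \<noteq> [] \<and> fst (last A) = \<sigma> i \<circ> ?x then butlast A else A)"
  have s: "successively ls_step (L @ M @ E)"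
  proof (cases "A = []")
    case True
    thus ?thesis using sE by (simp add: L_def)
  next
    case False
    obtain A' w where A': "A = A' @ [w]" using False by (cases A rule: rev_cases) auto
    have st: "ls_step w (hd B)" using P(4)[OF False] by (simp add: A')
    have p: "SiB_path D lam (snd w) (\<sigma> i \<circ> ?x) (fst w)"
      using SiB_path_lower[of "snd w" ?x "fst w" i] st x A by (simp add: ls_step_def A')
    have wb: "snd w < b" using b by (simp add: A' end_time_last)
    show ?thesis
    proof (cases "fst w = \<sigma> i \<circ> ?x")
      case True
      have "ls_step (last A') (\<sigma> i \<circ> ?x, b)" if "A' \<noteq> []"
      proof -
        have "ls_step (last A') w" using P(1) that by (auto simp: A' successively_append_iff)
        hence "ls_step (last A') (fst w, snd w)" by simp
        from ls_step_mono[OF this, of b] show ?thesis using wb True by simp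
      qed
      thus ?thesis using sE P(1) True hM by (auto simp: L_def A' successively_append_iff)
    next
      case False
      have "ls_step w (\<sigma> i \<circ> ?x, b)" using False p wb by (auto simp: ls_step_def)
      hence "successively ls_step (A @ (M @ E))"
        using sE P(1) hM by (subst successively_append_iff) (simp add: A')
      thus ?thesis using False by (simp add: L_def A')
    qed
  qed
  have fl: "f_list i A B C t1 = L @ M @ E" by (simp add: f_list_def L_def M_def E_def)
  have mem: "fst z \<in> WJ \<and> snd z \<in> \<rat> \<and> 0 < snd z" if "z \<in> set (L @ M @ E)" for z
  proof -
    have sub: "set (L @ M @ E) \<subseteq> set A \<union> set B \<union> set C \<union> {(\<sigma> i \<circ> ?y, t1)} \<union> reflect i ` set B"
      using B by (auto simp: L_def M_def E_def dest: in_set_butlastD)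
    have "fst (reflect i w) \<in> WJ \<and> snd (reflect i w) \<in> \<rat> \<and> 0 < snd (reflect i w)" if "w \<in> set B" for w
      using P(6-8)[of w] WJ_refl[of "fst w" i] pos that by force
    moreover have "t1 \<in> \<rat>" using Rats_of_slope[OF y(1) _ ti] y by simp
    moreover have "0 < t1" using T(6) t1 by simp
    moreover have "\<sigma> i \<circ> ?y \<in> WJ" using WJ_refl[OF y(1)] y by simp
    moreover have "z \<in> set A \<union> set B \<union> set C \<or> z = (\<sigma> i \<circ> ?y, t1) \<or> (\<exists>w\<in>set B. z = reflect i w)"
      using subsetD[OF sub that] unfolding Un_iff image_iff by blast
    ultimately show ?thesis using P(6-8)[of z] by (elim disjE bexE) simp_all
  qed
  have "L @ M @ E \<noteq> [] \<and> snd (last (L @ M @ E)) = 1"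
    using P(9,10) by (cases "C = []") (auto simp: M_def E_def)
  thus ?thesis using s mem by (auto simp: ls_list_def fl)
qed

text \<open>Reflecting the block subtracts the height gained in it times \<open>\<alpha> i\<close>,
  and \<open>list_path_middle\<close> expresses that gain by heights frozen at the two
  times.\<close>

lemma list_path_e_list:
  assumes l: "ls_list zs" and e: "e_data i zs A B C t0"
  shows "list_path lam 0 (e_list i A B C t0) t = list_path lam 0 zs t
    - (height i zs (min t (end_time (A @ B))) - height i zs (min t t0)) *\<^sub>R \<alpha> i"
proof -
  have zs: "zs = A @ B @ C" and B: "B \<noteq> []" and t0: "end_time A \<le> t0" "t0 < snd (hd B)"
    using e by (auto simp: e_data_def)
  let ?x = "fst (hd B)" and ?y = "fst (last B)" and ?R = "map (reflect i) B"
  define A1 where "A1 = A @ (if t0 = end_time A then [] else [(?x, t0)])"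
  have eA: "end_time A1 = t0" by (simp add: A1_def end_time_last)
  have eAB: "end_time (A1 @ B) = end_time (A @ B)" using B by simp
  obtain B' where B': "B = hd B # B'" using B by (cases B) auto
  have 1: "list_path lam 0 (A1 @ B @ C) t = list_path lam 0 zs t" for t
  proof (cases "t0 = end_time A")
    case False
    have "list_path lam 0 (A1 @ B @ C) t = list_path lam 0 A t + list_path lam (end_time A) ((?x, t0) # (?x, snd (hd B)) # B' @ C) t"
      using False B' by (simp add: A1_def list_path_append_0 del: list_path.simps) (metis append_Cons prod.collapse)
    also have "\<dots> = list_path lam 0 (A @ (?x, snd (hd B)) # B' @ C) t"
      by (simp only: list_path_split list_path_append_0)
    finally show ?thesis using B' by (metis zs append_Cons prod.collapse)
  qed (simp add: A1_def zs)
  have srt: "sorted (0 # map snd (A1 @ B @ C))"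
  proof -
    have so: "sorted (0 # map snd (A @ B @ C))" using ls_list_sorted_le[OF l] zs by simp
    hence "\<forall>z\<in>set B' \<union> set C. snd (hd B) \<le> snd z"
      by (subst (asm) B') (simp add: sorted_append ball_Un)
    hence ge: "z \<in> set B' \<union> set C \<Longrightarrow> t0 \<le> snd z" for z using t0 by force
    have "set B = insert (hd B) (set B')" using arg_cong[OF B', of set] by simp
    hence "\<forall>z\<in>set (B @ C). t0 \<le> snd z" using ge t0 by auto
    moreover have "\<forall>z\<in>set A. snd z \<le> t0" "0 \<le> t0"
      using so t0 by (cases A rule: rev_cases; force simp: sorted_append end_time_last)+
    ultimately show ?thesis using so by (auto simp: A1_def sorted_append)
  qed
  have mid: "list_path lam t0 B t = list_path lam 0 zs (min t (end_time (A @ B))) - list_path lam 0 zs (min t t0)"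
    using list_path_middle[OF srt eA[symmetric] refl, of lam t] unfolding 1 eAB .
  have eR: "end_time (A1 @ ?R) = end_time (A @ B)" using B by (simp add: end_time_last last_map)
  have 2: "list_path lam 0 (A1 @ ?R @ C) t = list_path lam 0 (A1 @ B @ C) t - \<kappa> i (list_path lam t0 B t) *\<^sub>R \<alpha> i"
  proof -
    have "list_path lam 0 (A1 @ ?R @ C) t = list_path lam 0 A1 t + \<sigma> i (list_path lam t0 B t) + list_path lam (end_time (A @ B)) C t"
      using list_path_append_0[of lam "A1 @ ?R" C t] list_path_append_0[of lam A1 ?R t]
      by (simp add: eR eA list_path_map[OF linear_refl])
    moreover have "list_path lam 0 (A1 @ B @ C) t = list_path lam 0 A1 t + list_path lam t0 B t + list_path lam (end_time (A @ B)) C t"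
      using list_path_append_0[of lam "A1 @ B" C t] list_path_append_0[of lam A1 B t] by (simp add: eAB eA)
    ultimately show ?thesis by (simp add: simple_refl_def)
  qed
  have 3: "list_path lam 0 (e_list i A B C t0) t = list_path lam 0 (A1 @ ?R @ C) t"
  proof (cases "C \<noteq> [] \<and> \<sigma> i \<circ> ?y = fst (hd C)")
    case True
    obtain C' where C': "C = (\<sigma> i \<circ> ?y, snd (hd C)) # C'" using True by (cases C) auto
    note R = map_reflect_snoc[OF B, of i]
    let ?X = "A1 @ map (reflect i) (butlast B)"
    have "list_path lam 0 (A1 @ ?R @ C) t = list_path lam 0 (?X @ (\<sigma> i \<circ> ?y, snd (last B)) # (\<sigma> i \<circ> ?y, snd (hd C)) # C') t"
      unfolding R using C' by (metis append_Cons append_Nil append_assoc)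
    also have "\<dots> = list_path lam 0 (?X @ (\<sigma> i \<circ> ?y, snd (hd C)) # C') t"
      by (simp only: list_path_append_0[of lam ?X] list_path_split)
    also have "\<dots> = list_path lam 0 (?X @ C) t" using C' by metis
    finally show ?thesis using True by (simp add: e_list_def A1_def)
  next
    case False
    hence "e_list i A B C t0 = A1 @ ?R @ C" by (auto simp: e_list_def A1_def)
    thus ?thesis by simp
  qed
  show ?thesis unfolding 3 2 1 mid by simp
qed

lemma list_path_f_list:
  assumes l: "ls_list zs" and e: "f_data i zs A B C t1"
  shows "list_path lam 0 (f_list i A B C t1) t = list_path lam 0 zs t
    - (height i zs (min t t1) - height i zs (min t (end_time A))) *\<^sub>R \<alpha> i"
proof -
  have zs: "zs = A @ B @ C" and B: "B \<noteq> []" and t1: "end_time (A @ butlast B) < t1" "t1 \<le> snd (last B)"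
    using e by (auto simp: f_data_def)
  let ?x = "fst (hd B)" and ?y = "fst (last B)"
  \<comment> \<open>The last segment of \<open>B\<close> is cut at \<open>t1\<close>; the remainder
    heading \<open>?C1\<close> may have length zero.\<close>
  let ?B1 = "butlast B @ [(?y, t1)]" and ?C1 = "(?y, snd (last B)) # C"
  let ?M = "map (reflect i) ?B1"
  have M: "?M = map (reflect i) (butlast B) @ [(\<sigma> i \<circ> ?y, t1)]" by simp
  have 1: "list_path lam 0 (A @ ?B1 @ ?C1) t = list_path lam 0 zs t" for t
  proof -
    have "list_path lam 0 (A @ ?B1 @ ?C1) t = list_path lam 0 ((A @ butlast B) @ (?y, t1) # (?y, snd (last B)) # C) t"
      by simp
    also have "\<dots> = list_path lam 0 ((A @ butlast B) @ (?y, snd (last B)) # C) t"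
      by (simp only: list_path_append_0[of lam "A @ butlast B"] list_path_split)
    also have "(A @ butlast B) @ (?y, snd (last B)) # C = zs" using B by (simp add: zs)
    finally show ?thesis .
  qed
  have srt: "sorted (0 # map snd (A @ ?B1 @ ?C1))"
  proof -
    have "zs = (A @ butlast B) @ last B # C" using B by (simp add: zs)
    hence "sorted (0 # map snd ((A @ butlast B) @ last B # C))" using ls_list_sorted_le[OF l] by metis
    hence "sorted (0 # map snd ((A @ butlast B) @ (?y, t1) # last B # C))"
      using t1 by (cases "A @ butlast B" rule: rev_cases) (auto simp: sorted_append end_time_last end_time_def)
    thus ?thesis by simp
  qed
  have eB: "end_time (A @ ?B1) = t1" by (simp add: end_time_last)
  have mid: "list_path lam (end_time A) ?B1 t = list_path lam 0 zs (min t t1) - list_path lam 0 zs (min t (end_time A))"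
    using list_path_middle[OF srt refl refl, of lam t] unfolding 1 eB .
  have eR: "end_time (A @ ?M) = t1" by (simp add: end_time_last)
  have 2: "list_path lam 0 (A @ ?M @ ?C1) t = list_path lam 0 (A @ ?B1 @ ?C1) t - \<kappa> i (list_path lam (end_time A) ?B1 t) *\<^sub>R \<alpha> i"
  proof -
    have "list_path lam 0 (A @ ?M @ ?C1) t = list_path lam 0 A t + \<sigma> i (list_path lam (end_time A) ?B1 t) + list_path lam t1 ?C1 t"
      using list_path_append_0[of lam "A @ ?M" ?C1 t] list_path_append_0[of lam A ?M t]
      by (simp add: eR list_path_map[OF linear_refl] del: map_append list_path.simps)
    moreover have "list_path lam 0 (A @ ?B1 @ ?C1) t = list_path lam 0 A t + list_path lam (end_time A) ?B1 t + list_path lam t1 ?C1 t"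
      using list_path_append_0[of lam "A @ ?B1" ?C1 t] list_path_append_0[of lam A ?B1 t] by (simp add: eB del: list_path.simps)
    ultimately show ?thesis by (simp add: simple_refl_def del: list_path.simps)
  qed
  define E where "E = (if t1 = snd (last B) then C else last B # C)"
  define L where "L = (if A \<noteq> [] \<and> fst (last A) = \<sigma> i \<circ> ?x then butlast A else A)"
  have fl: "f_list i A B C t1 = L @ ?M @ E" by (simp add: f_list_def L_def E_def)
  have 3: "list_path lam 0 (X @ ?M @ E) t = list_path lam 0 (X @ ?M @ ?C1) t" for X
  proof (cases "t1 = snd (last B)")
    case True
    have "list_path lam t1 ?C1 t = list_path lam t1 C t" using True by simp
    thus ?thesis using True list_path_append_0[of lam "X @ ?M" C t] list_path_append_0[of lam "X @ ?M" ?C1 t]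
      by (simp add: E_def end_time_last del: list_path.simps)
  next
    case False
    thus ?thesis by (simp add: E_def)
  qed
  obtain b N where N: "?M = (\<sigma> i \<circ> ?x, b) # N"
  proof (cases "butlast B = []")
    case True
    hence "hd B = last B" using B by (metis append_butlast_last_id append_Nil list.sel(1))
    thus ?thesis using that True by simp
  next
    case False
    moreover have "hd (butlast B) = hd B" using False by (cases B) auto
    ultimately obtain B' where "butlast B = hd B # B'" by (metis list.collapse)
    thus ?thesis using that by (cases "hd B") auto
  qed
  have 4: "list_path lam 0 (L @ ?M @ ?C1) t = list_path lam 0 (A @ ?M @ ?C1) t"
  proof (cases "A \<noteq> [] \<and> fst (last A) = \<sigma> i \<circ> ?x")
    case True
    hence A: "A = L @ [(\<sigma> i \<circ> ?x, snd (last A))]" by (simp add: L_def) (metis append_butlast_last_id prod.collapse)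
    have "list_path lam 0 (A @ ?M @ ?C1) t = list_path lam 0 (L @ (\<sigma> i \<circ> ?x, snd (last A)) # (\<sigma> i \<circ> ?x, b) # N @ ?C1) t"
      unfolding N by (subst A) simp
    also have "\<dots> = list_path lam 0 (L @ ?M @ ?C1) t"
      unfolding N by (simp only: list_path_append_0[of lam L] list_path_split append_Cons)
    finally show ?thesis ..
  next
    case False
    thus ?thesis by (auto simp: L_def)
  qed
  show ?thesis unfolding fl 3 4 2 1 mid by simp
qed

text \<open>A dictionary from the index arithmetic of the root operators to the blocks. The start
  time 0 heads \<open>as\<close>, so its indices are shifted by one against those of the
  entries.\<close>

lemma take_drop_pieces:
  fixes A B C :: "('x \<times> real) list"
  assumes "B \<noteq> []"
  defines "xs \<equiv> map fst (A @ B @ C)" and "as \<equiv> 0 # map snd (A @ B @ C)"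
  shows "take (length A) xs = map fst A" "take (Suc (length A)) xs = map fst A @ [fst (hd B)]"
    "drop (length A) (take (length A + length B) xs) = map fst B"
    "drop (length A + length B) xs = map fst C" "drop (Suc (length A + length B)) xs = map fst (tl C)"
    "drop (length A + length B - 1) xs = fst (last B) # map fst C"
    "take (length A - 1) xs = map fst (butlast A)"
    "take (Suc (length A)) as = 0 # map snd A" "take (length A) as @ [end_time A] = 0 # map snd A"
    "drop (Suc (length A)) (take (length A + length B) as) = map snd (butlast B)"
    "drop (length A + length B) as = snd (last B) # map snd C" "drop (Suc (length A + length B)) as = map snd C"
    "A \<noteq> [] \<Longrightarrow> take (length A) as = 0 # map snd (butlast A)"
    "xs ! (length A + length B - 1) = fst (last B)" "C \<noteq> [] \<Longrightarrow> xs ! (length A + length B) = fst (hd C)"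
    "A \<noteq> [] \<Longrightarrow> xs ! (length A - 1) = fst (last A)" "xs ! length A = fst (hd B)"
proof -
  obtain x B' where B: "B = x # B'" using assms(1) by (cases B) auto
  obtain B0 y where B0: "B = B0 @ [y]" using assms(1) by (cases B rule: rev_cases) auto
  show "take (length A) xs = map fst A" "drop (length A) (take (length A + length B) xs) = map fst B"
    "drop (length A + length B) xs = map fst C" by (simp_all add: xs_def)
  show "take (Suc (length A)) xs = map fst A @ [fst (hd B)]" by (simp add: xs_def B)
  show "drop (Suc (length A + length B)) xs = map fst (tl C)"
    by (simp add: xs_def) (simp add: drop_Suc flip: map_tl)
  show "drop (length A + length B - 1) xs = fst (last B) # map fst C" by (simp add: xs_def B0)
  show "take (length A - 1) xs = map fst (butlast A)" by (simp add: xs_def butlast_conv_take take_map)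
  show "take (Suc (length A)) as = 0 # map snd A" "drop (Suc (length A + length B)) as = map snd C"
    by (simp_all add: as_def)
  show "take (length A) as @ [end_time A] = 0 # map snd A"
    by (cases A rule: rev_cases) (simp_all add: as_def end_time_last)
  show "drop (Suc (length A)) (take (length A + length B) as) = map snd (butlast B)"
    by (simp add: as_def B0)
  show "drop (length A + length B) as = snd (last B) # map snd C" by (simp add: as_def B0)
  show "A \<noteq> [] \<Longrightarrow> take (length A) as = 0 # map snd (butlast A)"
    by (cases A rule: rev_cases) (simp_all add: as_def)
  show "xs ! (length A + length B - 1) = fst (last B)" by (simp add: xs_def B0 nth_append)
  show "C \<noteq> [] \<Longrightarrow> xs ! (length A + length B) = fst (hd C)" by (simp add: xs_def nth_append hd_conv_nth)
  show "A \<noteq> [] \<Longrightarrow> xs ! (length A - 1) = fst (last A)" by (simp add: xs_def nth_append last_conv_nth)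
  show "xs ! length A = fst (hd B)" by (simp add: xs_def B nth_append)
qed

lemma ls_list_nth_eq:
  assumes "ls_list zs" "p \<le> length zs" "q \<le> length zs"
  shows "(0 # map snd zs) ! p = (0 # map snd zs) ! q \<longleftrightarrow> p = q"
proof -
  have "distinct (0 # map snd zs)" using ls_list_sorted[OF assms(1)] strict_sorted_iff by blast
  thus ?thesis using assms(2,3) by (intro nth_eq_iff_index_eq) auto
qed

lemma ls_list_nth_mono:
  assumes "ls_list zs" "p \<le> q" "q \<le> length zs"
  shows "(0 # map snd zs) ! p \<le> (0 # map snd zs) ! q"
  using sorted_nth_mono[OF ls_list_sorted_le[OF assms(1)], of p q] assms(2,3) by simp

lemma root_e_None: "root_e D lam i (of_pairs zs) = None \<longleftrightarrow> height_min i zs = 0"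
  using H_min_of_pairs[of i zs] by (simp add: of_pairs_def Let_def)

lemma root_f_None: "root_f D lam i (of_pairs zs) = None \<longleftrightarrow> height i zs 1 = height_min i zs"
  using H_min_of_pairs[of i zs] H_fun_of_pairs[of i zs] by (simp add: of_pairs_def Let_def)

text \<open>The data single out the values of all the choices in the operator; uniqueness of
  \<open>p\<close> and \<open>q\<close> rests on the break points increasing strictly.\<close>

lemma root_e_e_list:
  assumes l: "ls_list zs" and e: "e_data i zs A B C t0" and nz: "height_min i zs \<noteq> 0"
  shows "root_e D lam i (of_pairs zs) = Some (of_pairs (e_list i A B C t0))"
proof -
  have zs: "zs = A @ B @ C" and B: "B \<noteq> []" and t0: "end_time A \<le> t0" "t0 < snd (hd B)"
    and h: "height i zs t0 = height_min i zs + 1" "height i zs (end_time (A @ B)) = height_min i zs"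
    and first: "\<And>t. 0 \<le> t \<Longrightarrow> t < end_time (A @ B) \<Longrightarrow> height_min i zs < height i zs t"
    and late: "\<And>t. t0 < t \<Longrightarrow> t \<le> end_time (A @ B) \<Longrightarrow> height i zs t < height_min i zs + 1"
    using e by (auto simp: e_data_def)
  note T = end_time_less[OF l[unfolded zs] B]
  let ?m = "height_min i zs" and ?t1 = "snd (last B)"
  define xs where "xs = map fst zs"
  define as where "as = 0 # map snd zs"
  note pieces = take_drop_pieces[OF B, where A = A and C = C, folded zs, folded xs_def as_def]
  have et: "end_time (A @ B) = ?t1" using B by (simp add: end_time_last)
  have He: "H_fun D lam i (xs, as) = height i zs" and me: "H_min D lam i (xs, as) = ?m"
    using H_fun_of_pairs[of i zs] H_min_of_pairs[of i zs] by (simp_all add: of_pairs_def xs_def as_def)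
  have len: "length xs = length A + length B + length C" by (simp add: xs_def zs)
  have lz: "length zs = length A + length B + length C" by (simp add: zs)
  have hb: "snd (hd B) \<le> ?t1"
    using ls_list_sorted_le[OF l] B unfolding zs by (cases B) (auto simp: sorted_append)
  have t1: "(LEAST t. t \<in> {0..1} \<and> height i zs t = ?m) = ?t1"
  proof (rule Least_equality)
    show "?t1 \<in> {0..1} \<and> height i zs ?t1 = ?m" using T h et by auto
    show "?t1 \<le> t" if "t \<in> {0..1} \<and> height i zs t = ?m" for t
      using first[of t] that et by force
  qed
  have t0e: "(GREATEST t. t \<in> {0..?t1} \<and> height i zs t = ?m + 1) = t0"
  proof (rule Greatest_equality)
    show "t0 \<in> {0..?t1} \<and> height i zs t0 = ?m + 1" using T(1) t0 h hb by auto
    show "t \<le> t0" if "t \<in> {0..?t1} \<and> height i zs t = ?m + 1" for t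
      using late[of t] that et by force
  qed
  have asn: "as ! length A = end_time A" "as ! (length A + length B) = ?t1" "as ! Suc (length A) = snd (hd B)"
  proof -
    show "as ! length A = end_time A" unfolding as_def zs by (rule nth_end_time)
    show "as ! (length A + length B) = ?t1"
      using nth_end_time[of "A @ B" C] et by (simp add: as_def zs)
    show "as ! Suc (length A) = snd (hd B)" using B by (simp add: as_def zs nth_append hd_conv_nth)
  qed
  have q: "(THE q. q \<le> length xs \<and> as ! q = ?t1) = length A + length B"
  proof (rule the_equality)
    fix q assume "q \<le> length xs \<and> as ! q = ?t1"
    thus "q = length A + length B"
      using ls_list_nth_eq[OF l, of q "length A + length B"] asn(2) by (simp add: as_def len lz del: map_append)
  qed (use asn len in auto)
  have p: "(THE p. 1 \<le> p \<and> p \<le> length xs \<and> as ! (p - 1) \<le> t0 \<and> t0 < as ! p) = Suc (length A)"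
  proof (rule the_equality)
    show "1 \<le> Suc (length A) \<and> Suc (length A) \<le> length xs \<and> as ! (Suc (length A) - 1) \<le> t0 \<and> t0 < as ! Suc (length A)"
      using asn t0 B len by (cases B) auto
    fix p assume p: "1 \<le> p \<and> p \<le> length xs \<and> as ! (p - 1) \<le> t0 \<and> t0 < as ! p"
    show "p = Suc (length A)"
    proof (rule ccontr)
      assume "p \<noteq> Suc (length A)"
      then consider "p \<le> length A" | "Suc (length A) \<le> p - 1" by linarith
      thus False
      proof cases
        case 1
        hence "as ! p \<le> as ! length A" unfolding as_def by (rule ls_list_nth_mono[OF l]) (simp add: zs)
        thus False using p asn t0 by simp
      next
        case 2
        hence "as ! Suc (length A) \<le> as ! (p - 1)" unfolding as_def
          by (rule ls_list_nth_mono[OF l]) (use p lz len in auto)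
        thus False using p asn t0 by simp
      qed
    qed
  qed
  have dr: "(length A + length B < length xs \<and> \<sigma> i \<circ> xs ! (length A + length B - 1) = xs ! (length A + length B))
      \<longleftrightarrow> C \<noteq> [] \<and> \<sigma> i \<circ> fst (last B) = fst (hd C)"
    using pieces(14,15) by (cases "C = []") (simp_all add: len)
  have "root_e D lam i (xs, as) = Some (of_pairs (e_list i A B C t0))"
    unfolding root_e.simps Let_def He me if_not_P[OF nz] t1 t0e q p diff_Suc_1 asn dr
    unfolding option.inject of_pairs_def prod.inject
  proof
    let ?dl = "t0 = end_time A" and ?dr = "C \<noteq> [] \<and> \<sigma> i \<circ> fst (last B) = fst (hd C)"
    have drC: "map fst (tl C) = tl (map fst C)" "map fst C = fst (hd C) # map fst (tl C)" if ?dr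
      using that by (cases C; simp)+
    have mB: "map fst (map (reflect i) B) = map ((\<circ>) (\<sigma> i)) (map fst B)" by simp
    have mB': "map ((\<circ>) (\<sigma> i)) (map fst B) = map fst (map (reflect i) (butlast B)) @ [\<sigma> i \<circ> fst (last B)]"
      unfolding mB[symmetric] map_reflect_snoc[OF B] by simp
    have sB: "map snd (map (reflect i) B) = map snd B" "map snd (map (reflect i) (butlast B)) = map snd (butlast B)"
      "map snd B = map snd (butlast B) @ [snd (last B)]"
      using arg_cong[OF append_butlast_last_id[OF B], of "map snd"] by simp_all
    show "take (if ?dl then length A else Suc (length A)) xs @
        map ((\<circ>) (\<sigma> i)) (drop (length A) (take (length A + length B) xs)) @
        drop (if ?dr then length A + length B + 1 else length A + length B) xs = map fst (e_list i A B C t0)"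
    proof (cases ?dr)
      case True
      thus ?thesis using pieces(1-5) mB' drC(2)[OF True] by (simp add: e_list_def)
    next
      case False
      show ?thesis unfolding e_list_def if_not_P[OF False] using pieces(1-5) by simp
    qed
    show "take (if ?dl then length A else Suc (length A)) as @
        [t0] @ drop (Suc (length A)) (take (length A + length B) as) @
        drop (if ?dr then length A + length B + 1 else length A + length B) as = 0 # map snd (e_list i A B C t0)"
    proof -
      have "take (if ?dl then length A else Suc (length A)) as @ [t0] = 0 # map snd (A @ (if ?dl then [] else [(fst (hd B), t0)]))"
        using pieces(8,9) by simp
      thus ?thesis using pieces(8-12) sB by (simp add: e_list_def)
    qed
  qed
  thus ?thesis by (simp add: of_pairs_def xs_def as_def)
qed

lemma root_f_f_list:
  assumes l: "ls_list zs" and e: "f_data i zs A B C t1" and nz: "height i zs 1 \<noteq> height_min i zs"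
  shows "root_f D lam i (of_pairs zs) = Some (of_pairs (f_list i A B C t1))"
proof -
  have zs: "zs = A @ B @ C" and B: "B \<noteq> []" and t1: "end_time (A @ butlast B) < t1" "t1 \<le> snd (last B)"
    and h: "height i zs t1 = height_min i zs + 1" "height i zs (end_time A) = height_min i zs"
    and late: "\<And>t. end_time A < t \<Longrightarrow> t \<le> 1 \<Longrightarrow> height_min i zs < height i zs t"
    and early: "\<And>t. end_time A \<le> t \<Longrightarrow> t < t1 \<Longrightarrow> height i zs t < height_min i zs + 1"
    using e by (auto simp: f_data_def)
  note T = end_time_less[OF l[unfolded zs] B]
  let ?m = "height_min i zs" and ?t0 = "end_time A"
  define xs where "xs = map fst zs"
  define as where "as = 0 # map snd zs"
  note pieces = take_drop_pieces[OF B, where A = A and C = C, folded zs, folded xs_def as_def]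
  have He: "H_fun D lam i (xs, as) = height i zs" and me: "H_min D lam i (xs, as) = ?m"
    using H_fun_of_pairs[of i zs] H_min_of_pairs[of i zs] by (simp_all add: of_pairs_def xs_def as_def)
  have len: "length xs = length A + length B + length C" by (simp add: xs_def zs)
  have lz: "length zs = length A + length B + length C" by (simp add: zs)
  have lB: "0 < length B" using B by simp
  have t0: "(GREATEST t. t \<in> {0..1} \<and> height i zs t = ?m) = ?t0"
  proof (rule Greatest_equality)
    show "?t0 \<in> {0..1} \<and> height i zs ?t0 = ?m" using T h by auto
    show "t \<le> ?t0" if "t \<in> {0..1} \<and> height i zs t = ?m" for t
      using late[of t] that by force
  qed
  have t1e: "(LEAST t. t \<in> {?t0..1} \<and> height i zs t = ?m + 1) = t1"
  proof (rule Least_equality)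
    show "t1 \<in> {?t0..1} \<and> height i zs t1 = ?m + 1" using T t1 h by auto
    show "t1 \<le> t" if "t \<in> {?t0..1} \<and> height i zs t = ?m + 1" for t
      using early[of t] that by force
  qed
  have asn: "as ! length A = ?t0" "as ! (length A + length B - 1) = end_time (A @ butlast B)"
    "as ! (length A + length B) = snd (last B)"
  proof -
    show "as ! length A = end_time A" unfolding as_def zs by (rule nth_end_time)
    show "as ! (length A + length B) = snd (last B)"
      using nth_end_time[of "A @ B" C] B by (simp add: as_def zs end_time_last)
    have "zs = (A @ butlast B) @ last B # C" using B by (simp add: zs)
    thus "as ! (length A + length B - 1) = end_time (A @ butlast B)"
      using nth_end_time[of "A @ butlast B" "last B # C"] lB unfolding as_def by simp
  qed
  have p: "(THE p. p \<le> length xs \<and> as ! p = ?t0) = length A"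
  proof (rule the_equality)
    fix q assume "q \<le> length xs \<and> as ! q = ?t0"
    thus "q = length A"
      using ls_list_nth_eq[OF l, of q "length A"] asn(1) by (simp add: as_def len lz del: map_append)
  qed (use asn len in auto)
  have q: "(THE q. q < length xs \<and> as ! q < t1 \<and> t1 \<le> as ! (q + 1)) = length A + length B - 1"
  proof (rule the_equality)
    show "length A + length B - 1 < length xs \<and> as ! (length A + length B - 1) < t1 \<and> t1 \<le> as ! (length A + length B - 1 + 1)"
    proof -
      have "length A + length B - 1 < length xs" "length A + length B - 1 + 1 = length A + length B"
        using lB len by linarith+
      thus ?thesis using asn(2,3) t1 by simp
    qed
    fix q assume q: "q < length xs \<and> as ! q < t1 \<and> t1 \<le> as ! (q + 1)"
    show "q = length A + length B - 1"
    proof (rule ccontr)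
      assume "q \<noteq> length A + length B - 1"
      then consider "q + 1 \<le> length A + length B - 1" | "length A + length B \<le> q" using lB by linarith
      thus False
      proof cases
        case 1
        hence "as ! (q + 1) \<le> as ! (length A + length B - 1)" unfolding as_def
          by (rule ls_list_nth_mono[OF l]) (simp add: zs)
        thus False using q asn t1 by simp
      next
        case 2
        hence "as ! (length A + length B) \<le> as ! q" unfolding as_def
          by (rule ls_list_nth_mono[OF l]) (use q lz len in auto)
        thus False using q asn t1 by simp
      qed
    qed
  qed
  have q1: "length A + length B - 1 + 1 = length A + length B" "length A + length B - 1 + 2 = Suc (length A + length B)"
    using lB by simp_all
  have dl: "(1 \<le> length A \<and> xs ! (length A - 1) = \<sigma> i \<circ> xs ! length A) \<longleftrightarrow> A \<noteq> [] \<and> fst (last A) = \<sigma> i \<circ> fst (hd B)"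
    using pieces(16,17) by (cases "A = []") (simp_all add: Suc_le_eq)
  have "root_f D lam i (xs, as) = Some (of_pairs (f_list i A B C t1))"
    unfolding root_f.simps Let_def He me if_not_P[OF nz] t0 t1e p q q1 asn dl
    unfolding option.inject of_pairs_def prod.inject
  proof
    let ?dl = "A \<noteq> [] \<and> fst (last A) = \<sigma> i \<circ> fst (hd B)" and ?dr = "t1 = snd (last B)"
    have mB: "map fst (map (reflect i) B) = map ((\<circ>) (\<sigma> i)) (map fst B)" by simp
    have mB': "map ((\<circ>) (\<sigma> i)) (map fst B) = map fst (map (reflect i) (butlast B)) @ [\<sigma> i \<circ> fst (last B)]"
      unfolding mB[symmetric] map_reflect_snoc[OF B] by simp
    have sB: "map snd (map (reflect i) (butlast B)) = map snd (butlast B)" by simp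
    show "take (if ?dl then length A - 1 else length A) xs @
        map ((\<circ>) (\<sigma> i)) (drop (length A) (take (length A + length B) xs)) @
        drop (if ?dr then length A + length B else length A + length B - 1) xs = map fst (f_list i A B C t1)"
    proof -
      have "take (if ?dl then length A - 1 else length A) xs = map fst (if ?dl then butlast A else A)"
        using pieces(1,7) by simp
      moreover have "drop (if ?dr then length A + length B else length A + length B - 1) xs = map fst (if ?dr then C else last B # C)"
        using pieces(4,6) by simp
      ultimately show ?thesis unfolding pieces(3) mB' by (simp add: f_list_def del: One_nat_def)
    qed
    show "take (if ?dl then length A else length A + 1) as @
        drop (length A + 1) (take (length A + length B) as) @ [t1] @
        drop (if ?dr then Suc (length A + length B) else length A + length B) as = 0 # map snd (f_list i A B C t1)"
    proof -
      have "take (if ?dl then length A else length A + 1) as = 0 # map snd (if ?dl then butlast A else A)"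
        using pieces(8,13) by simp
      moreover have "drop (if ?dr then Suc (length A + length B) else length A + length B) as = map snd (if ?dr then C else last B # C)"
        using pieces(11,12) by simp
      moreover have "drop (length A + 1) (take (length A + length B) as) = map snd (map (reflect i) (butlast B))"
        using pieces(10) sB by simp
      ultimately show ?thesis by (simp add: f_list_def)
    qed
  qed
  thus ?thesis by (simp add: of_pairs_def xs_def as_def)
qed

section \<open>The root operators invert each other\<close>

text \<open>Heights stay as they are up to \<open>t0\<close>, are mirrored in the level
  \<open>m + 1\<close> up to \<open>t\<^sub>1\<close>, and rise by 2 afterwards. So the new minimum
  \<open>m + 1\<close> is last attained at \<open>t0\<close>, and the next level is first met from
  there at \<open>t\<^sub>1\<close>: exactly the two times at which the other operator acts.\<close>

lemma root_e_cases:
  assumes l: "ls_list zs" and nz: "height_min i zs \<noteq> 0"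
  obtains ws where "root_e D lam i (of_pairs zs) = Some (of_pairs ws)" "ls_list ws"
    "height_min i ws = height_min i zs + 1" "list_path lam 0 ws 1 = list_path lam 0 zs 1 + \<alpha> i"
    "root_f D lam i (of_pairs ws) = Some (of_pairs zs)"
proof -
  obtain A B C t0 where e: "e_data i zs A B C t0" and int: "height_min i zs \<in> \<int>"
    and neg: "\<forall>z\<in>set B. slope i (fst z) < 0" and Cn: "C \<noteq> [] \<longrightarrow> 0 \<le> slope i (fst (hd C))"
    and early: "\<And>t. 0 \<le> t \<Longrightarrow> t \<le> t0 \<Longrightarrow> height_min i zs + 1 \<le> height i zs t"
    by (rule e_data_exists[OF l nz]) (rule that)
  have zs: "zs = A @ B @ C" and B: "B \<noteq> []" and t0: "end_time A \<le> t0" "t0 < snd (hd B)"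
    and h: "height i zs t0 = height_min i zs + 1" "height i zs (end_time (A @ B)) = height_min i zs"
    and first: "\<And>t. 0 \<le> t \<Longrightarrow> t < end_time (A @ B) \<Longrightarrow> height_min i zs < height i zs t"
    and late: "\<And>t. t0 < t \<Longrightarrow> t \<le> end_time (A @ B) \<Longrightarrow> height i zs t < height_min i zs + 1"
    using e by (auto simp: e_data_def)
  note T = end_time_less[OF l[unfolded zs] B] and P = ls_list_parts[OF l[unfolded zs] B]
  let ?m = "height_min i zs" and ?t1 = "snd (last B)" and ?x = "fst (hd B)" and ?y = "fst (last B)"
  define ws where "ws = e_list i A B C t0"
  have et: "end_time (A @ B) = ?t1" using B by (simp add: end_time_last)
  have hb: "snd (hd B) \<le> ?t1"
    using ls_list_sorted_le[OF l] B unfolding zs by (cases B) (auto simp: sorted_append)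
  have t01: "0 \<le> t0" "t0 < ?t1" "?t1 \<le> 1" using T t0 hb by auto
  have lw: "ls_list ws" unfolding ws_def by (rule ls_list_e_list[OF l e int neg Cn])
  have path: "list_path lam 0 ws t = list_path lam 0 zs t - (height i zs (min t ?t1) - height i zs (min t t0)) *\<^sub>R \<alpha> i" for t
    unfolding ws_def by (rule list_path_e_list[OF l e, unfolded et])
  have hw: "height i ws t = height i zs t - 2 * (height i zs (min t ?t1) - height i zs (min t t0))" for t
    by (simp add: path)
  have h1: "height i ws t = height i zs t" if "t \<le> t0" for t
    using that t01 by (simp add: hw min_absorb1)
  have h2: "height i ws t = 2 * ?m + 2 - height i zs t" if "t0 \<le> t" "t \<le> ?t1" for t
    using that t01 h by (simp add: hw min_absorb1 min_absorb2)
  have h3: "height i ws t = height i zs t + 2" if "?t1 \<le> t" for t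
    using that t01 h et by (simp add: hw min_absorb1 min_absorb2)
  have above: "?m + 1 < height i ws t" if "t0 < t" "t \<le> 1" for t
    using late[of t] h2[of t] h3[of t] height_min(2)[OF l, of t i] that t01 et by (cases "t \<le> ?t1") auto
  have below: "height i ws t < ?m + 1 + 1" if "t0 \<le> t" "t < ?t1" for t
    using first[of t] h2[of t] that t01 et by auto
  have min: "height_min i ws = ?m + 1"
  proof (rule height_min_eqI)
    show "?m + 1 \<in> height i ws ` {0..1}"
      using h1[of t0] h t01 by (intro image_eqI[of _ _ t0]) auto
    show "?m + 1 \<le> height i ws t" if "t \<in> {0..1}" for t
      using above[of t] early[of t] h1[of t] that by (cases "t \<le> t0") auto
  qed
  let ?mg = "C \<noteq> [] \<and> \<sigma> i \<circ> ?y = fst (hd C)"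
  define A2 where "A2 = A @ (if t0 = end_time A then [] else [(?x, t0)])"
  \<comment> \<open>After a merge, the head of \<open>C\<close> contains the time
    \<open>t\<^sub>1\<close> in its interior and thus belongs to the block of the inverse
    operator.\<close>
  define B2 where "B2 = (if ?mg then map (reflect i) (butlast B) @ [hd C] else map (reflect i) B)"
  define C2 where "C2 = (if ?mg then tl C else C)"
  have eA2: "end_time A2 = t0" by (simp add: A2_def end_time_last)
  have ws2: "ws = A2 @ B2 @ C2" by (simp add: ws_def e_list_def A2_def B2_def C2_def)
  have B2: "B2 \<noteq> []" using B by (simp add: B2_def)
  have bB2: "butlast B2 = map (reflect i) (butlast B)" by (simp add: B2_def butlast_append map_butlast)
  have lB2: "fst (last B2) = \<sigma> i \<circ> ?y" "snd (last B2) = (if ?mg then snd (hd C) else ?t1)"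
    using B by (auto simp: B2_def last_map)
  have hB2: "fst (hd B2) = \<sigma> i \<circ> ?x"
  proof (cases "butlast B = []")
    case True
    hence "hd B = last B" using B by (metis append_butlast_last_id append_Nil list.sel(1))
    thus ?thesis using True B by (auto simp: B2_def hd_map)
  next
    case False
    hence "hd (butlast B) = hd B" by (cases B) auto
    thus ?thesis using False B by (auto simp: B2_def hd_map hd_append)
  qed
  have tb: "end_time (A2 @ butlast B2) < ?t1"
  proof (cases "butlast B = []")
    case True
    thus ?thesis using eA2 t01 by (simp add: bB2)
  next
    case False
    thus ?thesis using T(5) by (simp add: bB2 end_time_last last_map)
  qed
  have fd: "f_data i ws A2 B2 C2 ?t1"
    unfolding f_data_def min eA2
  proof (intro conjI allI impI)
    show "ws = A2 @ B2 @ C2" "B2 \<noteq> []" "end_time (A2 @ butlast B2) < ?t1" by (fact ws2 B2 tb)+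
    show "?t1 \<le> snd (last B2)" using lB2 T(8) by (auto simp: less_imp_le)
    show "height i ws ?t1 = ?m + 1 + 1" using h3[of ?t1] h et by simp
    show "height i ws t0 = ?m + 1" using h1[of t0] h by simp
    show "?m + 1 < height i ws t" if "t0 < t \<and> t \<le> 1" for t using above that by blast
    show "height i ws t < ?m + 1 + 1" if "t0 \<le> t \<and> t < ?t1" for t using below that by blast
  qed
  have fl: "f_list i A2 B2 C2 ?t1 = zs"
  proof -
    \<comment> \<open>An entry inserted at \<open>t0\<close> meets the condition for being dropped;
      without one the condition fails, because neighbouring directions of \<open>zs\<close>
      differ.\<close>
    have 1: "(if A2 \<noteq> [] \<and> fst (last A2) = \<sigma> i \<circ> fst (hd B2) then butlast A2 else A2) = A"
    proof (cases "t0 = end_time A")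
      case True
      thus ?thesis using P(4) by (auto simp: A2_def hB2 ls_step_def)
    next
      case False
      thus ?thesis by (simp add: A2_def hB2)
    qed
    have 2: "map (reflect i) (butlast B2) @ [(\<sigma> i \<circ> fst (last B2), ?t1)] = B"
      using B by (simp add: bB2 lB2 del: map_map)
    have 3: "(if ?t1 = snd (last B2) then C2 else last B2 # C2) = C"
    proof (cases ?mg)
      case True
      thus ?thesis using lB2(2) T(8) by (simp add: B2_def C2_def)
    next
      case False
      thus ?thesis using lB2(2) unfolding C2_def by argo
    qed
    show ?thesis unfolding f_list_def 1 2 3 by (simp add: zs)
  qed
  show ?thesis
  proof (rule that)
    show "root_e D lam i (of_pairs zs) = Some (of_pairs ws)"
      unfolding ws_def by (rule root_e_e_list[OF l e nz])
    show "list_path lam 0 ws 1 = list_path lam 0 zs 1 + \<alpha> i"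
      using h et t01 by (simp add: path min_absorb2)
    show "root_f D lam i (of_pairs ws) = Some (of_pairs zs)"
      using root_f_f_list[OF lw fd] above[of 1] t01 unfolding fl min by simp
  qed (fact lw min)+
qed

text \<open>Dually, heights are mirrored in the level \<open>m\<close> between the two times and
  fall by 2 afterwards. The new minimum \<open>m - 1\<close> is first attained at \<open>t1\<close>,
  and the level \<open>m\<close> is last met before that at the old
  \<open>t\<^sub>0\<close>.\<close>

lemma root_f_cases:
  assumes l: "ls_list zs" and nz: "height i zs 1 \<noteq> height_min i zs"
  obtains ws where "root_f D lam i (of_pairs zs) = Some (of_pairs ws)" "ls_list ws"
    "height_min i ws = height_min i zs - 1" "list_path lam 0 ws 1 = list_path lam 0 zs 1 - \<alpha> i"
    "root_e D lam i (of_pairs ws) = Some (of_pairs zs)"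
proof -
  obtain A B C t1 where e: "f_data i zs A B C t1" and int: "height_min i zs \<in> \<int>"
    and pos: "\<forall>z\<in>set B. 0 < slope i (fst z)" and An: "A \<noteq> [] \<longrightarrow> slope i (fst (last A)) \<le> 0"
    and after: "\<And>t. t1 \<le> t \<Longrightarrow> t \<le> 1 \<Longrightarrow> height_min i zs + 1 \<le> height i zs t"
    by (rule f_data_exists[OF l nz]) (rule that)
  have zs: "zs = A @ B @ C" and B: "B \<noteq> []" and t1: "end_time (A @ butlast B) < t1" "t1 \<le> snd (last B)"
    and h: "height i zs t1 = height_min i zs + 1" "height i zs (end_time A) = height_min i zs"
    and late: "\<And>t. end_time A < t \<Longrightarrow> t \<le> 1 \<Longrightarrow> height_min i zs < height i zs t"
    and early: "\<And>t. end_time A \<le> t \<Longrightarrow> t < t1 \<Longrightarrow> height i zs t < height_min i zs + 1"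
    using e by (auto simp: f_data_def)
  note T = end_time_less[OF l[unfolded zs] B] and P = ls_list_parts[OF l[unfolded zs] B]
  let ?m = "height_min i zs" and ?t0 = "end_time A" and ?x = "fst (hd B)" and ?y = "fst (last B)"
  define ws where "ws = f_list i A B C t1"
  have t01: "0 \<le> ?t0" "?t0 < t1" "t1 \<le> 1" using T t1 by auto
  have lw: "ls_list ws" unfolding ws_def by (rule ls_list_f_list[OF l e int pos An])
  have path: "list_path lam 0 ws t = list_path lam 0 zs t - (height i zs (min t t1) - height i zs (min t ?t0)) *\<^sub>R \<alpha> i" for t
    unfolding ws_def by (rule list_path_f_list[OF l e])
  have hw: "height i ws t = height i zs t - 2 * (height i zs (min t t1) - height i zs (min t ?t0))" for t
    by (simp add: path)
  have h1: "height i ws t = height i zs t" if "t \<le> ?t0" for t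
    using that t01 by (simp add: hw min_absorb1)
  have h2: "height i ws t = 2 * ?m - height i zs t" if "?t0 \<le> t" "t \<le> t1" for t
    using that t01 h by (simp add: hw min_absorb1 min_absorb2)
  have h3: "height i ws t = height i zs t - 2" if "t1 \<le> t" for t
    using that t01 h by (simp add: hw min_absorb1 min_absorb2)
  have above: "?m - 1 < height i ws t" if "0 \<le> t" "t < t1" for t
    using early[of t] h1[of t] h2[of t] height_min(2)[OF l, of t i] that t01 by (cases "t \<le> ?t0") auto
  have below: "height i ws t < ?m" if "?t0 < t" "t \<le> t1" for t
    using late[of t] h2[of t] that t01 by auto
  have ht1: "height i ws t1 = ?m - 1" using h3[of t1] h by simp
  have min: "height_min i ws = ?m - 1"
  proof (rule height_min_eqI)
    show "?m - 1 \<in> height i ws ` {0..1}"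
      using ht1 t01 by (intro image_eqI[of _ _ t1]) auto
    show "?m - 1 \<le> height i ws t" if "t \<in> {0..1}" for t
      using above[of t] after[of t] h3[of t] that by (cases "t < t1") auto
  qed
  let ?dl = "A \<noteq> [] \<and> fst (last A) = \<sigma> i \<circ> ?x"
  \<comment> \<open>If the last entry of \<open>A\<close> was absorbed, \<open>?t0\<close> lies
    inside the first segment of \<open>B2\<close>, and the inverse operator cuts there
    again.\<close>
  define A2 where "A2 = (if ?dl then butlast A else A)"
  define B2 where "B2 = map (reflect i) (butlast B) @ [(\<sigma> i \<circ> ?y, t1)]"
  define C2 where "C2 = (if t1 = snd (last B) then C else last B # C)"
  have ws2: "ws = A2 @ B2 @ C2" by (simp add: ws_def f_list_def A2_def B2_def C2_def)
  have B2: "B2 \<noteq> []" by (simp add: B2_def)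
  have eB: "end_time (A2 @ B2) = t1" by (simp add: B2_def end_time_last)
  have hB2: "fst (hd B2) = \<sigma> i \<circ> ?x \<and> ?t0 < snd (hd B2)"
  proof (cases "butlast B = []")
    case True
    hence "hd B = last B" using B by (metis append_butlast_last_id append_Nil list.sel(1))
    thus ?thesis using True t01 by (auto simp: B2_def)
  next
    case False
    hence "hd (butlast B) = hd B" by (cases B) auto
    thus ?thesis using False T(2) by (auto simp: B2_def hd_map hd_append)
  qed
  have eA: "end_time A2 \<le> ?t0 \<and> (?dl \<longrightarrow> end_time A2 < ?t0)"
  proof (cases ?dl)
    case True
    have "zs = butlast A @ [last A] @ (B @ C)" using True by (simp add: zs)
    hence "end_time (butlast A) < snd (last A)" using end_time_less(2)[of "butlast A" "[last A]" "B @ C"] l by simp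
    thus ?thesis using True by (simp add: A2_def end_time_last)
  next
    case False
    thus ?thesis by (auto simp: A2_def)
  qed
  have ed: "e_data i ws A2 B2 C2 ?t0"
    unfolding e_data_def min eB
  proof (intro conjI allI impI)
    show "ws = A2 @ B2 @ C2" "B2 \<noteq> []" by (fact ws2 B2)+
    show "end_time A2 \<le> ?t0" "?t0 < snd (hd B2)" using eA hB2 by blast+
    show "height i ws ?t0 = ?m - 1 + 1" using h1[of ?t0] h by simp
    show "height i ws t1 = ?m - 1" by (rule ht1)
  qed (use above below in auto)
  have el: "e_list i A2 B2 C2 ?t0 = zs"
  proof -
    have 1: "A2 @ (if ?t0 = end_time A2 then [] else [(fst (hd B2), ?t0)]) = A"
    proof (cases ?dl)
      case True
      hence "(fst (hd B2), ?t0) = last A" using hB2 by (simp add: end_time_last prod_eq_iff)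
      thus ?thesis using True eA by (simp add: A2_def)
    next
      case False
      thus ?thesis unfolding A2_def by auto
    qed
    have l2: "\<sigma> i \<circ> fst (last B2) = ?y" by (simp add: B2_def)
    have 2: "(if C2 \<noteq> [] \<and> \<sigma> i \<circ> fst (last B2) = fst (hd C2) then map (reflect i) (butlast B2) else map (reflect i) B2) @ C2 = B @ C"
    proof (cases "t1 = snd (last B)")
      case True
      have "\<not> (C \<noteq> [] \<and> ?y = fst (hd C))" using P(5) by (auto simp: ls_step_def)
      moreover have "map (reflect i) B2 = butlast B @ [(?y, snd (last B))]" by (simp add: B2_def True del: map_map)
      ultimately show ?thesis using B True unfolding l2 C2_def by auto
    next
      case False
      moreover have "map (reflect i) (butlast B2) = butlast B" by (simp add: B2_def del: map_map)
      ultimately show ?thesis using B unfolding l2 C2_def by simp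
    qed
    show ?thesis unfolding e_list_def 1 2 by (simp add: zs)
  qed
  show ?thesis
  proof (rule that)
    show "root_f D lam i (of_pairs zs) = Some (of_pairs ws)"
      unfolding ws_def by (rule root_f_f_list[OF l e nz])
    show "list_path lam 0 ws 1 = list_path lam 0 zs 1 - \<alpha> i"
      using h t01 by (simp add: path min_absorb2)
    show "root_e D lam i (of_pairs ws) = Some (of_pairs zs)"
      using root_e_e_list[OF lw ed] height_min(3)[OF l, of i] unfolding el min by simp
  qed (fact lw min)+
qed

end

subsection \<open>The crystal structure\<close>

lemma op_power_0 [simp]: "op_power g 0 b = Some b"
  by (simp add: op_power_def)

lemma op_power_Suc: "op_power g (Suc n) b = (case g b of None \<Rightarrow> None | Some c \<Rightarrow> op_power g n c)"
proof -
  have "((\<lambda>z. Option.bind z g) ^^ n) None = None" by (induction n) auto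
  thus ?thesis by (simp add: op_power_def funpow_Suc_right del: funpow.simps split: option.split)
qed

text \<open>\<open>N\<close> is a counter that every successful application lowers by one and that
  is zero exactly where the operator fails.\<close>

lemma op_power_None_iff:
  assumes step: "\<And>b. b \<in> S \<Longrightarrow> (N b = 0 \<and> g b = None) \<or> (\<exists>c\<in>S. g b = Some c \<and> N b = Suc (N c))"
    and "b \<in> S"
  shows "op_power g n b \<noteq> None \<longleftrightarrow> n \<le> N b"
  using assms(2)
proof (induction n arbitrary: b)
  case (Suc n)
  from step[OF Suc.prems] show ?case
  proof (elim disjE conjE bexE)
    fix c assume "c \<in> S" "g b = Some c" "N b = Suc (N c)"
    thus ?thesis using Suc.IH[of c] by (simp add: op_power_Suc)
  qed (simp add: op_power_Suc)
qed simp

lemma op_depth_eq: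
  assumes "\<And>b. b \<in> S \<Longrightarrow> (N b = 0 \<and> g b = None) \<or> (\<exists>c\<in>S. g b = Some c \<and> N b = Suc (N c))" "b \<in> S"
  shows "finite {n. op_power g n b \<noteq> None}" "op_depth g b = N b"
proof -
  have e: "{n. op_power g n b \<noteq> None} = {..N b}"
    using op_power_None_iff[where g = g and N = N and S = S, OF assms] by auto
  show "finite {n. op_power g n b \<noteq> None}" unfolding e by simp
  show "op_depth g b = N b" unfolding op_depth_def e by (intro Max_eqI) auto
qed

context dominant_weight
begin

lemma wt_of_pairs: "wt lam (of_pairs zs) = list_path lam 0 zs 1"
  by (simp add: wt_def sils_path_of_pairs)

lemma height_min_int:
  assumes "ls_list zs"
  shows "height_min i zs \<in> \<int>"
proof (cases "height_min i zs = 0")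
  case False
  show ?thesis by (rule e_data_exists[OF assms False])
qed simp

definition e_depth :: "'i \<Rightarrow> 'v sils \<Rightarrow> nat" where
  "e_depth i \<eta> = nat \<lfloor>- H_min D lam i \<eta>\<rfloor>"

definition f_depth :: "'i \<Rightarrow> 'v sils \<Rightarrow> nat" where
  "f_depth i \<eta> = nat \<lfloor>\<kappa> i (wt lam \<eta>) - H_min D lam i \<eta>\<rfloor>"

lemma e_depth: "ls_list zs \<Longrightarrow> real (e_depth i (of_pairs zs)) = - height_min i zs"
  using height_min(3)[of zs i] height_min_int[of zs i]
  by (auto simp: e_depth_def H_min_of_pairs elim!: Ints_cases)

lemma f_depth:
  assumes "ls_list zs"
  shows "real (f_depth i (of_pairs zs)) = height i zs 1 - height_min i zs"
proof -
  have "height i zs 1 - height_min i zs \<in> \<int>"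
    using coroot_integral[OF list_path_end[OF assms]] height_min_int[OF assms] by (intro Ints_diff)
  moreover have "0 \<le> height i zs 1 - height_min i zs" using height_min(2)[OF assms, of 1 i] by simp
  ultimately show ?thesis by (auto simp: f_depth_def H_min_of_pairs wt_of_pairs elim!: Ints_cases)
qed

lemma root_e_SiLS:
  assumes "\<eta> \<in> SiLS D lam"
  shows "(e_depth i \<eta> = 0 \<and> root_e D lam i \<eta> = None) \<or>
    (\<exists>\<eta>'\<in>SiLS D lam. root_e D lam i \<eta> = Some \<eta>' \<and> e_depth i \<eta> = Suc (e_depth i \<eta>') \<and>
      f_depth i \<eta>' = Suc (f_depth i \<eta>) \<and> wt lam \<eta>' = wt lam \<eta> + \<alpha> i \<and> root_f D lam i \<eta>' = Some \<eta>)"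
proof -
  obtain zs where e: "\<eta> = of_pairs zs" and l: "ls_list zs" by (rule SiLS_cases[OF assms])
  show ?thesis
  proof (cases "height_min i zs = 0")
    case True
    hence "real (e_depth i \<eta>) = 0" unfolding e using e_depth[OF l, of i] by simp
    thus ?thesis using True root_e_None unfolding e by simp
  next
    case False
    obtain ws where w: "root_e D lam i (of_pairs zs) = Some (of_pairs ws)" "ls_list ws"
      "height_min i ws = height_min i zs + 1" "list_path lam 0 ws 1 = list_path lam 0 zs 1 + \<alpha> i"
      "root_f D lam i (of_pairs ws) = Some (of_pairs zs)" by (rule root_e_cases[OF l False])
    have "real (e_depth i \<eta>) = real (Suc (e_depth i (of_pairs ws)))"
      unfolding e using e_depth[OF l, of i] e_depth[OF w(2), of i] w(3) by simp
    moreover have "real (f_depth i (of_pairs ws)) = real (Suc (f_depth i \<eta>))"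
      unfolding e using f_depth[OF l, of i] f_depth[OF w(2), of i] w(3,4) by simp
    ultimately show ?thesis
      using w SiLS_of_pairs[of ws] unfolding e by (intro disjI2 bexI[of _ "of_pairs ws"]) (simp_all add: wt_of_pairs)
  qed
qed

lemma root_f_SiLS:
  assumes "\<eta> \<in> SiLS D lam"
  shows "(f_depth i \<eta> = 0 \<and> root_f D lam i \<eta> = None) \<or>
    (\<exists>\<eta>'\<in>SiLS D lam. root_f D lam i \<eta> = Some \<eta>' \<and> f_depth i \<eta> = Suc (f_depth i \<eta>') \<and>
      e_depth i \<eta>' = Suc (e_depth i \<eta>) \<and> wt lam \<eta>' = wt lam \<eta> - \<alpha> i \<and> root_e D lam i \<eta>' = Some \<eta>)"
proof -
  obtain zs where e: "\<eta> = of_pairs zs" and l: "ls_list zs" by (rule SiLS_cases[OF assms])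
  show ?thesis
  proof (cases "height i zs 1 = height_min i zs")
    case True
    hence "real (f_depth i \<eta>) = 0" unfolding e using f_depth[OF l, of i] by simp
    thus ?thesis using True root_f_None unfolding e by simp
  next
    case False
    obtain ws where w: "root_f D lam i (of_pairs zs) = Some (of_pairs ws)" "ls_list ws"
      "height_min i ws = height_min i zs - 1" "list_path lam 0 ws 1 = list_path lam 0 zs 1 - \<alpha> i"
      "root_e D lam i (of_pairs ws) = Some (of_pairs zs)" by (rule root_f_cases[OF l False])
    have "real (f_depth i \<eta>) = real (Suc (f_depth i (of_pairs ws)))"
      unfolding e using f_depth[OF l, of i] f_depth[OF w(2), of i] w(3,4) by simp
    moreover have "real (e_depth i (of_pairs ws)) = real (Suc (e_depth i \<eta>))"
      unfolding e using e_depth[OF l, of i] e_depth[OF w(2), of i] w(3) by simp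
    ultimately show ?thesis
      using w SiLS_of_pairs[of ws] unfolding e by (intro disjI2 bexI[of _ "of_pairs ws"]) (simp_all add: wt_of_pairs)
  qed
qed

lemma root_e_depth:
  assumes "\<eta> \<in> SiLS D lam"
  shows "finite {n. op_power (root_e D lam i) n \<eta> \<noteq> None}" "op_depth (root_e D lam i) \<eta> = e_depth i \<eta>"
proof -
  have "(e_depth i b = 0 \<and> root_e D lam i b = None) \<or>
      (\<exists>c\<in>SiLS D lam. root_e D lam i b = Some c \<and> e_depth i b = Suc (e_depth i c))"
    if "b \<in> SiLS D lam" for b
    using root_e_SiLS[OF that, of i] by blast
  from op_depth_eq[where N = "e_depth i", OF this assms]
  show "finite {n. op_power (root_e D lam i) n \<eta> \<noteq> None}" "op_depth (root_e D lam i) \<eta> = e_depth i \<eta>"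
    by blast+
qed

lemma root_f_depth:
  assumes "\<eta> \<in> SiLS D lam"
  shows "finite {n. op_power (root_f D lam i) n \<eta> \<noteq> None}" "op_depth (root_f D lam i) \<eta> = f_depth i \<eta>"
proof -
  have "(f_depth i b = 0 \<and> root_f D lam i b = None) \<or>
      (\<exists>c\<in>SiLS D lam. root_f D lam i b = Some c \<and> f_depth i b = Suc (f_depth i c))"
    if "b \<in> SiLS D lam" for b
    using root_f_SiLS[OF that, of i] by blast
  from op_depth_eq[where N = "f_depth i", OF this assms]
  show "finite {n. op_power (root_f D lam i) n \<eta> \<noteq> None}" "op_depth (root_f D lam i) \<eta> = f_depth i \<eta>"
    by blast+
qed

lemma SiLS_crystal:
  "crystal D (SiLS D lam) (wt lam) (root_e D lam) (root_f D lam)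
     (\<lambda>i \<eta>. ereal (real (op_depth (root_e D lam i) \<eta>)))
     (\<lambda>i \<eta>. ereal (real (op_depth (root_f D lam i) \<eta>)))"
proof
  fix b i assume b: "b \<in> SiLS D lam"
  obtain zs where zs: "b = of_pairs zs" "ls_list zs" by (rule SiLS_cases[OF b])
  show "wt lam b \<in> weight_lattice D" using list_path_end[OF zs(2)] by (simp add: zs wt_of_pairs)
  show "root_e D lam i b \<in> insert None (Some ` SiLS D lam)" using root_e_SiLS[OF b, of i] by auto
  show "root_f D lam i b \<in> insert None (Some ` SiLS D lam)" using root_f_SiLS[OF b, of i] by auto
  show "ereal (real (op_depth (root_e D lam i) b)) \<in> insert (- \<infinity>) (range (\<lambda>n :: int. ereal (of_int n)))"
    "ereal (real (op_depth (root_f D lam i) b)) \<in> insert (- \<infinity>) (range (\<lambda>n :: int. ereal (of_int n)))"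
    by (intro insertI2, rule range_eqI[of _ _ "int _"], simp)+
  show "ereal (real (op_depth (root_f D lam i) b)) =
      ereal (real (op_depth (root_e D lam i) b)) + ereal (simple_coroot D i (wt lam b))"
    using e_depth[OF zs(2), of i] f_depth[OF zs(2), of i]
    unfolding root_e_depth(2)[OF b] root_f_depth(2)[OF b] by (simp add: zs(1) wt_of_pairs)
  show "ereal (real (op_depth (root_f D lam i) b)) = - \<infinity> \<Longrightarrow> root_e D lam i b = None \<and> root_f D lam i b = None"
    by simp
  {
    fix b' assume e: "root_e D lam i b = Some b'"
    hence b': "b' \<in> SiLS D lam" and d: "e_depth i b = Suc (e_depth i b')" "f_depth i b' = Suc (f_depth i b)"
      and w: "wt lam b' = wt lam b + \<alpha> i"
      using root_e_SiLS[OF b, of i] by auto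
    show "wt lam b' = wt lam b + \<alpha> i" by (rule w)
    show "ereal (real (op_depth (root_e D lam i) b')) = ereal (real (op_depth (root_e D lam i) b)) - 1"
      unfolding root_e_depth(2)[OF b] root_e_depth(2)[OF b'] d by (simp add: one_ereal_def)
    show "ereal (real (op_depth (root_f D lam i) b')) = ereal (real (op_depth (root_f D lam i) b)) + 1"
      unfolding root_f_depth(2)[OF b] root_f_depth(2)[OF b'] d by (simp add: one_ereal_def)
  }
  {
    fix b' assume e: "root_f D lam i b = Some b'"
    hence b': "b' \<in> SiLS D lam" and d: "f_depth i b = Suc (f_depth i b')" "e_depth i b' = Suc (e_depth i b)"
      and w: "wt lam b' = wt lam b - \<alpha> i"
      using root_f_SiLS[OF b, of i] by auto
    show "wt lam b' = wt lam b - \<alpha> i" by (rule w)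
    show "ereal (real (op_depth (root_e D lam i) b')) = ereal (real (op_depth (root_e D lam i) b)) + 1"
      unfolding root_e_depth(2)[OF b] root_e_depth(2)[OF b'] d by (simp add: one_ereal_def)
    show "ereal (real (op_depth (root_f D lam i) b')) = ereal (real (op_depth (root_f D lam i) b)) - 1"
      unfolding root_f_depth(2)[OF b] root_f_depth(2)[OF b'] d by (simp add: one_ereal_def)
  }
  fix b' assume b': "b' \<in> SiLS D lam"
  show "root_e D lam i b = Some b' \<longleftrightarrow> root_f D lam i b' = Some b"
    using root_e_SiLS[OF b, of i] root_f_SiLS[OF b', of i] by auto
qed

end

text \<open>Finiteness is asserted alongside because \<open>op_depth\<close> is a
  \<open>Max\<close>, which is unspecified on infinite sets; the sets contain 0, so both depths are
  genuine maxima.\<close>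

theorem theorem3p1p5:
  fixes D :: "('i::finite, 'v::real_vector) affine_datum"
    and lam :: 'v
  assumes "untwisted_affine D"
    and "lam \<in> dominant_weights D"
  shows
    "(\<forall>i. \<forall>z \<in> insert None (Some ` SiLS D lam).
        Option.bind z (root_e D lam i) \<in> insert None (Some ` SiLS D lam) \<and>
        Option.bind z (root_f D lam i) \<in> insert None (Some ` SiLS D lam)) \<and>
     (\<forall>i. \<forall>\<eta> \<in> SiLS D lam.
        finite {n. op_power (root_e D lam i) n \<eta> \<noteq> None} \<and>
        finite {n. op_power (root_f D lam i) n \<eta> \<noteq> None}) \<and>
     crystal D (SiLS D lam) (wt lam) (root_e D lam) (root_f D lam)
       (\<lambda>i \<eta>. ereal (real (op_depth (root_e D lam i) \<eta>)))
       (\<lambda>i \<eta>. ereal (real (op_depth (root_f D lam i) \<eta>)))"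
proof -
  interpret untwisted_affine D by (rule assms(1))
  interpret dominant_weight D lam by unfold_locales (rule assms(2))
  show ?thesis
  proof (intro conjI allI ballI)
    fix i z
    assume "z \<in> insert None (Some ` SiLS D lam)"
    thus "Option.bind z (root_e D lam i) \<in> insert None (Some ` SiLS D lam)"
      "Option.bind z (root_f D lam i) \<in> insert None (Some ` SiLS D lam)"
      using root_e_SiLS[of _ i] root_f_SiLS[of _ i] by fastforce+
  qed (use root_e_depth(1) root_f_depth(1) SiLS_crystal in auto)
qed

end
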